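(* Let $d$ be the dimension, $\epsilon = 1/d^4$, and $\delta\in[0,1]$. Any deterministic first-order algorithm (in the memory-constrained model below) that is guaranteed to minimize every $1$-Lipschitz convex function $f:\mathbb{R}^d\to\mathbb{R}$ over the unit ball $B_d(0,1)$ to accuracy $\epsilon$ either uses at least $d^{2-\delta}$ bits of memory, or makes $\tilde\Omega(d^{1+\delta/3})$ oracle queries (on some such function).
   Context: $B_d(\mathbf x,r)=\{\mathbf x'\in\mathbb{R}^d:\|\mathbf x-\mathbf x'\|_2\le r\}$. A first-order oracle for a convex $f$ returns, for each query $\mathbf x\in\mathbb{R}^d$, the pair $(f(\mathbf x),\mathbf g)$ with $\mathbf g$ a subgradient of $f$ at $\mathbf x$. An $M$-bit memory-constrained deterministic algorithm with access to an oracle $\mathcal O:\mathcal S\to\mathcal R$ is specified by a query function $\psi_{query}:\{0,1\}^M\to\mathcal S$ and an update function $\psi_{update}:\{0,1\}^M\times\mathcal S\times\mathcal R\to\{0,1\}^M$; it starts with memory $\mathsf{Memory}_0=0^M$, and at iteration $t$ it queries $q_t=\psi_{query}(\mathsf{Memory}_{t-1})$, receives $r_t=\mathcal O(q_t)$ and sets $\mathsf{Memory}_t=\psi_{update}(\mathsf{Memory}_{t-1},q_t,r_t)$ (internal computations are unrestricted in memory). It may stop at any iteration, and its last query is its output. The algorithm minimizes $f$ to accuracy $\epsilon$ if its output $\tilde{\mathbf x}\in B_d(0,1)$ satisfies $f(\tilde{\mathbf x})\le\min_{\mathbf x\in B_d(0,1)}f(\mathbf x)+\epsilon$. The notation $\tilde\Omega(\cdot)$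 hides universal constants and polylogarithmic factors in $d$ (the statement is asymptotic in $d$). *)

theory Defs
  imports "HOL-Analysis.Analysis"
begin

text \<open>Points of R^d are represented as functions nat \<Rightarrow> real vanishing at
  all coordinates i \<ge> d (the dimension d varies inside the statement).\<close>

definition vecs :: "nat \<Rightarrow> (nat \<Rightarrow> real) set" where
  "vecs d = {x. \<forall>i\<ge>d. x i = 0}"

definition enorm :: "nat \<Rightarrow> (nat \<Rightarrow> real) \<Rightarrow> real" where
  "enorm d x = sqrt (\<Sum>i<d. (x i)^2)"

definition inner_d :: "nat \<Rightarrow> (nat \<Rightarrow> real) \<Rightarrow> (nat \<Rightarrow> real) \<Rightarrow> real" where
  "inner_d d x y = (\<Sum>i<d. x i * y i)"

definition unit_ball :: "nat \<Rightarrow> (nat \<Rightarrow> real) set" where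
  "unit_ball d = {x \<in> vecs d. enorm d x \<le> 1}"

definition convex_d :: "nat \<Rightarrow> ((nat \<Rightarrow> real) \<Rightarrow> real) \<Rightarrow> bool" where
  "convex_d d f = (\<forall>x\<in>vecs d. \<forall>y\<in>vecs d. \<forall>t::real. 0 \<le> t \<and> t \<le> 1 \<longrightarrow>
      f (\<lambda>i. t * x i + (1 - t) * y i) \<le> t * f x + (1 - t) * f y)"

definition lipschitz1_d :: "nat \<Rightarrow> ((nat \<Rightarrow> real) \<Rightarrow> real) \<Rightarrow> bool" where
  "lipschitz1_d d f = (\<forall>x\<in>vecs d. \<forall>y\<in>vecs d. \<bar>f x - f y\<bar> \<le> enorm d (\<lambda>i. x i - y i))"

definition is_subgrad :: "nat \<Rightarrow> ((nat \<Rightarrow> real) \<Rightarrow> real) \<Rightarrow> (nat \<Rightarrow> real) \<Rightarrow> (nat \<Rightarrow> real) \<Rightarrow> bool" where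
  "is_subgrad d f x g = (g \<in> vecs d \<and>
      (\<forall>y\<in>vecs d. f y \<ge> f x + inner_d d g (\<lambda>i. y i - x i)))"

definition first_order_oracle ::
  "nat \<Rightarrow> ((nat \<Rightarrow> real) \<Rightarrow> real) \<Rightarrow> ((nat \<Rightarrow> real) \<Rightarrow> real \<times> (nat \<Rightarrow> real)) \<Rightarrow> bool" where
  "first_order_oracle d f orc = (\<forall>x\<in>vecs d. fst (orc x) = f x \<and> is_subgrad d f x (snd (orc x)))"

record alg =
  query :: "bool list \<Rightarrow> (nat \<Rightarrow> real)"
  update :: "bool list \<Rightarrow> (nat \<Rightarrow> real) \<Rightarrow> real \<times> (nat \<Rightarrow> real) \<Rightarrow> bool list"
  stop :: "bool list \<Rightarrow> (nat \<Rightarrow> real) \<Rightarrow> real \<times> (nat \<Rightarrow> real) \<Rightarrow> bool"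

definition valid_alg :: "nat \<Rightarrow> nat \<Rightarrow> alg \<Rightarrow> bool" where
  "valid_alg d M A = (\<forall>m. length m = M \<longrightarrow> query A m \<in> vecs d \<and>
      (\<forall>q r. length (update A m q r) = M))"

fun memseq :: "alg \<Rightarrow> nat \<Rightarrow> ((nat \<Rightarrow> real) \<Rightarrow> real \<times> (nat \<Rightarrow> real)) \<Rightarrow> nat \<Rightarrow> bool list" where
  "memseq A M orc 0 = replicate M False"
| "memseq A M orc (Suc t) =
     (let m = memseq A M orc t; q = query A m in update A m q (orc q))"

text \<open>stops_at A M orc t: the algorithm stops at iteration t+1 (whose query is
  query A (Memory_t)).\<close>
definition stops_at :: "alg \<Rightarrow> nat \<Rightarrow> ((nat \<Rightarrow> real) \<Rightarrow> real \<times> (nat \<Rightarrow> real)) \<Rightarrow> nat \<Rightarrow> bool" where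
  "stops_at A M orc t = (let m = memseq A M orc t; q = query A m in stop A m q (orc q))"

definition halts :: "alg \<Rightarrow> nat \<Rightarrow> ((nat \<Rightarrow> real) \<Rightarrow> real \<times> (nat \<Rightarrow> real)) \<Rightarrow> bool" where
  "halts A M orc = (\<exists>t. stops_at A M orc t)"

definition num_queries :: "alg \<Rightarrow> nat \<Rightarrow> ((nat \<Rightarrow> real) \<Rightarrow> real \<times> (nat \<Rightarrow> real)) \<Rightarrow> nat" where
  "num_queries A M orc = Suc (LEAST t. stops_at A M orc t)"

definition alg_output :: "alg \<Rightarrow> nat \<Rightarrow> ((nat \<Rightarrow> real) \<Rightarrow> real \<times> (nat \<Rightarrow> real)) \<Rightarrow> (nat \<Rightarrow> real)" where
  "alg_output A M orc = query A (memseq A M orc (LEAST t. stops_at A M orc t))"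

definition minimizes :: "nat \<Rightarrow> nat \<Rightarrow> alg \<Rightarrow> real \<Rightarrow> bool" where
  "minimizes d M A eps = (\<forall>f orc. convex_d d f \<and> lipschitz1_d d f \<and> first_order_oracle d f orc \<longrightarrow>
      halts A M orc \<and> alg_output A M orc \<in> unit_ball d \<and>
      (\<forall>x\<in>unit_ball d. f (alg_output A M orc) \<le> f x + eps))"

end

theory Submission
  imports Defs "HOL-Real_Asymp.Real_Asymp"
begin

text \<open>
  The hard functions are
  \<open>f(x) = max {|x| - 1, max\<^sub>i |a\<^sub>i \<bullet> x| - \<eta>, max\<^sub>j (\<beta> v\<^sub>j \<bullet> x - o\<^sub>j)}\<close>
  with rows \<open>a\<^sub>i\<close> taken from a fine grid and vectors \<open>v\<^sub>j\<close> that a resisting oracle releases one at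
  a time, in \<open>P\<close> periods of \<open>k\<close> vectors. A new vector is released only at a query \<open>x\<close> that is nearly
  orthogonal to all rows, is low on the vectors released so far, and is robustly independent of the
  other such (explored) queries of its period. It is a scaled difference of two sign vectors, nearly
  orthogonal to the explored queries of its period and incoherent with everything else seen so far;
  this makes the answers consistent with the final \<open>f\<close> and makes the optimum low, so that the
  algorithm must explore \<open>P k\<close> queries.

  Count pairs \<open>(A, V)\<close> of a row matrix and a compatible sequence of vectors. By pigeonhole a fraction
  \<open>d\<^bsup>-O(k)\<^esup>\<close> of the difference vectors is admissible at each step, so each \<open>A\<close> has many partners \<open>V\<close>.
  Conversely fix \<open>V\<close>. If the algorithm is fast, some period uses few queries, and the \<open>k\<close> queries
  explored in it can be recomputed from the \<open>M\<close> bits of memory at its start and the few rows seen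
  during it. All remaining rows are nearly orthogonal to these \<open>k\<close> robustly independent vectors,
  and at most a fraction \<open>3 / 2\<^sup>k\<close> of the grid points has this property. Comparing both counts gives
  \<open>M = \<Omega>(k n)\<close> for \<open>n\<close> rows, up to logarithms.
\<close>

section \<open>Euclidean geometry in coordinates\<close>

text \<open>Where the exponent comes from: each period lowers the level by
  \<open>\<gamma>\<^sub>1\<close>, which has to exceed the noise \<open>4 * \<beta> * s\<close> with
  s about sqrt (ln d / d), whereas the optimum is only about \<beta> / sqrt (P k) below zero. So P
  sqrt (P k) must stay below sqrt d, that is P^3 k below d, up to logarithms. The number n of rows
  is d up to logarithms, and M bits are too few once k n reaches 16 M; hence k is about
  d^(1-\<delta>) and P about d^(\<delta>/3). A period of m = n / 4 queries reveals at most half of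
  the rows, since each step consults two maxima. The P periods together therefore take about P m
  queries, which is d^(1+\<delta>/3).

  The obstacle: the vectors are chosen after the rows and in reaction to them, so V carries
  information about A, yet the decoder is given all of V. The admissible fraction bounds this leak:
  P k + 1 vectors at O(k log d) bits each must cost far less than the k n bits saved, which is a
  second condition, P k below n up to logarithms.\<close>

lemma inner_d_commute: "inner_d d x y = inner_d d y x"
  unfolding inner_d_def by (simp add: mult.commute)

lemma inner_d_add_left: "inner_d d (\<lambda>i. x i + y i) z = inner_d d x z + inner_d d y z"
  unfolding inner_d_def by (simp add: distrib_right sum.distrib)

lemma inner_d_diff_left: "inner_d d (\<lambda>i. x i - y i) z = inner_d d x z - inner_d d y z"
  unfolding inner_d_def by (simp add: left_diff_distrib sum_subtractf)

lemma inner_d_scale_left: "inner_d d (\<lambda>i. c * x i) z = c * inner_d d x z"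
  unfolding inner_d_def by (simp add: sum_distrib_left mult.assoc)

lemma inner_d_divide_left: "inner_d d (\<lambda>i. x i / c) z = inner_d d x z / c"
  unfolding inner_d_def by (simp add: sum_divide_distrib)

lemma inner_d_add_right: "inner_d d z (\<lambda>i. x i + y i) = inner_d d z x + inner_d d z y"
  by (metis inner_d_commute inner_d_add_left)

lemma inner_d_diff_right: "inner_d d z (\<lambda>i. x i - y i) = inner_d d z x - inner_d d z y"
  by (metis inner_d_commute inner_d_diff_left)

lemma inner_d_scale_right: "inner_d d z (\<lambda>i. c * x i) = c * inner_d d z x"
  by (metis inner_d_commute inner_d_scale_left)

lemma inner_d_divide_right: "inner_d d z (\<lambda>i. x i / c) = inner_d d z x / c"
  by (metis inner_d_commute inner_d_divide_left)

lemma inner_d_zero_left [simp]: "inner_d d (\<lambda>i. 0) z = 0"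
  and inner_d_zero_right [simp]: "inner_d d z (\<lambda>i. 0) = 0"
  unfolding inner_d_def by simp_all

lemma inner_d_sum_list_left:
  "inner_d d (\<lambda>i. \<Sum>u\<leftarrow>us. f u * g u i) z = (\<Sum>u\<leftarrow>us. f u * inner_d d (g u) z)"
  by (induction us) (simp_all add: inner_d_add_left inner_d_scale_left)

lemma inner_d_sum_list_right:
  "inner_d d z (\<lambda>i. \<Sum>u\<leftarrow>us. f u * g u i) = (\<Sum>u\<leftarrow>us. f u * inner_d d z (g u))"
  by (induction us) (simp_all add: inner_d_add_right inner_d_scale_right)

lemmas inner_d_linear =
  inner_d_add_left inner_d_diff_left inner_d_scale_left inner_d_divide_left
  inner_d_add_right inner_d_diff_right inner_d_scale_right inner_d_divide_right

lemma enorm_eq_L2_set: "enorm d x = L2_set x {..<d}"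
  unfolding enorm_def L2_set_def ..

lemma enorm_nonneg [simp]: "0 \<le> enorm d x"
  by (simp add: enorm_eq_L2_set)

lemma enorm_power2: "(enorm d x)\<^sup>2 = inner_d d x x"
  unfolding enorm_def inner_d_def by (simp add: power2_eq_square sum_nonneg)

lemma inner_d_self_nonneg [simp]: "0 \<le> inner_d d x x"
  by (metis enorm_power2 zero_le_power2)

lemma enorm_mult_self: "enorm d x * enorm d x = inner_d d x x"
  by (metis enorm_power2 power2_eq_square)

lemma inner_d_le_enorm: "\<bar>inner_d d x y\<bar> \<le> enorm d x * enorm d y"
proof -
  have "\<bar>inner_d d x y\<bar> \<le> (\<Sum>i<d. \<bar>x i\<bar> * \<bar>y i\<bar>)"
    unfolding inner_d_def by (rule order_trans[OF sum_abs]) (simp add: abs_mult)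
  also have "\<dots> \<le> enorm d x * enorm d y"
    unfolding enorm_eq_L2_set by (rule L2_set_mult_ineq)
  finally show ?thesis .
qed

lemma enorm_scale: "enorm d (\<lambda>i. c * x i) = \<bar>c\<bar> * enorm d x"
  unfolding enorm_def
  by (simp add: power_mult_distrib sum_distrib_left[symmetric] real_sqrt_mult)

lemma enorm_divide: "enorm d (\<lambda>i. x i / c) = enorm d x / \<bar>c\<bar>"
  using enorm_scale[of d "1 / c" x] by simp

lemma abs_le_enorm: "i < d \<Longrightarrow> \<bar>x i\<bar> \<le> enorm d x"
  unfolding enorm_eq_L2_set
  using member_le_L2_set[of "{..<d}" i "\<lambda>i. \<bar>x i\<bar>"] by (simp add: L2_set_def)

lemma enorm_zero [simp]: "enorm d (\<lambda>i. 0) = 0"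
  by (simp add: enorm_def)

section \<open>Projections, Gram-Schmidt and robust independence\<close>

definition proj :: "nat \<Rightarrow> (nat \<Rightarrow> real) list \<Rightarrow> (nat \<Rightarrow> real) \<Rightarrow> nat \<Rightarrow> real" where
  "proj d us x = (\<lambda>i. \<Sum>u\<leftarrow>us. inner_d d x u * u i)"

definition resid :: "nat \<Rightarrow> (nat \<Rightarrow> real) list \<Rightarrow> (nat \<Rightarrow> real) \<Rightarrow> nat \<Rightarrow> real" where
  "resid d us x = (\<lambda>i. x i - proj d us x i)"

definition orthonormal :: "nat \<Rightarrow> (nat \<Rightarrow> real) list \<Rightarrow> bool" where
  "orthonormal d us \<longleftrightarrow> sorted_wrt (\<lambda>u v. inner_d d u v = 0) us \<and> (\<forall>u\<in>set us. inner_d d u u = 1)"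

lemma orthonormal_snoc:
  "orthonormal d (us @ [u]) \<longleftrightarrow>
    orthonormal d us \<and> inner_d d u u = 1 \<and> (\<forall>v\<in>set us. inner_d d v u = 0)"
  unfolding orthonormal_def by (auto simp: sorted_wrt_append)

lemma orthonormal_enorm: "orthonormal d us \<Longrightarrow> u \<in> set us \<Longrightarrow> enorm d u = 1"
  unfolding orthonormal_def by (metis enorm_nonneg enorm_power2 one_power2 power2_eq_imp_eq zero_le_one)

lemma inner_d_proj_left: "inner_d d (proj d us x) y = (\<Sum>u\<leftarrow>us. inner_d d x u * inner_d d u y)"
  unfolding proj_def by (rule inner_d_sum_list_left)

lemma proj_snoc: "proj d (us @ [u]) x = (\<lambda>i. proj d us x i + inner_d d x u * u i)"
  unfolding proj_def by simp

lemma resid_snoc: "resid d (us @ [u]) x = (\<lambda>i. resid d us x i - inner_d d x u * u i)"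
  unfolding resid_def proj_snoc by (simp add: algebra_simps)

lemma proj_plus_resid: "x = (\<lambda>i. proj d us x i + resid d us x i)"
  unfolding resid_def by simp

lemma inner_d_decompose:
  "inner_d d v x = (\<Sum>u\<leftarrow>us. inner_d d x u * inner_d d v u) + inner_d d v (resid d us x)"
proof -
  have "inner_d d v x = inner_d d v (\<lambda>i. proj d us x i + resid d us x i)"
    using proj_plus_resid by simp
  then show ?thesis
    unfolding proj_def by (simp add: inner_d_add_right inner_d_sum_list_right)
qed

lemma sum_list_eq_0: "(\<And>u. u \<in> set us \<Longrightarrow> f u = 0) \<Longrightarrow> (\<Sum>u\<leftarrow>us. f u) = (0::real)"
  by (induction us) auto

lemma inner_d_proj:
  assumes "orthonormal d us" "u \<in> set us"
  shows "inner_d d (proj d us x) u = inner_d d x u"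
  using assms
proof (induction us rule: rev_induct)
  case (snoc a us)
  show ?case
  proof (cases "u \<in> set us")
    case True
    then show ?thesis
      using snoc by (simp add: proj_snoc inner_d_linear orthonormal_snoc inner_d_commute[of d a u])
  next
    case False
    then have "u = a" using snoc.prems by simp
    moreover have "inner_d d (proj d us x) a = 0"
      unfolding inner_d_proj_left using snoc.prems by (intro sum_list_eq_0) (simp add: orthonormal_snoc)
    ultimately show ?thesis
      using snoc.prems by (simp add: proj_snoc inner_d_linear orthonormal_snoc)
  qed
qed simp

lemma inner_d_resid_basis:
  "orthonormal d us \<Longrightarrow> u \<in> set us \<Longrightarrow> inner_d d (resid d us x) u = 0"
  unfolding resid_def by (simp add: inner_d_linear inner_d_proj)

lemma inner_d_resid_proj: "orthonormal d us \<Longrightarrow> inner_d d (resid d us x) (proj d us y) = 0"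
  unfolding proj_def inner_d_sum_list_right
  by (intro sum_list_eq_0) (simp add: inner_d_resid_basis)

lemma inner_d_resid_resid:
  assumes "orthonormal d us"
  shows "inner_d d (resid d us x) (resid d us y) = inner_d d x (resid d us y)"
    and "inner_d d (resid d us x) (resid d us y) = inner_d d (resid d us x) y"
proof -
  have "inner_d d x (resid d us y) = inner_d d (\<lambda>i. proj d us x i + resid d us x i) (resid d us y)"
    using proj_plus_resid by simp
  then show "inner_d d (resid d us x) (resid d us y) = inner_d d x (resid d us y)"
    using inner_d_resid_proj[OF assms, of y x]
    by (simp add: inner_d_add_left inner_d_commute[of d "proj d us x" "resid d us y"])
  have "inner_d d (resid d us x) y = inner_d d (resid d us x) (\<lambda>i. proj d us y i + resid d us y i)"
    using proj_plus_resid by simp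
  then show "inner_d d (resid d us x) (resid d us y) = inner_d d (resid d us x) y"
    using inner_d_resid_proj[OF assms, of x y] by (simp add: inner_d_add_right)
qed

lemma inner_d_resid_self:
  assumes "orthonormal d us"
  shows "inner_d d (resid d us x) (resid d us x) = inner_d d x x - (\<Sum>u\<leftarrow>us. (inner_d d x u)\<^sup>2)"
  using inner_d_decompose[of d x x us] inner_d_resid_resid(1)[OF assms, of x x]
  by (simp add: power2_eq_square)

lemma enorm_resid_le: "orthonormal d us \<Longrightarrow> enorm d (resid d us x) \<le> enorm d x"
  by (rule power2_le_imp_le)
    (auto simp: enorm_power2 inner_d_resid_self intro!: sum_list_nonneg)

text \<open>Since x / 0 = 0, a vector of norm 0 is normalized to the zero vector. Gram-Schmidt of an
  arbitrary list, dependent ones included, thus consists of vectors of norm at most 1.\<close>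

definition normalized :: "nat \<Rightarrow> (nat \<Rightarrow> real) \<Rightarrow> nat \<Rightarrow> real" where
  "normalized d x = (\<lambda>i. x i / enorm d x)"

lemma enorm_normalized_le: "enorm d (normalized d x) \<le> 1"
  unfolding normalized_def by (simp add: enorm_divide)

lemma inner_d_normalized_self: "enorm d x > 0 \<Longrightarrow> inner_d d (normalized d x) (normalized d x) = 1"
  unfolding normalized_def by (simp add: inner_d_linear enorm_mult_self[symmetric])

text \<open>One output per input, with nothing dropped: positions correspond, and the result on a
  prefix is a prefix of the result.\<close>

definition gram_schmidt :: "nat \<Rightarrow> (nat \<Rightarrow> real) list \<Rightarrow> (nat \<Rightarrow> real) list" where
  "gram_schmidt d xs = foldl (\<lambda>us x. us @ [normalized d (resid d us x)]) [] xs"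

lemma gram_schmidt_Nil [simp]: "gram_schmidt d [] = []"
  by (simp add: gram_schmidt_def)

lemma gram_schmidt_snoc:
  "gram_schmidt d (xs @ [x]) =
    gram_schmidt d xs @ [normalized d (resid d (gram_schmidt d xs) x)]"
  by (simp add: gram_schmidt_def)

lemma length_gram_schmidt [simp]: "length (gram_schmidt d xs) = length xs"
  by (induction xs rule: rev_induct) (auto simp: gram_schmidt_snoc)

lemma gram_schmidt_append:
  "\<exists>us. gram_schmidt d (xs @ ys) = gram_schmidt d xs @ us"
proof (induction ys rule: rev_induct)
  case (snoc y ys)
  then show ?case
    unfolding append_assoc[symmetric] gram_schmidt_snoc by force
qed simp

lemma set_gram_schmidt_append: "set (gram_schmidt d xs) \<subseteq> set (gram_schmidt d (xs @ ys))"
  using gram_schmidt_append[of d xs ys] by auto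

lemma enorm_gram_schmidt: "u \<in> set (gram_schmidt d xs) \<Longrightarrow> enorm d u \<le> 1"
  by (induction xs rule: rev_induct) (auto simp: gram_schmidt_snoc enorm_normalized_le)

text \<open>A quantitative linear independence that depends on the order. Appending a vector adds a
  single condition on its residual, which is the form in which the oracle examines a query.\<close>

definition robust :: "nat \<Rightarrow> real \<Rightarrow> (nat \<Rightarrow> real) list \<Rightarrow> bool" where
  "robust d \<rho> xs \<longleftrightarrow> (\<forall>l<length xs. \<rho> \<le> enorm d (resid d (gram_schmidt d (take l xs)) (xs ! l))
     \<and> enorm d (xs ! l) \<le> 1)"

lemma robust_Nil [simp]: "robust d \<rho> []"
  by (simp add: robust_def)

lemma robust_snoc:
  "robust d \<rho> (xs @ [x]) \<longleftrightarrow>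
    robust d \<rho> xs \<and> \<rho> \<le> enorm d (resid d (gram_schmidt d xs) x) \<and> enorm d x \<le> 1"
  unfolding robust_def by (auto simp: nth_append less_Suc_eq)

lemma robust_orthonormal:
  assumes "0 < \<rho>" "robust d \<rho> xs"
  shows "orthonormal d (gram_schmidt d xs)"
  using assms(2)
proof (induction xs rule: rev_induct)
  case Nil
  then show ?case by (simp add: orthonormal_def)
next
  case (snoc x xs)
  let ?us = "gram_schmidt d xs"
  have on: "orthonormal d ?us" using snoc by (simp add: robust_snoc)
  have "0 < enorm d (resid d ?us x)" using snoc.prems assms(1) by (simp add: robust_snoc)
  moreover have "inner_d d v (normalized d (resid d ?us x)) = 0" if "v \<in> set ?us" for v
    unfolding normalized_def inner_d_divide_right
    using inner_d_resid_basis[OF on that, of x] by (simp add: inner_d_commute[of d v])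
  ultimately show ?case
    by (simp add: gram_schmidt_snoc orthonormal_snoc on inner_d_normalized_self)
qed

lemma robust_resid_member:
  assumes "0 < \<rho>" "robust d \<rho> xs" "x \<in> set xs"
  shows "resid d (gram_schmidt d xs) x = (\<lambda>i. 0)"
  using assms(2,3)
proof (induction xs rule: rev_induct)
  case (snoc y xs)
  let ?us = "gram_schmidt d xs" and ?r = "resid d (gram_schmidt d xs) y"
  have on: "orthonormal d ?us" using snoc assms(1) by (simp add: robust_snoc robust_orthonormal)
  have pos: "0 < enorm d ?r" using snoc.prems assms(1) by (simp add: robust_snoc)
  show ?case
  proof (cases "x \<in> set xs")
    case True
    have z: "resid d ?us x = (\<lambda>i. 0)" using snoc True by (simp add: robust_snoc)
    have "inner_d d x ?r = 0"
      using inner_d_resid_resid(1)[OF on, of x y] z by simp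
    then have "inner_d d x (normalized d ?r) = 0"
      unfolding normalized_def inner_d_divide_right by simp
    then show ?thesis by (simp add: gram_schmidt_snoc resid_snoc z)
  next
    case False
    then have xy: "x = y" using snoc.prems by simp
    have "inner_d d y (normalized d ?r) = enorm d ?r"
      unfolding normalized_def inner_d_divide_right
      using inner_d_resid_resid(1)[OF on, of y y] pos
      by (simp add: enorm_mult_self[symmetric] divide_eq_eq)
    then show ?thesis
      using pos by (simp add: gram_schmidt_snoc resid_snoc xy normalized_def)
  qed
qed simp

text \<open>The i-th direction is the normalized residual of the i-th vector, so its product with
  that vector is the residual norm, while earlier vectors have no residual left.\<close>

lemma robust_triangular:
  assumes "0 < \<rho>" "robust d \<rho> xs" "i < length xs"
  shows "\<rho> \<le> inner_d d (gram_schmidt d xs ! i) (xs ! i)"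
    and "l < i \<Longrightarrow> inner_d d (gram_schmidt d xs ! i) (xs ! l) = 0"
proof -
  have "\<forall>i<length xs. \<rho> \<le> inner_d d (gram_schmidt d xs ! i) (xs ! i) \<and>
      (\<forall>l<i. inner_d d (gram_schmidt d xs ! i) (xs ! l) = 0)"
    using assms(2)
  proof (induction xs rule: rev_induct)
    case (snoc y xs)
    let ?us = "gram_schmidt d xs" and ?r = "resid d (gram_schmidt d xs) y"
    have rob: "robust d \<rho> xs" using snoc.prems by (simp add: robust_snoc)
    have on: "orthonormal d ?us" by (rule robust_orthonormal[OF assms(1) rob])
    have ge: "\<rho> \<le> enorm d ?r" using snoc.prems by (simp add: robust_snoc)
    have "inner_d d (normalized d ?r) y = enorm d ?r"
      unfolding normalized_def inner_d_divide_left
      using inner_d_resid_resid(2)[OF on, of y y] ge assms(1)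
      by (auto simp: enorm_mult_self[symmetric] divide_eq_eq)
    moreover have "inner_d d (normalized d ?r) x = 0" if "x \<in> set xs" for x
      unfolding normalized_def inner_d_divide_left
      using inner_d_resid_resid(2)[OF on, of y x] robust_resid_member[OF assms(1) rob that] by simp
    ultimately show ?case
      using snoc.IH[OF rob] ge by (auto simp: gram_schmidt_snoc nth_append less_Suc_eq)
  qed simp
  with assms(3) show "\<rho> \<le> inner_d d (gram_schmidt d xs ! i) (xs ! i)"
    and "l < i \<Longrightarrow> inner_d d (gram_schmidt d xs ! i) (xs ! l) = 0" by auto
qed

text \<open>The given vectors may be dependent; one with residual of norm 0 is skipped instead of
  normalized, whence only an upper bound on the length.\<close>

lemma orthonormal_basis_exists:
  "\<exists>us. orthonormal d us \<and> length us \<le> n \<and> (\<forall>i<n. \<forall>j<d. resid d us (r i) j = 0)"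
proof (induction n)
  case 0
  show ?case by (intro exI[of _ "[]"]) (simp add: orthonormal_def)
next
  case (Suc n)
  then obtain us where us: "orthonormal d us" "length us \<le> n" "\<forall>i<n. \<forall>j<d. resid d us (r i) j = 0"
    by auto
  let ?r = "resid d us (r n)"
  show ?case
  proof (cases "enorm d ?r = 0")
    case True
    then have "\<forall>j<d. ?r j = 0"
      by (metis abs_le_enorm abs_le_zero_iff)
    then show ?thesis using us by (intro exI[of _ us]) (auto simp: less_Suc_eq)
  next
    case False
    then have pos: "0 < enorm d ?r" by (simp add: less_le)
    let ?u = "normalized d ?r"
    have "inner_d d v ?u = 0" if "v \<in> set us" for v
      unfolding normalized_def inner_d_divide_right
      using inner_d_resid_basis[OF us(1) that, of "r n"] by (simp add: inner_d_commute[of d v])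
    then have on: "orthonormal d (us @ [?u])"
      using us(1) pos by (simp add: orthonormal_snoc inner_d_normalized_self)
    have "resid d (us @ [?u]) (r i) j = 0" if i: "i < Suc n" and j: "j < d" for i j
    proof (cases "i = n")
      case True
      have "inner_d d (r n) ?u = enorm d ?r"
        unfolding normalized_def inner_d_divide_right
        using inner_d_resid_resid(1)[OF us(1), of "r n" "r n"] pos
        by (simp add: enorm_mult_self[symmetric] divide_eq_eq)
      then show ?thesis using pos True by (simp add: resid_snoc normalized_def)
    next
      case False
      then have z: "\<forall>j<d. resid d us (r i) j = 0" using us(3) i by simp
      have "inner_d d (r i) ?r = inner_d d (resid d us (r i)) ?r"
        by (rule inner_d_resid_resid(1)[OF us(1), symmetric])
      also have "\<dots> = 0" using z by (simp add: inner_d_def)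
      finally show ?thesis
        using z j by (simp add: resid_snoc normalized_def inner_d_divide_right)
    qed
    then show ?thesis using on us(2) by (intro exI[of _ "us @ [?u]"]) auto
  qed
qed

text \<open>The translates of the solution set by the rounded vectors \<open>s \<Sum>\<^bsub>l\<in>B\<^esub> u\<^sub>l\<close>,
  one for each set \<open>B\<close> of indices, are pairwise disjoint: at the least index at which two such
  sets differ, the triangular structure of Gram-Schmidt makes the two translates differ by
  more than the slab width.\<close>

lemma card_nearly_orthogonal:
  assumes \<rho>: "0 < \<rho>" and rob: "robust d \<rho> xs" and s: "0 \<le> s" "2 * \<tau> + sqrt d < s * \<rho>"
    and H: "s * length xs + 1 \<le> real H"
  shows "card {a \<in> PiE {..<d} (\<lambda>_. {..<L}). \<forall>x\<in>set xs. \<bar>inner_d d (\<lambda>j. real (a j)) x\<bar> \<le> \<tau>}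
      * 2 ^ length xs \<le> (L + 2 * H) ^ d"
proof -
  define us where "us = gram_schmidt d xs"
  define S where "S = {a \<in> PiE {..<d} (\<lambda>_. {..<L}). \<forall>x\<in>set xs. \<bar>inner_d d (\<lambda>j. real (a j)) x\<bar> \<le> \<tau>}"
  define r where "r B j = s * (\<Sum>l\<in>B. (us ! l) j)" for B :: "nat set" and j
  \<comment> \<open>Adding \<open>H\<close> keeps the rounded coordinates nonnegative, so
    \<open>nat\<close> loses nothing; the image lies in a cube of side
    \<open>L + 2 * H\<close>.\<close>
  define \<Psi> where "\<Psi> = (\<lambda>(a, B). restrict (\<lambda>j. nat (int (a j) + \<lfloor>r B j\<rfloor> + int H)) {..<d})"
  have u1: "\<bar>(us ! l) j\<bar> \<le> 1" if "l < length xs" "j < d" for l j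
    using abs_le_enorm[OF that(2), of "us ! l"] that(1) enorm_gram_schmidt[of "us ! l" d xs]
    by (simp add: us_def)
  have hb: "\<bar>\<lfloor>r B j\<rfloor>\<bar> \<le> int H" if "B \<subseteq> {..<length xs}" "j < d" for B j
  proof -
    have "\<bar>\<Sum>l\<in>B. (us ! l) j\<bar> \<le> (\<Sum>l\<in>B. 1)"
      by (rule order_trans[OF sum_abs sum_mono]) (use that u1 in auto)
    also have "\<dots> \<le> length xs"
      using that(1) card_mono[of "{..<length xs}" B] by simp
    finally have "s * \<bar>\<Sum>l\<in>B. (us ! l) j\<bar> \<le> s * length xs"
      by (rule mult_left_mono) (rule s(1))
    then have "\<bar>r B j\<bar> \<le> s * length xs" using s(1) by (simp add: r_def abs_mult)
    then show ?thesis using H by linarith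
  qed
  have "inj_on \<Psi> (S \<times> Pow {..<length xs})"
  proof (rule inj_onI, clarify)
    fix a B a' B'
    assume a: "a \<in> S" "a' \<in> S" and B: "B \<subseteq> {..<length xs}" "B' \<subseteq> {..<length xs}"
      and eq: "\<Psi> (a, B) = \<Psi> (a', B')"
    have shift: "int (a j) + \<lfloor>r B j\<rfloor> = int (a' j) + \<lfloor>r B' j\<rfloor>" if "j < d" for j
    proof -
      have "nat (int (a j) + \<lfloor>r B j\<rfloor> + int H) = nat (int (a' j) + \<lfloor>r B' j\<rfloor> + int H)"
        using fun_cong[OF eq, of j] that by (simp add: \<Psi>_def)
      moreover have "0 \<le> int (a j) + \<lfloor>r B j\<rfloor> + int H" "0 \<le> int (a' j) + \<lfloor>r B' j\<rfloor> + int H"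
        using hb[OF B(1) that] hb[OF B(2) that] by linarith+
      ultimately show ?thesis by linarith
    qed
    have "B = B'"
    proof (rule ccontr)
      assume "B \<noteq> B'"
      define D where "D = (B - B') \<union> (B' - B)"
      define l where "l = (LEAST l. l \<in> D)"
      have "D \<noteq> {}" using \<open>B \<noteq> B'\<close> by (auto simp: D_def)
      then have lD: "l \<in> D" unfolding l_def by (metis LeastI ex_in_conv)
      have lmin: "i \<notin> D" if "i < l" for i using that not_less_Least unfolding l_def by blast
      have ll: "l < length xs" using lD B by (auto simp: D_def)
      \<comment> \<open>Directions after l vanish on \<open>xs ! l\<close>, so only indices up to l
        contribute, and below l the two sets agree.\<close>
      have val: "inner_d d (r C) (xs ! l) = s * (\<Sum>i\<in>C \<inter> {..<l}. inner_d d (us ! i) (xs ! l))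
          + (if l \<in> C then s * inner_d d (us ! l) (xs ! l) else 0)" if C: "C \<subseteq> {..<length xs}" for C
      proof -
        have fin: "finite C" using C finite_subset by blast
        have "inner_d d (r C) (xs ! l) = s * (\<Sum>i\<in>C. inner_d d (us ! i) (xs ! l))"
          unfolding inner_d_def r_def
          by (simp add: sum_distrib_left sum_distrib_right mult.assoc) (rule sum.swap)
        also have "(\<Sum>i\<in>C. inner_d d (us ! i) (xs ! l)) =
            (\<Sum>i\<in>C \<inter> {..l}. inner_d d (us ! i) (xs ! l))"
          using C fin robust_triangular(2)[OF \<rho> rob]
          by (intro sum.mono_neutral_right) (auto simp: us_def not_le subset_iff)
        also have "C \<inter> {..l} = (C \<inter> {..<l}) \<union> (if l \<in> C then {l} else {})" by (auto simp: le_less)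
        also have "(\<Sum>i\<in>\<dots>. inner_d d (us ! i) (xs ! l)) = (\<Sum>i\<in>C \<inter> {..<l}. inner_d d (us ! i) (xs ! l))
            + (if l \<in> C then inner_d d (us ! l) (xs ! l) else 0)"
          using fin by (subst sum.union_disjoint) auto
        finally show ?thesis by (simp add: distrib_left)
      qed
      have "B \<inter> {..<l} = B' \<inter> {..<l}" using lmin by (auto simp: D_def)
      then have "\<bar>inner_d d (r B) (xs ! l) - inner_d d (r B') (xs ! l)\<bar> =
          s * \<bar>inner_d d (us ! l) (xs ! l)\<bar>"
        using lD s(1) unfolding val[OF B(1)] val[OF B(2)] by (auto simp: D_def abs_mult)
      moreover have "\<rho> \<le> inner_d d (us ! l) (xs ! l)"
        using robust_triangular(1)[OF \<rho> rob ll] by (simp add: us_def)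
      ultimately have big: "s * \<rho> \<le> \<bar>inner_d d (r B) (xs ! l) - inner_d d (r B') (xs ! l)\<bar>"
        using s(1) by (metis abs_ge_self mult_left_mono order_trans)
      \<comment> \<open>Both roundings together cost at most one unit per coordinate, hence at most
        sqrt d against a vector of norm at most 1. This is the \<open>sqrt d\<close> in the
        hypothesis on \<open>s\<close>.\<close>
      define e where "e j = (r B j - \<lfloor>r B j\<rfloor>) - (r B' j - \<lfloor>r B' j\<rfloor>)" for j
      have e1: "\<bar>e j\<bar> \<le> 1" for j unfolding e_def by linarith
      have "enorm d e \<le> sqrt d"
        unfolding enorm_def using e1 sum_mono[of "{..<d}" "\<lambda>i. (e i)\<^sup>2" "\<lambda>_. 1"]
        by (simp add: abs_square_le_1)
      moreover have "enorm d (xs ! l) \<le> 1" using rob ll by (simp add: robust_def)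
      ultimately have "enorm d e * enorm d (xs ! l) \<le> sqrt d * 1"
        by (intro mult_mono) auto
      then have ee: "\<bar>inner_d d e (xs ! l)\<bar> \<le> sqrt d"
        using inner_d_le_enorm[of d e "xs ! l"] by linarith
      have "r B j - r B' j = real (a' j) - real (a j) + e j" if "j < d" for j
        using shift[OF that] unfolding e_def by linarith
      then have "inner_d d (\<lambda>j. r B j - r B' j) (xs ! l) =
          inner_d d (\<lambda>j. real (a' j) - real (a j) + e j) (xs ! l)"
        unfolding inner_d_def by (intro sum.cong) auto
      then have "inner_d d (r B) (xs ! l) - inner_d d (r B') (xs ! l) =
          inner_d d (\<lambda>j. real (a' j)) (xs ! l) - inner_d d (\<lambda>j. real (a j)) (xs ! l)
          + inner_d d e (xs ! l)"
        by (simp add: inner_d_linear)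
      moreover have "\<bar>inner_d d (\<lambda>j. real (a' j)) (xs ! l)\<bar> \<le> \<tau>" "\<bar>inner_d d (\<lambda>j. real (a j)) (xs ! l)\<bar> \<le> \<tau>"
        using a ll by (auto simp: S_def)
      ultimately show False using big ee s(2) by linarith
    qed
    moreover have "a j = a' j" for j
    proof (cases "j < d")
      case True
      then show ?thesis using shift[OF True] \<open>B = B'\<close> by simp
    next
      case False
      then show ?thesis using a PiE_arb[of a "{..<d}" "\<lambda>_. {..<L}" j]
          PiE_arb[of a' "{..<d}" "\<lambda>_. {..<L}" j] by (simp add: S_def)
    qed
    ultimately show "a = a' \<and> B = B'" by auto
  qed
  moreover have "\<Psi> ` (S \<times> Pow {..<length xs}) \<subseteq> PiE {..<d} (\<lambda>_. {..<L + 2 * H})"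
  proof (rule image_subsetI, clarify)
    fix a B assume a: "a \<in> S" and B: "B \<subseteq> {..<length xs}"
    have "nat (int (a j) + \<lfloor>r B j\<rfloor> + int H) < L + 2 * H" if "j < d" for j
    proof -
      have "a j < L" using a that PiE_mem[of a "{..<d}" "\<lambda>_. {..<L}" j] by (simp add: S_def)
      with hb[OF B that] show ?thesis by linarith
    qed
    then show "\<Psi> (a, B) \<in> PiE {..<d} (\<lambda>_. {..<L + 2 * H})" by (auto simp: \<Psi>_def)
  qed
  moreover have "finite (PiE {..<d} (\<lambda>_. {..<L + 2 * H}))" by (rule finite_PiE) auto
  ultimately have "card (S \<times> Pow {..<length xs}) \<le> card (PiE {..<d} (\<lambda>_. {..<L + 2 * H}))"
    by (rule card_inj_on_le)
  then show ?thesis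
    by (simp add: card_cartesian_product card_Pow card_PiE S_def)
qed

section \<open>Sign vectors\<close>

text \<open>Compare logarithms: x^2 / 2 - ln (cosh x) has derivative x - tanh x, which is
  nonnegative for x \<ge> 0. Both sides are even.\<close>

lemma cosh_le_exp_square: "cosh (x::real) \<le> exp (x\<^sup>2 / 2)"
proof -
  have *: "cosh y \<le> exp (y\<^sup>2 / 2)" if "0 \<le> y" for y :: real
  proof -
    have sinh: "sinh z \<le> z * cosh z" if "0 \<le> z" for z :: real
    proof -
      have "(\<lambda>t. t * cosh t - sinh t) 0 \<le> (\<lambda>t. t * cosh t - sinh t) z"
      proof (rule DERIV_nonneg_imp_nondecreasing[OF that])
        fix t :: real assume "0 \<le> t" "t \<le> z"
        moreover have "((\<lambda>t. t * cosh t - sinh t) has_real_derivative t * sinh t) (at t)"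
          by (auto intro!: derivative_eq_intros)
        ultimately show "\<exists>D. ((\<lambda>t. t * cosh t - sinh t) has_real_derivative D) (at t) \<and> 0 \<le> D"
          by (metis mult_nonneg_nonneg sinh_real_nonneg_iff)
      qed
      then show ?thesis by simp
    qed
    have "(\<lambda>t. t\<^sup>2 / 2 - ln (cosh t)) 0 \<le> (\<lambda>t. t\<^sup>2 / 2 - ln (cosh t)) y"
    proof (rule DERIV_nonneg_imp_nondecreasing[OF that])
      fix t :: real assume t: "0 \<le> t" "t \<le> y"
      have "((\<lambda>t. t\<^sup>2 / 2 - ln (cosh t)) has_real_derivative t - sinh t / cosh t) (at t)"
        by (auto intro!: derivative_eq_intros simp: cosh_real_pos)
      moreover have "0 \<le> t - sinh t / cosh t"
        using sinh[OF t(1)] cosh_real_pos[of t] by (simp add: divide_le_eq)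
      ultimately show "\<exists>D. ((\<lambda>t. t\<^sup>2 / 2 - ln (cosh t)) has_real_derivative D) (at t) \<and> 0 \<le> D"
        by blast
    qed
    then have "ln (cosh y) \<le> y\<^sup>2 / 2" by simp
    then show ?thesis
      by (metis cosh_real_pos exp_le_cancel_iff exp_ln)
  qed
  show ?thesis
    using *[of x] *[of "- x"] by (cases "0 \<le> x") auto
qed

lemma exp_plus_exp_minus_le: "exp x + exp (- x) \<le> 2 * exp (x\<^sup>2 / 2)" for x :: real
  using cosh_le_exp_square[of x] by (simp add: cosh_field_def)

definition signs :: "nat \<Rightarrow> (nat \<Rightarrow> real) set" where
  "signs d = PiE {..<d} (\<lambda>_. {-1, 1})"

lemma finite_signs [simp]: "finite (signs d)"
  unfolding signs_def by (rule finite_PiE) auto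

lemma card_signs: "card (signs d) = 2 ^ d"
  unfolding signs_def by (simp add: card_PiE numeral_2_eq_2)

lemma signs_abs: "\<sigma> \<in> signs d \<Longrightarrow> j < d \<Longrightarrow> \<sigma> j * \<sigma> j = 1"
  unfolding signs_def by (fastforce dest: PiE_mem[where x = j])

lemma inner_d_signs: "\<sigma> \<in> signs d \<Longrightarrow> inner_d d \<sigma> \<sigma> = real d"
  unfolding inner_d_def by (simp add: signs_abs)

lemma enorm_signs: "\<sigma> \<in> signs d \<Longrightarrow> enorm d \<sigma> = sqrt d"
  by (metis enorm_nonneg enorm_power2 inner_d_signs real_sqrt_unique)

text \<open>Chernoff's bound in counting form: the sum of exp (\<mu> \<sigma> y) over all sign
  vectors factors over the coordinates, each factor being 2 cosh. For y of norm 0 the strict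
  inequality leaves an empty set.\<close>

lemma card_signs_tail:
  assumes "0 \<le> t"
  shows "real (card {\<sigma> \<in> signs d. t * enorm d y < inner_d d \<sigma> y}) \<le> 2 ^ d * exp (- t\<^sup>2 / 2)"
proof (cases "enorm d y = 0")
  case True
  have "\<not> t * enorm d y < inner_d d \<sigma> y" for \<sigma>
    using inner_d_le_enorm[of d \<sigma> y] True by auto
  then have e: "{\<sigma> \<in> signs d. t * enorm d y < inner_d d \<sigma> y} = {}" by blast
  show ?thesis unfolding e by simp
next
  case False
  then have pos: "0 < enorm d y" by (simp add: less_le)
  \<comment> \<open>The minimizer of \<mu>^2 |y|^2 / 2 - \<mu> t |y|.\<close>
  define \<mu> where "\<mu> = t / enorm d y"
  have \<mu>: "0 \<le> \<mu>" using assms pos by (simp add: \<mu>_def)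
  let ?S = "{\<sigma> \<in> signs d. t * enorm d y < inner_d d \<sigma> y}"
  have "real (card ?S) * exp (t\<^sup>2) = (\<Sum>\<sigma>\<in>?S. exp (t\<^sup>2))" by simp
  also have "\<dots> \<le> (\<Sum>\<sigma>\<in>?S. exp (\<mu> * inner_d d \<sigma> y))"
  proof (rule sum_mono)
    fix \<sigma> assume "\<sigma> \<in> ?S"
    then have "\<mu> * (t * enorm d y) \<le> \<mu> * inner_d d \<sigma> y" using \<mu> by (intro mult_left_mono) auto
    moreover have "\<mu> * (t * enorm d y) = t\<^sup>2" using pos by (simp add: \<mu>_def power2_eq_square)
    ultimately show "exp (t\<^sup>2) \<le> exp (\<mu> * inner_d d \<sigma> y)" by simp
  qed
  also have "\<dots> \<le> (\<Sum>\<sigma>\<in>signs d. exp (\<mu> * inner_d d \<sigma> y))"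
    by (rule sum_mono2) auto
  also have "\<dots> = (\<Sum>\<sigma>\<in>signs d. \<Prod>j<d. exp (\<mu> * y j * \<sigma> j))"
    by (simp add: inner_d_def sum_distrib_left exp_sum ac_simps)
  also have "\<dots> = (\<Prod>j<d. \<Sum>e\<in>{-1, 1}. exp (\<mu> * y j * e))"
    unfolding signs_def by (rule prod_sum_PiE[symmetric]) auto
  also have "\<dots> = (\<Prod>j<d. exp (\<mu> * y j) + exp (- (\<mu> * y j)))"
    by (simp add: add.commute)
  also have "\<dots> \<le> (\<Prod>j<d. 2 * exp ((\<mu> * y j)\<^sup>2 / 2))"
    by (rule prod_mono) (auto intro: exp_plus_exp_minus_le add_nonneg_nonneg)
  also have "\<dots> = 2 ^ d * exp (\<Sum>j<d. (\<mu> * y j)\<^sup>2 / 2)"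
    by (simp add: prod.distrib exp_sum)
  also have "(\<Sum>j<d. (\<mu> * y j)\<^sup>2 / 2) = \<mu>\<^sup>2 * (enorm d y)\<^sup>2 / 2"
    unfolding enorm_power2 inner_d_def
    by (simp add: sum_divide_distrib sum_distrib_left power2_eq_square ac_simps)
  also have "\<dots> = t\<^sup>2 / 2" using pos by (simp add: \<mu>_def power_divide)
  finally have "real (card ?S) \<le> 2 ^ d * exp (t\<^sup>2 / 2) / exp (t\<^sup>2)"
    by (simp add: pos_le_divide_eq)
  also have "\<dots> = 2 ^ d * exp (- t\<^sup>2 / 2)"
    by (simp add: exp_minus field_simps flip: exp_add)
  finally show ?thesis .
qed

lemma card_signs_abs_tail:
  assumes "0 \<le> t"
  shows "real (card {\<sigma> \<in> signs d. t * enorm d y < \<bar>inner_d d \<sigma> y\<bar>}) \<le> 2 * 2 ^ d * exp (- t\<^sup>2 / 2)"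
proof -
  let ?y = "\<lambda>i. - 1 * y i"
  have "{\<sigma> \<in> signs d. t * enorm d y < \<bar>inner_d d \<sigma> y\<bar>} \<subseteq>
      {\<sigma> \<in> signs d. t * enorm d y < inner_d d \<sigma> y} \<union> {\<sigma> \<in> signs d. t * enorm d ?y < inner_d d \<sigma> ?y}"
    unfolding enorm_scale inner_d_scale_right by auto
  then have "card {\<sigma> \<in> signs d. t * enorm d y < \<bar>inner_d d \<sigma> y\<bar>} \<le>
      card {\<sigma> \<in> signs d. t * enorm d y < inner_d d \<sigma> y} +
      card {\<sigma> \<in> signs d. t * enorm d ?y < inner_d d \<sigma> ?y}"
    by (intro order_trans[OF card_mono card_Un_le]) auto
  then show ?thesis
    using card_signs_tail[OF assms, of d y] card_signs_tail[OF assms, of d ?y] by linarith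
qed

text \<open>A difference, because two sign vectors in the same cell of a partition by inner products
  yield a vector nearly orthogonal to the partitioning directions. The scale keeps the norm at most
  1. The pair itself is stored: pairs are easy to count, and swapping one negates the
  vector.\<close>

definition half_diff :: "nat \<Rightarrow> (nat \<Rightarrow> real) \<times> (nat \<Rightarrow> real) \<Rightarrow> nat \<Rightarrow> real" where
  "half_diff d p = (\<lambda>i. if i < d then (fst p i - snd p i) / (2 * sqrt d) else 0)"

lemma inner_d_half_diff:
  "inner_d d (half_diff d p) y = (inner_d d (fst p) y - inner_d d (snd p) y) / (2 * sqrt d)"
proof -
  have "inner_d d (half_diff d p) y = inner_d d (\<lambda>i. (fst p i - snd p i) / (2 * sqrt d)) y"
    unfolding half_diff_def inner_d_def by simp
  then show ?thesis by (simp add: inner_d_linear)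
qed

lemma half_diff_swap: "half_diff d (prod.swap p) = (\<lambda>i. - half_diff d p i)"
  by (auto simp: half_diff_def minus_divide_left)

lemma inner_d_half_diff_self:
  assumes "p \<in> signs d \<times> signs d" "0 < d"
  shows "inner_d d (half_diff d p) (half_diff d p) = 1/2 - inner_d d (fst p) (snd p) / (2 * real d)"
proof -
  have e: "inner_d d y (half_diff d p) = (inner_d d y (fst p) - inner_d d y (snd p)) / (2 * sqrt d)" for y
    by (metis inner_d_commute inner_d_half_diff)
  have "inner_d d (fst p) (half_diff d p) = (real d - inner_d d (fst p) (snd p)) / (2 * sqrt d)"
    using assms(1) unfolding e by (auto simp: inner_d_signs)
  moreover have "inner_d d (snd p) (half_diff d p) = (inner_d d (fst p) (snd p) - real d) / (2 * sqrt d)"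
    using assms(1) unfolding e by (auto simp: inner_d_signs inner_d_commute[of d "snd p" "fst p"])
  ultimately have "inner_d d (half_diff d p) (half_diff d p) =
      (2 * real d - 2 * inner_d d (fst p) (snd p)) / (2 * sqrt d * (2 * sqrt d))"
    unfolding inner_d_half_diff by (simp add: diff_divide_distrib[symmetric])
  also have "2 * sqrt d * (2 * sqrt d) = 4 * real d" by simp
  finally show ?thesis using assms(2) by (simp add: field_simps)
qed

lemma enorm_half_diff_le:
  assumes "p \<in> signs d \<times> signs d"
  shows "enorm d (half_diff d p) \<le> 1"
proof (cases "d = 0")
  case True
  then show ?thesis by (simp add: enorm_def)
next
  case False
  have "\<bar>inner_d d (fst p) (snd p)\<bar> \<le> real d"
    using inner_d_le_enorm[of d "fst p" "snd p"] assms by (auto simp: enorm_signs)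
  then have "inner_d d (half_diff d p) (half_diff d p) \<le> 1"
    using False assms by (subst inner_d_half_diff_self) (auto simp: field_simps)
  then show ?thesis
    using power2_le_imp_le[of "enorm d (half_diff d p)" 1] by (simp add: enorm_power2)
qed

text \<open>Among the sign vectors passing all tests \<open>Y\<close>, some cell of the partition according to the
  (rounded) inner products with \<open>us\<close> is large; differences within a cell are nearly orthogonal
  to \<open>us\<close>.\<close>

lemma card_good_pairs:
  fixes c :: nat
  assumes d: "0 < d" and Y: "finite Y" "real (card Y) * (4 * exp (- (real d * s\<^sup>2) / 2)) \<le> 1"
    and s: "0 \<le> s"
    and us: "\<And>u. u \<in> set us \<Longrightarrow> enorm d u \<le> 1" "length us \<le> k"
    and w: "0 < w" "2 / w + 1 \<le> real c"
    and far: "8 * real c ^ (2 * k) * exp (- real d / 8) \<le> 1"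
  shows "4 ^ d \<le> 8 * real c ^ (2 * k) * real (card {p \<in> signs d \<times> signs d.
      (\<forall>u\<in>set us. \<bar>inner_d d (half_diff d p) u\<bar> \<le> w) \<and>
      (\<forall>y\<in>Y. \<bar>inner_d d (half_diff d p) y\<bar> \<le> s * enorm d y) \<and>
      1/4 \<le> inner_d d (half_diff d p) (half_diff d p)})"
proof -
  have sd: "0 < sqrt d" using d by simp
  define t where "t = sqrt d * s"
  have t: "0 \<le> t" "t\<^sup>2 = real d * s\<^sup>2" using s by (auto simp: t_def power_mult_distrib)
  define G where "G = {\<sigma> \<in> signs d. \<forall>y\<in>Y. \<bar>inner_d d \<sigma> y\<bar> \<le> t * enorm d y}"
  define Z where "Z y = {\<sigma> \<in> signs d. t * enorm d y < \<bar>inner_d d \<sigma> y\<bar>}" for y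
  have "real (card (\<Union>y\<in>Y. Z y)) \<le> (\<Sum>y\<in>Y. real (card (Z y)))"
    using card_UN_le[OF Y(1), of Z] by (metis of_nat_mono of_nat_sum)
  also have "\<dots> \<le> (\<Sum>y\<in>Y. 2 * 2 ^ d * exp (- t\<^sup>2 / 2))"
    unfolding Z_def by (intro sum_mono card_signs_abs_tail t(1))
  also have "\<dots> = (real (card Y) * (4 * exp (- (real d * s\<^sup>2) / 2))) * 2 ^ d / 2"
    by (simp add: t(2))
  also have "\<dots> \<le> 1 * 2 ^ d / 2"
    by (intro divide_right_mono mult_right_mono Y(2)) auto
  \<comment> \<open>At most half of the sign vectors fail a test. The factor 4 in the hypothesis on
    \<open>Y\<close> pays 2 for the two-sided tail and 2 for this half.\<close>
  finally have bad: "real (card (\<Union>y\<in>Y. Z y)) \<le> 2 ^ d / 2" by simp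
  have "signs d \<subseteq> G \<union> (\<Union>y\<in>Y. Z y)" unfolding G_def Z_def by auto
  then have "card (signs d) \<le> card G + card (\<Union>y\<in>Y. Z y)"
    by (intro order_trans[OF card_mono card_Un_le]) (auto simp: G_def Z_def Y(1))
  then have "real (2 ^ d) \<le> real (card G) + real (card (\<Union>y\<in>Y. Z y))"
    unfolding card_signs using of_nat_mono by fastforce
  with bad have G: "2 ^ d / 2 \<le> real (card G)" by simp
  \<comment> \<open>Normalized products lie in [-1, 1]; shifted by 1 and cut into intervals of
    length \<open>w\<close>, they fall into at most \<open>c\<close> classes per direction.\<close>
  define cell where "cell \<sigma> = map (\<lambda>u. nat \<lfloor>(1 + inner_d d \<sigma> u / sqrt d) / w\<rfloor>) us" for \<sigma>
  have ip1: "\<bar>inner_d d \<sigma> u / sqrt d\<bar> \<le> 1" if "\<sigma> \<in> signs d" "u \<in> set us" for \<sigma> u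
  proof -
    have "\<bar>inner_d d \<sigma> u\<bar> \<le> sqrt d * 1"
      by (rule order_trans[OF inner_d_le_enorm mult_mono]) (use that us(1) in \<open>auto simp: enorm_signs\<close>)
    then show ?thesis using sd by (simp add: divide_le_eq)
  qed
  define B where "B = {l. set l \<subseteq> {..<c} \<and> length l = length us}"
  have cpos: "0 < c" using w by (metis add_pos_pos divide_pos_pos less_le_trans of_nat_0_less_iff zero_less_numeral zero_less_one)
  have B: "finite B" "card B = c ^ length us" "B \<noteq> {}"
  proof -
    show "finite B" unfolding B_def by (rule finite_lists_length_eq) simp
    show "card B = c ^ length us" unfolding B_def by (subst card_lists_length_eq) auto
    show "B \<noteq> {}" using cpos by (auto simp: B_def intro!: exI[of _ "replicate (length us) 0"])
  qed
  have "cell \<in> G \<rightarrow> B"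
  proof
    fix \<sigma> assume "\<sigma> \<in> G"
    then have \<sigma>: "\<sigma> \<in> signs d" by (simp add: G_def)
    have "nat \<lfloor>(1 + inner_d d \<sigma> u / sqrt d) / w\<rfloor> < c" if "u \<in> set us" for u
    proof -
      have "(1 + inner_d d \<sigma> u / sqrt d) / w \<le> 2 / w"
        using abs_le_D1[OF ip1[OF \<sigma> that]] w(1) by (intro divide_right_mono) auto
      then have "(1 + inner_d d \<sigma> u / sqrt d) / w < real c" using w(2) by linarith
      then show ?thesis using cpos by linarith
    qed
    then show "cell \<sigma> \<in> B" by (auto simp: B_def cell_def)
  qed
  then obtain b where "card G \<le> card (cell -` {b} \<inter> G) * card B"
    using pigeonhole_card[of cell G B] B by (auto simp: G_def)
  then have Fc: "card G \<le> card (cell -` {b} \<inter> G) * c ^ length us" using B(2) by simp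
  define F where "F = cell -` {b} \<inter> G"
  have finF: "finite F" by (simp add: F_def G_def)
  have "card G \<le> card F * c ^ k"
    using order_trans[OF Fc mult_le_mono2[OF power_increasing[OF us(2), of c]]] cpos
    by (simp add: F_def)
  then have "2 ^ d / 2 \<le> real (card F) * real c ^ k"
    using G by (metis of_nat_mono of_nat_mult of_nat_power order_trans)
  then have "(2 ^ d / 2)\<^sup>2 \<le> (real (card F) * real c ^ k)\<^sup>2"
    by (intro power_mono) auto
  then have FF: "4 ^ d \<le> 4 * real c ^ (2 * k) * real (card (F \<times> F))"
    by (simp add: power2_eq_square power_mult_distrib card_cartesian_product power_mult field_simps
        power_divide power_even_eq flip: power_mult_distrib)
  \<comment> \<open>Pairs with a large inner product, whose difference would be too short. They are
    exponentially few: by \<open>far\<close>, removing them costs at most half of the lower bound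
    just obtained, which turns the factor 4 into 8.\<close>
  define N where "N = {p \<in> signs d \<times> signs d. sqrt d / 2 * enorm d (snd p) < inner_d d (fst p) (snd p)}"
  have "N \<subseteq> (\<Union>\<tau>\<in>signs d. {\<sigma> \<in> signs d. sqrt d / 2 * enorm d \<tau> < inner_d d \<sigma> \<tau>} \<times> {\<tau>})"
    by (auto simp: N_def)
  then have "card N \<le> (\<Sum>\<tau>\<in>signs d. card ({\<sigma> \<in> signs d. sqrt d / 2 * enorm d \<tau> < inner_d d \<sigma> \<tau>} \<times> {\<tau>}))"
    by (intro order_trans[OF card_mono card_UN_le]) auto
  then have "real (card N) \<le>
      (\<Sum>\<tau>\<in>signs d. real (card {\<sigma> \<in> signs d. sqrt d / 2 * enorm d \<tau> < inner_d d \<sigma> \<tau>}))"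
    by (simp add: card_cartesian_product flip: of_nat_sum)
  also have "\<dots> \<le> (\<Sum>\<tau>\<in>signs d. 2 ^ d * exp (- (sqrt d / 2)\<^sup>2 / 2))"
    by (intro sum_mono card_signs_tail) simp
  also have "\<dots> = 4 ^ d * exp (- real d / 8)"
    by (simp add: card_signs power_divide flip: power_mult_distrib)
  finally have N: "real (card N) \<le> 4 ^ d * exp (- real d / 8)" .
  let ?R = "{p \<in> signs d \<times> signs d.
      (\<forall>u\<in>set us. \<bar>inner_d d (half_diff d p) u\<bar> \<le> w) \<and>
      (\<forall>y\<in>Y. \<bar>inner_d d (half_diff d p) y\<bar> \<le> s * enorm d y) \<and>
      1/4 \<le> inner_d d (half_diff d p) (half_diff d p)}"
  have "F \<times> F \<subseteq> ?R \<union> N"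
  proof -
    have "(\<sigma>, \<tau>) \<in> ?R" if st: "\<sigma> \<in> F" "\<tau> \<in> F" "(\<sigma>, \<tau>) \<notin> N" for \<sigma> \<tau>
    proof -
      from st have sg: "\<sigma> \<in> signs d" "\<tau> \<in> signs d" by (auto simp: F_def G_def)
      have "\<bar>inner_d d (half_diff d (\<sigma>, \<tau>)) u\<bar> \<le> w" if u: "u \<in> set us" for u
      proof -
        let ?a = "(1 + inner_d d \<sigma> u / sqrt d) / w" and ?b = "(1 + inner_d d \<tau> u / sqrt d) / w"
        have "cell \<sigma> = cell \<tau>" using st by (simp add: F_def)
        then have "nat \<lfloor>?a\<rfloor> = nat \<lfloor>?b\<rfloor>" using u by (simp add: cell_def)
        moreover have "0 \<le> ?a" "0 \<le> ?b" 
          using abs_le_D2[OF ip1[OF sg(1) u]] abs_le_D2[OF ip1[OF sg(2) u]] w(1)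
          by (auto intro!: divide_nonneg_pos)
        ultimately have "\<lfloor>?a\<rfloor> = \<lfloor>?b\<rfloor>" by (simp add: eq_nat_nat_iff)
        then have "\<bar>?a - ?b\<bar> \<le> 1" by linarith
        moreover have "?a - ?b = 2 * inner_d d (half_diff d (\<sigma>, \<tau>)) u / w"
          by (simp add: inner_d_half_diff diff_divide_distrib add_divide_distrib)
        ultimately have "\<bar>2 * inner_d d (half_diff d (\<sigma>, \<tau>)) u\<bar> \<le> w"
          using w(1) by (simp add: divide_le_eq)
        then show ?thesis by simp
      qed
      moreover have "\<bar>inner_d d (half_diff d (\<sigma>, \<tau>)) y\<bar> \<le> s * enorm d y" if "y \<in> Y" for y
      proof -
        have "\<bar>inner_d d \<sigma> y\<bar> \<le> t * enorm d y" "\<bar>inner_d d \<tau> y\<bar> \<le> t * enorm d y"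
          using st that by (auto simp: F_def G_def)
        then have "\<bar>inner_d d \<sigma> y - inner_d d \<tau> y\<bar> \<le> (s * enorm d y) * (2 * sqrt d)"
          unfolding t_def by (simp add: algebra_simps)
        then show ?thesis
          using sd by (simp add: inner_d_half_diff divide_le_eq)
      qed
      moreover have "1/4 \<le> inner_d d (half_diff d (\<sigma>, \<tau>)) (half_diff d (\<sigma>, \<tau>))"
      proof -
        have "inner_d d \<sigma> \<tau> \<le> real d / 2"
          using st(3) sg by (simp add: N_def enorm_signs)
        then show ?thesis
          using sg d by (subst inner_d_half_diff_self) (auto simp: field_simps)
      qed
      ultimately show "(\<sigma>, \<tau>) \<in> ?R" using sg by simp
    qed
    then show ?thesis by blast
  qed
  then have "card (F \<times> F) \<le> card ?R + card N"
    by (intro order_trans[OF card_mono card_Un_le]) (auto simp: N_def)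
  then have "real (card (F \<times> F)) \<le> real (card ?R) + 4 ^ d * exp (- real d / 8)"
    using N by linarith
  then have "4 * real c ^ (2 * k) * real (card (F \<times> F)) \<le>
      4 * real c ^ (2 * k) * (real (card ?R) + 4 ^ d * exp (- real d / 8))"
    by (rule mult_left_mono) simp
  also have "\<dots> = 4 * real c ^ (2 * k) * real (card ?R) + 4 * real c ^ (2 * k) * (4 ^ d * exp (- real d / 8))"
    by (rule distrib_left)
  also have "4 * real c ^ (2 * k) * (4 ^ d * exp (- real d / 8)) =
      (8 * real c ^ (2 * k) * exp (- real d / 8)) * 4 ^ d / 2" by simp
  also have "\<dots> \<le> 1 * 4 ^ d / 2"
    by (intro divide_right_mono mult_right_mono far) auto
  finally show ?thesis using FF by simp
qed

section \<open>The resisting oracle\<close>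

text \<open>Average the two subgradient inequalities based at the intermediate point. For a maximum
  of pieces, convexity then follows from the subgradient of the active piece alone.\<close>

lemma subgrads_imp_convex:
  assumes "\<And>x. x \<in> vecs d \<Longrightarrow> is_subgrad d f x (g x)"
  shows "convex_d d f"
  unfolding convex_d_def
proof (intro ballI allI impI)
  fix x y and t :: real
  assume x: "x \<in> vecs d" and y: "y \<in> vecs d" and t: "0 \<le> t \<and> t \<le> 1"
  define z where "z = (\<lambda>i. t * x i + (1 - t) * y i)"
  have "z \<in> vecs d" using x y by (simp add: z_def vecs_def)
  from assms[OF this] have sub: "f z + inner_d d (g z) (\<lambda>i. u i - z i) \<le> f u" if "u \<in> vecs d" for u
    using that by (simp add: is_subgrad_def)
  have "t * (f z + inner_d d (g z) (\<lambda>i. x i - z i)) + (1 - t) * (f z + inner_d d (g z) (\<lambda>i. y i - z i))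
      \<le> t * f x + (1 - t) * f y"
    using t by (intro add_mono mult_left_mono sub x y) auto
  moreover have "inner_d d (g z) z = t * inner_d d (g z) x + (1 - t) * inner_d d (g z) y"
    unfolding z_def by (simp add: inner_d_linear)
  ultimately show "f (\<lambda>i. t * x i + (1 - t) * y i) \<le> t * f x + (1 - t) * f y"
    unfolding z_def[symmetric] by (simp add: inner_d_linear algebra_simps)
qed

lemma enorm_minus_commute: "enorm d (\<lambda>i. x i - y i) = enorm d (\<lambda>i. y i - x i)"
  unfolding enorm_def by (simp add: power2_commute)

lemma subgrads_imp_lipschitz:
  assumes "\<And>x. x \<in> vecs d \<Longrightarrow> is_subgrad d f x (g x)" "\<And>x. x \<in> vecs d \<Longrightarrow> enorm d (g x) \<le> 1"
  shows "lipschitz1_d d f"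
proof -
  have *: "f x - f y \<le> enorm d (\<lambda>i. x i - y i)" if x: "x \<in> vecs d" and y: "y \<in> vecs d" for x y
  proof -
    have "f x + inner_d d (g x) (\<lambda>i. y i - x i) \<le> f y"
      using assms(1)[OF x] y by (simp add: is_subgrad_def)
    moreover have "\<bar>inner_d d (g x) (\<lambda>i. y i - x i)\<bar> \<le> 1 * enorm d (\<lambda>i. y i - x i)"
      by (rule order_trans[OF inner_d_le_enorm]) (intro mult_right_mono assms(2)[OF x], simp)
    ultimately show ?thesis unfolding enorm_minus_commute[of d x y] by linarith
  qed
  show ?thesis
    unfolding lipschitz1_d_def
  proof (intro ballI)
    fix x y assume "x \<in> vecs d" "y \<in> vecs d"
    with *[of x y] *[of y x] show "\<bar>f x - f y\<bar> \<le> enorm d (\<lambda>i. x i - y i)"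
      using enorm_minus_commute[of d x y] by linarith
  qed
qed

text \<open>Roles: \<open>P\<close> periods of \<open>k\<close> vectors; \<open>n\<close> rows with
  \<open>L\<close> grid values per coordinate; \<open>T\<close> the number of queries tested;
  \<open>s\<close> the correlation allowed with anything that should look unrelated;
  \<open>\<rho>\<close> the robustness threshold; \<open>w\<close> the product allowed with explored
  directions of the same period; \<open>\<beta>\<close> the scale of the vectors;
  \<open>\<eta>\<close> the slack of the rows; \<open>\<Lambda>\<close> the rate of the potential.
  The level drops by \<open>\<gamma>\<^sub>1\<close> per period, at least twice what a new vector
  contributes at a query of norm 2, and by \<open>\<gamma>\<^sub>2\<close> per vector, at least
  twice the error of near orthogonality. The last inequality keeps all drops of the second kind
  together below a quarter of one drop of the first kind.\<close>

locale adversary =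
  fixes d k P n L T M :: nat and alg :: alg
    and s \<rho> w \<beta> \<gamma>\<^sub>1 \<gamma>\<^sub>2 \<eta> \<Lambda> :: real
  assumes d: "0 < d" and k: "0 < k" and L: "0 < L"
    and s: "0 \<le> s" "s \<le> 1" and \<rho>: "0 < \<rho>" and w: "0 < w" and \<beta>: "0 < \<beta>" "\<beta> \<le> 1 / 2"
    and \<gamma>\<^sub>1: "4 * \<beta> * s \<le> \<gamma>\<^sub>1" and \<gamma>\<^sub>2: "2 * \<beta> * (\<rho> + (real k + 1) * w) \<le> \<gamma>\<^sub>2"
    and \<gamma>\<^sub>1\<^sub>2: "(real (P * k) + 1) * \<gamma>\<^sub>2 + \<beta> * \<rho> \<le> \<gamma>\<^sub>1 / 4"
    and valid_alg: "valid_alg d M alg"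
begin

abbreviation N :: nat where "N \<equiv> P * k"

definition mats :: "(nat \<Rightarrow> nat \<Rightarrow> nat) set" where
  "mats = PiE {..<n} (\<lambda>_. PiE {..<d} (\<lambda>_. {..<L}))"

definition row :: "(nat \<Rightarrow> nat \<Rightarrow> nat) \<Rightarrow> nat \<Rightarrow> nat \<Rightarrow> real" where
  "row A i = (\<lambda>j. if j < d then real (A i j) / (real L * sqrt d) else 0)"

text \<open>Vectors that have not been chosen yet read as \<open>0\<close>. This lets the oracle be run on a prefix of
  \<open>V\<close>; the run agrees with the full one until the first missing vector is released.\<close>

definition vec :: "((nat \<Rightarrow> real) \<times> (nat \<Rightarrow> real)) list \<Rightarrow> nat \<Rightarrow> nat \<Rightarrow> real" where
  "vec V i = (if i < length V then half_diff d (V ! i) else (\<lambda>_. 0))"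

text \<open>Vector 0 is present from the start and has offset 0. Vector \<open>i > 0\<close> is
  released by the i-th explored query and hence belongs to period \<open>(i - 1) div k\<close>,
  counted from 0.\<close>

definition offs :: "nat \<Rightarrow> real" where
  "offs i = (if i = 0 then 0 else real ((i - 1) div k) + 1) * \<gamma>\<^sub>1 + real i * \<gamma>\<^sub>2"

text \<open>The pieces of the hard function: index \<open>0\<close> is the norm piece, \<open>1, \<dots>, n\<close> are the rows, and
  \<open>n + 1 + i\<close> is the \<open>i\<close>-th adaptive vector. The oracle answers with the first active piece, so
  pieces added at the end do not change an answer unless they exceed the current maximum.\<close>

definition val :: "(nat \<Rightarrow> nat \<Rightarrow> nat) \<Rightarrow> ((nat \<Rightarrow> real) \<times> (nat \<Rightarrow> real)) list \<Rightarrow> nat \<Rightarrow>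
    (nat \<Rightarrow> real) \<Rightarrow> real" where
  "val A V i x = (if i = 0 then enorm d x - 1
     else if i \<le> n then \<bar>inner_d d (row A (i - 1)) x\<bar> - \<eta>
     else \<beta> * inner_d d (vec V (i - n - 1)) x - offs (i - n - 1))"

definition grad :: "(nat \<Rightarrow> nat \<Rightarrow> nat) \<Rightarrow> ((nat \<Rightarrow> real) \<times> (nat \<Rightarrow> real)) list \<Rightarrow> nat \<Rightarrow>
    (nat \<Rightarrow> real) \<Rightarrow> nat \<Rightarrow> real" where
  "grad A V i x = (if i = 0 then normalized d x
     else if i \<le> n then (\<lambda>j. sgn (inner_d d (row A (i - 1)) x) * row A (i - 1) j)
     else (\<lambda>j. \<beta> * vec V (i - n - 1) j))"

text \<open>\<open>I\<close> is the set of rows consulted: all of them in the true run, only a few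
  when a period is recomputed. Vectors 0 to \<open>j\<close> are present after \<open>j\<close>
  explored queries.\<close>

definition pieces :: "nat set \<Rightarrow> nat \<Rightarrow> nat set" where
  "pieces I j = insert 0 (Suc ` I \<union> {n + 1..n + 1 + j})"

definition F where
  "F A V J x = Max ((\<lambda>i. val A V i x) ` J)"

definition sel where
  "sel A V J x = (LEAST i. i \<in> J \<and> val A V i x = F A V J x)"

definition resp where
  "resp A V J x = (F A V J x, grad A V (sel A V J x) x)"

definition cur :: "(nat \<Rightarrow> real) list \<Rightarrow> (nat \<Rightarrow> real) list" where
  "cur E = drop (k * (length E div k)) E"

text \<open>The threshold lies halfway between the levels of the previous and the current period. A
  query that is refused before all vectors are out is either high, or nearly dependent on the
  explored queries of its period.\<close>

definition explores where
  "explores A V I E x \<longleftrightarrow> length E < N \<and>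
     F A V (pieces I (length E)) x < - (real (length E div k) + 1) * \<gamma>\<^sub>1 + \<gamma>\<^sub>1 / 2 \<and>
     \<rho> \<le> enorm d (resid d (gram_schmidt d (cur E)) x)"

definition extend where
  "extend A V I E x = (if explores A V I E x then E @ [x] else E)"

text \<open>The list is extended first, so a query that releases a vector is answered with this
  vector included. The vector, being nearly orthogonal to the query, then bounds the answer from
  below.\<close>

definition step where
  "step A V I st = (let m = fst st; x = query alg m; E' = extend A V I (snd st) x
     in (update alg m x (resp A V (pieces I (length E')) x), E'))"

definition state where
  "state A V t = (step A V {..<n} ^^ t) (replicate M False, [])"

definition qu where "qu A V t = query alg (fst (state A V t))"

definition expl where "expl A V t = snd (state A V t)"

definition basis where
  "basis A = (SOME us. orthonormal d us \<and> length us \<le> n \<and> (\<forall>i<n. \<forall>j<d. resid d us (row A i) j = 0))"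

definition ker_proj where "ker_proj A x = resid d (basis A) x"

definition total :: "((nat \<Rightarrow> real) \<times> (nat \<Rightarrow> real)) list \<Rightarrow> nat \<Rightarrow> real" where
  "total V = (\<lambda>i. \<Sum>p\<leftarrow>V. half_diff d p i)"

text \<open>The optimum is found along \<open>- \<Sum>\<^sub>j P v\<^sub>j\<close>, with \<open>P\<close> the projection to the kernel of the rows. The sum of
  \<open>v\<^sub>j \<bullet> P v\<^sub>m\<close> over the later \<open>m\<close> involves vectors chosen after \<open>v\<^sub>j\<close>; an exponential potential,
  controlled by choosing the sign of each new vector, keeps all these sums from becoming very
  negative.\<close>

definition corr where
  "corr A V j = (\<Sum>m\<in>{j<..<length V}. inner_d d (ker_proj A (vec V j)) (vec V m))"

definition pot where
  "pot A V = (\<Sum>j<length V. exp (- \<Lambda> * corr A V j))"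

text \<open>The queries are those of the run on the prefix \<open>V\<close>. Once this run lacks a
  vector it may leave the final run; the queries made from then on merely add tests. The other
  members serve to keep the optimum low.\<close>

definition tests where
  "tests A V = (qu A V ` {..<T}) \<union> set (basis A) \<union> ((\<lambda>p. ker_proj A (half_diff d p)) ` set V)
     \<union> {ker_proj A (total V)}"

text \<open>The explored queries in the period of vector \<open>i > 0\<close>, up to and including
  the one that releases it.\<close>

definition blk :: "nat \<Rightarrow> (nat \<Rightarrow> real) list \<Rightarrow> (nat \<Rightarrow> real) list" where
  "blk i E = drop (k * ((i - 1) div k)) (take i E)"

definition passes where
  "passes A V p \<longleftrightarrow> p \<in> signs d \<times> signs d \<and>
     (\<forall>u\<in>set (gram_schmidt d (blk (length V) (expl A V T))). \<bar>inner_d d (half_diff d p) u\<bar> \<le> w) \<and>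
     (\<forall>y\<in>tests A V. \<bar>inner_d d (half_diff d p) y\<bar> \<le> s * enorm d y) \<and>
     1/4 \<le> inner_d d (half_diff d p) (half_diff d p)"

text \<open>The bound is that on the average of the potential over both signs of the new vector,
  with cosh estimated by the exponential; the summand 1 is the term of the new vector, whose own sum
  is still empty.\<close>

definition good where
  "good A V p \<longleftrightarrow> passes A V p \<and> pot A (V @ [p]) \<le> exp (\<Lambda>\<^sup>2 * s\<^sup>2 / 2) * pot A V + 1"

definition valid where
  "valid A V \<longleftrightarrow> (\<forall>i<length V. good A (take i V) (V ! i))"

lemma valid_Nil [simp]: "valid A []"
  by (simp add: valid_def)

lemma valid_snoc: "valid A (V @ [p]) \<longleftrightarrow> valid A V \<and> good A V p"
  unfolding valid_def by (auto simp: less_Suc_eq nth_append)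

lemma \<gamma>_nonneg: "0 < \<gamma>\<^sub>2" "0 < \<gamma>\<^sub>1"
proof -
  have "0 < 2 * \<beta> * (\<rho> + (real k + 1) * w)"
    using \<beta> \<rho> w by (intro mult_pos_pos add_pos_nonneg) auto
  then show g2: "0 < \<gamma>\<^sub>2" using \<gamma>\<^sub>2 by linarith
  have "0 < (real (P * k) + 1) * \<gamma>\<^sub>2 + \<beta> * \<rho>"
    using g2 \<beta> \<rho> by (intro add_nonneg_pos mult_nonneg_nonneg mult_pos_pos) auto
  then show "0 < \<gamma>\<^sub>1" using \<gamma>\<^sub>1\<^sub>2 by linarith
qed

section \<open>Maxima of pieces and the first active piece\<close>

lemma finite_pieces: "finite I \<Longrightarrow> finite (pieces I j)"
  by (simp add: pieces_def)

lemma pieces_nonempty: "pieces I j \<noteq> {}"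
  by (simp add: pieces_def)

lemma val_le_F: "finite J \<Longrightarrow> i \<in> J \<Longrightarrow> val A V i x \<le> F A V J x"
  unfolding F_def by (rule Max_ge) auto

lemma sel_in:
  assumes "finite J" "J \<noteq> {}"
  shows "sel A V J x \<in> J" "val A V (sel A V J x) x = F A V J x"
proof -
  have "F A V J x \<in> (\<lambda>i. val A V i x) ` J"
    unfolding F_def using assms by (intro Max_in) auto
  then obtain i where "i \<in> J \<and> val A V i x = F A V J x" by auto
  from LeastI[of "\<lambda>i. i \<in> J \<and> val A V i x = F A V J x", OF this]
  show "sel A V J x \<in> J" "val A V (sel A V J x) x = F A V J x"
    by (auto simp: sel_def)
qed

lemma sel_le: "i \<in> J \<Longrightarrow> val A V i x = F A V J x \<Longrightarrow> sel A V J x \<le> i"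
  unfolding sel_def by (rule Least_le) simp

lemma F_eq:
  assumes "finite J'" "J \<subseteq> J'" "i \<in> J" "val A V i x = F A V J' x"
  shows "F A V J x = F A V J' x"
proof (rule antisym)
  show "F A V J x \<le> F A V J' x"
    unfolding F_def using assms by (intro Max_mono) auto
  show "F A V J' x \<le> F A V J x"
    using val_le_F[of J i A V x] assms finite_subset by metis
qed

lemma resp_restrict:
  assumes "finite J'" "J \<subseteq> J'" "sel A V J' x \<in> J"
  shows "resp A V J x = resp A V J' x"
proof -
  have J': "J' \<noteq> {}" using assms by auto
  have FF: "F A V J x = F A V J' x"
    using assms sel_in(2)[OF assms(1) J'] by (intro F_eq[of _ _ "sel A V J' x"])
  have "sel A V J x = sel A V J' x"
  proof (rule antisym)
    show "sel A V J x \<le> sel A V J' x"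
      using assms sel_in(2)[OF assms(1) J'] by (intro sel_le) (auto simp: FF)
    have "sel A V J x \<in> J" "val A V (sel A V J x) x = F A V J x"
      using assms finite_subset by (auto intro!: sel_in)
    then show "sel A V J' x \<le> sel A V J x"
      using assms(2) by (intro sel_le) (auto simp: FF)
  qed
  then show ?thesis by (simp add: resp_def FF)
qed

lemma resp_extend:
  assumes "finite J'" "J \<noteq> {}" "J \<subseteq> J'" "\<And>i. i \<in> J' - J \<Longrightarrow> val A V i x \<le> F A V J x"
    and "\<And>i j. i \<in> J' - J \<Longrightarrow> j \<in> J \<Longrightarrow> j < i"
  shows "resp A V J x = resp A V J' x"
proof (rule resp_restrict[OF assms(1,3)])
  have fin: "finite J" using assms finite_subset by blast
  have J': "J' \<noteq> {}" using assms by auto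
  have "val A V i x \<le> F A V J x" if "i \<in> J'" for i
    using assms(4)[of i] val_le_F[OF fin, of i] that by blast
  then have "F A V J' x \<le> F A V J x"
    unfolding F_def[of A V J'] using assms(1) J' by (subst Max_le_iff) auto
  then have "val A V (sel A V J x) x = F A V J' x"
    using sel_in[OF fin assms(2)] val_le_F[OF assms(1)] assms(3) by (metis antisym subsetD)
  then have "sel A V J' x \<le> sel A V J x"
    using sel_in(1)[OF fin assms(2)] assms(3) by (intro sel_le) auto
  then show "sel A V J' x \<in> J"
    using sel_in(1)[OF assms(1) J'] sel_in(1)[OF fin assms(2)] assms(5) by (meson DiffI not_le)
qed

lemma resp_cong:
  assumes "I \<subseteq> {..<n}" "\<And>m. m \<le> j \<Longrightarrow> vec V m = vec V' m" "\<And>r. r \<in> I \<Longrightarrow> A r = A' r"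
  shows "F A V (pieces I j) x = F A' V' (pieces I j) x"
    and "resp A V (pieces I j) x = resp A' V' (pieces I j) x"
proof -
  have rr: "row A r = row A' r" if "r \<in> I" for r
    unfolding row_def assms(3)[OF that] ..
  have eq: "val A V i x = val A' V' i x \<and> grad A V i x = grad A' V' i x" if "i \<in> pieces I j" for i
  proof -
    from that consider "i = 0" | r where "r \<in> I" "i = Suc r" | "n + 1 \<le> i" "i \<le> n + 1 + j"
      by (auto simp: pieces_def)
    then show ?thesis
    proof cases
      case 2
      with assms(1) have "Suc r \<le> n" by auto
      then show ?thesis using 2 rr by (simp add: val_def grad_def)
    next
      case 3
      then have "vec V (i - n - 1) = vec V' (i - n - 1)" by (intro assms(2)) auto
      then show ?thesis using 3 by (simp add: val_def grad_def)
    qed (simp add: val_def grad_def)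
  qed
  then show F: "F A V (pieces I j) x = F A' V' (pieces I j) x"
    unfolding F_def by (metis (no_types, lifting) image_cong)
  have "(i \<in> pieces I j \<and> val A V i x = F A V (pieces I j) x) \<longleftrightarrow>
      (i \<in> pieces I j \<and> val A' V' i x = F A' V' (pieces I j) x)" for i
    using eq F by auto
  then have "sel A V (pieces I j) x = sel A' V' (pieces I j) x"
    unfolding sel_def by presburger
  moreover have "sel A V (pieces I j) x \<in> pieces I j"
    using assms(1) by (intro sel_in(1) finite_pieces pieces_nonempty) (auto dest: finite_subset)
  ultimately show "resp A V (pieces I j) x = resp A' V' (pieces I j) x"
    using eq F by (simp add: resp_def)
qed

section \<open>Runs of the oracle on prefixes of the vector sequence\<close>

lemma extend_cases: "extend A V I E x = E \<or> (extend A V I E x = E @ [x] \<and> explores A V I E x)"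
  by (auto simp: extend_def)

lemma snd_step: "snd (step A V I st) = extend A V I (snd st) (query alg (fst st))"
  by (simp add: step_def Let_def)

lemma state_Suc: "state A V (Suc t) = step A V {..<n} (state A V t)"
  by (simp add: state_def)

lemma expl_Suc: "expl A V (Suc t) = extend A V {..<n} (expl A V t) (qu A V t)"
  by (simp add: expl_def state_Suc snd_step qu_def)

lemma expl_0 [simp]: "expl A V 0 = []"
  by (simp add: expl_def state_def)

lemma iterate_prefix: "\<exists>R. snd ((step A V I ^^ t) st) = snd st @ R"
proof (induction t)
  case (Suc t)
  then show ?case
    using extend_cases[of A V I "snd ((step A V I ^^ t) st)"] by (fastforce simp: snd_step)
qed simp

lemma state_add: "state A V (t' + t) = (step A V {..<n} ^^ t') (state A V t)"
  by (simp add: state_def funpow_add)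

lemma expl_prefix: "t \<le> t' \<Longrightarrow> \<exists>R. expl A V t' = expl A V t @ R"
  using iterate_prefix[of "t' - t" A V "{..<n}" "state A V t"] state_add[of A V "t' - t" t]
  by (simp add: expl_def)

lemma length_expl_mono: "t \<le> t' \<Longrightarrow> length (expl A V t) \<le> length (expl A V t')"
  using expl_prefix[of t t' A V] by auto

lemma length_expl_le: "length (expl A V t) \<le> N"
  by (induction t) (auto simp: expl_Suc extend_def explores_def)

lemma vec_take: "m < i \<Longrightarrow> vec (take i V) m = vec V m"
  by (simp add: vec_def)

text \<open>With fewer than \<open>i\<close> explored queries, the exploration test reads only
  vectors below \<open>i\<close>, so both runs decide alike. The answer to the i-th explored query
  already reads vector \<open>i\<close>: from there on the memories may differ, while the first
  \<open>i\<close> explored queries still agree.\<close>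

lemma state_take:
  assumes "0 < i"
  shows "(length (expl A V t) < i \<and> state A V t = state A (take i V) t) \<or>
    (i \<le> length (expl A V t) \<and> i \<le> length (expl A (take i V) t) \<and>
      take i (expl A V t) = take i (expl A (take i V) t))"
proof (induction t)
  case 0
  then show ?case using assms by (simp add: state_def)
next
  case (Suc t)
  then show ?case
  proof (elim disjE conjE)
    assume len: "length (expl A V t) < i" and st: "state A V t = state A (take i V) t"
    let ?E = "expl A V t" and ?x = "qu A V t" and ?E' = "extend A V {..<n} (expl A V t) (qu A V t)"
    have same: "expl A (take i V) t = ?E" "qu A (take i V) t = ?x"
      using st by (auto simp: expl_def qu_def)
    have c: "F A (take i V) (pieces {..<n} j) x = F A V (pieces {..<n} j) x"
      "resp A (take i V) (pieces {..<n} j) x = resp A V (pieces {..<n} j) x" if "j < i" for j x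
      using that by (auto intro!: resp_cong vec_take)
    have ext: "extend A (take i V) {..<n} ?E ?x = ?E'"
      unfolding extend_def explores_def using c(1)[OF len] by simp
    have unf: "step A W {..<n} (state A V t) = (update alg (fst (state A V t)) ?x
        (resp A W (pieces {..<n} (length (extend A W {..<n} ?E ?x))) ?x), extend A W {..<n} ?E ?x)" for W
      by (simp add: step_def Let_def expl_def qu_def)
    show ?thesis
    proof (cases "length ?E' < i")
      case True
      then have "state A (take i V) (Suc t) = state A V (Suc t)"
        by (simp only: state_Suc st[symmetric] unf ext c(2))
      then show ?thesis using True by (simp add: expl_Suc)
    next
      case False
      then show ?thesis by (simp add: expl_Suc same ext)
    qed
  next
    assume "i \<le> length (expl A V t)" "i \<le> length (expl A (take i V) t)"
      "take i (expl A V t) = take i (expl A (take i V) t)"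
    then show ?thesis
      by (auto simp: expl_Suc extend_def)
  qed
qed

lemma expl_take: "0 < i \<Longrightarrow> take i (expl A V t) = take i (expl A (take i V) t)"
  using state_take[of i A V t] by (auto simp: expl_def)

lemma length_fst_state: "length (fst (state A V t)) = M"
proof (induction t)
  case (Suc t)
  have "length (update alg m q r) = M" if "length m = M" for m q r
    using valid_alg that unfolding valid_alg_def by blast
  then show ?case using Suc by (simp add: state_Suc step_def Let_def)
qed (simp add: state_def)

section \<open>What the tests guarantee along the final run\<close>

lemma valid_passes:
  assumes "valid A V" "i < length V"
  shows "passes A (take i V) (V ! i)" "vec V i = half_diff d (V ! i)"
  using assms by (auto simp: valid_def good_def vec_def)

lemma enorm_vec_le:
  assumes "valid A V"
  shows "enorm d (vec V i) \<le> 1"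
  using valid_passes(1)[OF assms, of i] by (auto simp: vec_def passes_def enorm_half_diff_le)

text \<open>Vector \<open>i\<close> was tested against the run on the vectors before it, and that
  run agrees with the full one up to and including the query that releases vector
  \<open>i\<close>.\<close>

lemma valid_query:
  assumes "valid A V" "0 < i" "i < length V" "length (expl A V t) < i" "t < T"
  shows "\<bar>inner_d d (vec V i) (qu A V t)\<bar> \<le> s * enorm d (qu A V t)"
proof -
  have "state A V t = state A (take i V) t"
    using state_take[OF assms(2), of A V t] assms(4) by auto
  then have "qu A V t \<in> tests A (take i V)"
    using assms(5) by (auto simp: tests_def qu_def)
  then show ?thesis
    using valid_passes[OF assms(1,3)] by (auto simp: passes_def)
qed

text \<open>The block tested for vector \<open>i\<close> extends what is explored of its period at
  time \<open>t\<close>; Gram-Schmidt respects prefixes, so every direction known at time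
  \<open>t\<close> was tested.\<close>

lemma valid_orthogonal:
  assumes "valid A V" "0 < i" "i < length V" "length (expl A V t) \<le> i" "t \<le> T"
    and u: "u \<in> set (gram_schmidt d (drop (k * ((i - 1) div k)) (expl A V t)))"
  shows "\<bar>inner_d d (vec V i) u\<bar> \<le> w"
proof -
  obtain R where R: "expl A V T = expl A V t @ R" using expl_prefix[OF assms(5)] by blast
  let ?c = "k * ((i - 1) div k)"
  have "blk i (expl A (take i V) T) = drop ?c (take i (expl A V T))"
    unfolding blk_def using expl_take[OF assms(2), of A V T] by simp
  also have "take i (expl A V T) = expl A V t @ take (i - length (expl A V t)) R"
    using assms(4) by (simp add: R)
  finally obtain R' where "blk i (expl A (take i V) T) = drop ?c (expl A V t) @ R'"
    by (metis drop_append)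
  then have "u \<in> set (gram_schmidt d (blk i (expl A (take i V) T)))"
    using u set_gram_schmidt_append[of d "drop ?c (expl A V t)"] by auto
  then show ?thesis
    using valid_passes[OF assms(1,3)] assms(3) by (auto simp: passes_def min_def)
qed

text \<open>Expand \<open>x\<close> along \<open>us\<close>: at most \<open>k\<close> coefficients,
  none larger than 1 in absolute value.\<close>

lemma nearly_orthogonal_bound:
  assumes "\<And>u. u \<in> set us \<Longrightarrow> \<bar>inner_d d v u\<bar> \<le> w" "\<And>u. u \<in> set us \<Longrightarrow> enorm d u \<le> 1"
    "enorm d x \<le> 1" "length us \<le> k"
  shows "\<bar>inner_d d v x\<bar> \<le> real k * w + \<bar>inner_d d v (resid d us x)\<bar>"
proof -
  have "\<bar>\<Sum>u\<leftarrow>us. inner_d d x u * inner_d d v u\<bar> \<le> (\<Sum>u\<leftarrow>us. \<bar>inner_d d x u * inner_d d v u\<bar>)"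
    using sum_list_abs[of "map (\<lambda>u. inner_d d x u * inner_d d v u) us"] by (simp add: comp_def)
  also have "\<dots> \<le> (\<Sum>u\<leftarrow>us. w)"
  proof (rule sum_list_mono)
    fix u assume u: "u \<in> set us"
    have "\<bar>inner_d d x u\<bar> \<le> 1 * 1"
      by (rule order_trans[OF inner_d_le_enorm mult_mono]) (use assms u in auto)
    then have "\<bar>inner_d d x u\<bar> * \<bar>inner_d d v u\<bar> \<le> 1 * w"
      by (intro mult_mono assms(1)[OF u]) auto
    then show "\<bar>inner_d d x u * inner_d d v u\<bar> \<le> w" by (simp add: abs_mult)
  qed
  also have "\<dots> = real (length us) * w" by (simp add: sum_list_triv)
  also have "\<dots> \<le> real k * w" using assms(4) w by (intro mult_right_mono) auto
  finally show ?thesis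
    using inner_d_decompose[of d v x us] by linarith
qed

lemma length_cur: "length (cur E) < k"
  unfolding cur_def using k by (simp add: minus_mult_div_eq_mod)

lemma norm_piece_le_F: "finite I \<Longrightarrow> enorm d x - 1 \<le> F A V (pieces I j) x"
  using val_le_F[of "pieces I j" 0 A V x] by (simp add: finite_pieces val_def pieces_def)

text \<open>The exploration threshold is negative in every period, so all consulted pieces are
  negative at an explored query.\<close>

lemma explores_imp:
  assumes "explores A V I E x" "finite I"
  shows "enorm d x \<le> 1" "i \<in> I \<Longrightarrow> I \<subseteq> {..<n} \<Longrightarrow> \<bar>inner_d d (row A i) x\<bar> \<le> \<eta>"
proof -
  have "0 \<le> real (length E div k) * \<gamma>\<^sub>1" using \<gamma>_nonneg by simp
  moreover have "F A V (pieces I (length E)) x < - (real (length E div k) + 1) * \<gamma>\<^sub>1 + \<gamma>\<^sub>1 / 2"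
    using assms(1) by (simp only: explores_def)
  moreover have "- (real (length E div k) + 1) * \<gamma>\<^sub>1 = - (real (length E div k) * \<gamma>\<^sub>1) - \<gamma>\<^sub>1"
    by (simp add: algebra_simps)
  ultimately have neg: "F A V (pieces I (length E)) x < 0"
    using \<gamma>_nonneg by linarith
  then show "enorm d x \<le> 1" using norm_piece_le_F[OF assms(2), of x A V "length E"] by simp
  assume "i \<in> I" "I \<subseteq> {..<n}"
  then have "val A V (Suc i) x = \<bar>inner_d d (row A i) x\<bar> - \<eta>" by (auto simp: val_def)
  moreover have "val A V (Suc i) x \<le> F A V (pieces I (length E)) x"
    using \<open>i \<in> I\<close> by (intro val_le_F finite_pieces assms(2)) (simp add: pieces_def)
  ultimately show "\<bar>inner_d d (row A i) x\<bar> \<le> \<eta>" using neg by simp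
qed

section \<open>Robust independence of the explored queries within each period\<close>

definition robust_blocks where
  "robust_blocks E \<longleftrightarrow> (\<forall>p. robust d \<rho> (take k (drop (k * p) E)))"

lemma robust_blocks_Nil [simp]: "robust_blocks []"
  by (simp add: robust_blocks_def)

lemma cur_eq_take: "cur E = take k (drop (k * (length E div k)) E)"
  using length_cur[of E] by (simp add: cur_def)

lemma robust_blocks_extend:
  assumes "robust_blocks E" "finite I"
  shows "robust_blocks (extend A V I E x)"
proof (cases "explores A V I E x")
  case True
  have "robust d \<rho> (take k (drop (k * p) (E @ [x])))" for p
  proof -
    consider "p < length E div k" | "p = length E div k" | "length E div k < p" by linarith
    then show ?thesis
    proof cases
      case 1
      then have "k * Suc p \<le> k * (length E div k)" by (intro mult_le_mono2) simp
      also have "\<dots> \<le> length E" by simp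
      finally have eq: "take k (drop (k * p) (E @ [x])) = take k (drop (k * p) E)" by simp
      show ?thesis using assms(1) unfolding eq robust_blocks_def by blast
    next
      case 2
      then have "take k (drop (k * p) (E @ [x])) = cur E @ [x]"
        using length_cur[of E] by (simp add: cur_def)
      moreover have "robust d \<rho> (cur E)"
        using assms(1) unfolding cur_eq_take robust_blocks_def by blast
      ultimately show ?thesis
        using True explores_imp(1)[OF True assms(2)] by (simp add: robust_snoc explores_def)
    next
      case 3
      then have "k * Suc (length E div k) \<le> k * p" by (intro mult_le_mono2) simp
      moreover have "length E < k * Suc (length E div k)"
        using k by (metis dividend_less_times_div mult_Suc_right)
      ultimately show ?thesis by simp
    qed
  qed
  then show ?thesis using True by (simp add: extend_def robust_blocks_def)
qed (use assms in \<open>simp add: extend_def\<close>)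

lemma robust_blocks_iterate:
  "robust_blocks (snd st) \<Longrightarrow> finite I \<Longrightarrow> robust_blocks (snd ((step A V I ^^ t) st))"
  by (induction t) (auto simp: snd_step robust_blocks_extend)

lemma robust_blocks_expl: "robust_blocks (expl A V t)"
  unfolding expl_def state_def by (rule robust_blocks_iterate) auto

text \<open>Error of near orthogonality: \<open>w\<close> for each of at most \<open>k\<close>
  directions, \<open>\<rho>\<close> for a short residual, and one more \<open>w\<close> for the
  direction of a query just explored.\<close>

definition err :: real where "err = \<rho> + (real k + 1) * w"

lemma offs_bounds:
  assumes "0 < i" "i \<le> N"
  shows "(real ((i - 1) div k) + 1) * \<gamma>\<^sub>1 \<le> offs i"
    "offs i \<le> (real ((i - 1) div k) + 1) * \<gamma>\<^sub>1 + \<gamma>\<^sub>1 / 4 - \<beta> * err / 2"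
proof -
  show "(real ((i - 1) div k) + 1) * \<gamma>\<^sub>1 \<le> offs i"
    using assms \<gamma>_nonneg by (simp add: offs_def)
  have "real i * \<gamma>\<^sub>2 \<le> real N * \<gamma>\<^sub>2"
    using assms \<gamma>_nonneg by (intro mult_right_mono of_nat_mono) auto
  moreover have "\<beta> * err / 2 \<le> \<gamma>\<^sub>2" using \<gamma>\<^sub>2 \<gamma>_nonneg \<beta> by (simp add: err_def)
  moreover have "0 \<le> \<beta> * \<rho>" using \<beta> \<rho> by simp
  ultimately have "real i * \<gamma>\<^sub>2 \<le> \<gamma>\<^sub>1 / 4 - \<beta> * err / 2"
    using \<gamma>\<^sub>1\<^sub>2 by (simp add: distrib_right)
  then show "offs i \<le> (real ((i - 1) div k) + 1) * \<gamma>\<^sub>1 + \<gamma>\<^sub>1 / 4 - \<beta> * err / 2"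
    using assms by (simp add: offs_def)
qed

lemma offs_mono:
  assumes "i < i'" "0 < i"
  shows "offs i + \<gamma>\<^sub>2 \<le> offs i'"
proof -
  have "(real ((i - 1) div k) + 1) * \<gamma>\<^sub>1 \<le> (real ((i' - 1) div k) + 1) * \<gamma>\<^sub>1"
    using assms \<gamma>_nonneg by (intro mult_right_mono add_mono of_nat_mono div_le_mono) auto
  moreover have "(real i + 1) * \<gamma>\<^sub>2 \<le> real i' * \<gamma>\<^sub>2"
    using assms \<gamma>_nonneg by (intro mult_right_mono) auto
  ultimately show ?thesis
    using assms unfolding offs_def by (simp add: distrib_right)
qed

lemma offs_nonneg: "0 \<le> offs i"
  unfolding offs_def using \<gamma>_nonneg by simp

lemma vec_piece: "val A V (n + 1 + i) x = \<beta> * inner_d d (vec V i) x - offs i"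
  by (simp add: val_def)

lemma vec_piece_le_F: "finite I \<Longrightarrow> i \<le> j \<Longrightarrow> \<beta> * inner_d d (vec V i) x - offs i \<le> F A V (pieces I j) x"
  unfolding vec_piece[symmetric, of V i x A]
  by (intro val_le_F finite_pieces) (auto simp: pieces_def)

text \<open>Adding the vectors of later rounds does not change the answer to an earlier query. If the
  query was refused because the current value is high, the new vectors have small inner product
  with it; otherwise it (nearly) lies in the span of the explored queries of its period, to which
  the last vector \<open>i\<^sub>0\<close> of that period and all later ones are nearly orthogonal.\<close>

lemma later_pieces_inactive:
  assumes V: "valid A V" "length V = N + 1" and t: "t < T"
  defines "j' \<equiv> length (expl A V (Suc t))" and "x \<equiv> qu A V t"
  shows "j' < i \<Longrightarrow> i \<le> N \<Longrightarrow> \<beta> * inner_d d (vec V i) x - offs i \<le> F A V (pieces {..<n} j') x"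
    and "length (expl A V t) < N \<Longrightarrow> - (real P + 1) * \<gamma>\<^sub>1 \<le> F A V (pieces {..<n} j') x"
proof -
  define E where "E = expl A V t"
  define j where "j = length E"
  define p where "p = j div k"
  have E': "expl A V (Suc t) = extend A V {..<n} E x"
    by (simp add: expl_Suc E_def x_def)
  have jj': "j \<le> j'" "j' \<le> Suc j"
    unfolding j'_def j_def E' by (auto simp: extend_def)
  let ?F = "F A V (pieces {..<n} j) x" and ?F' = "F A V (pieces {..<n} j') x"
  have FF': "?F \<le> ?F'"
    unfolding F_def using jj'
    by (intro Max_mono image_mono finite_imageI finite_pieces) (auto simp: pieces_def)
  have Vi: "i < length V" if "i \<le> N" for i using V(2) that by simp
  have query: "\<bar>inner_d d (vec V i) x\<bar> \<le> s * enorm d x" if "j < i" "i \<le> N" for i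
    unfolding x_def using that t V(1) Vi by (intro valid_query) (auto simp: j_def E_def)
  have pP: "p < P" if "j < N" using that k by (simp add: p_def less_mult_imp_div_less)
  have err: "0 < err" using \<rho> w by (simp add: err_def add_pos_nonneg)
  consider (high) "- (real p + 1) * \<gamma>\<^sub>1 + \<gamma>\<^sub>1 / 2 \<le> ?F" | (full) "N \<le> j"
    | (low) "j < N" "?F < - (real p + 1) * \<gamma>\<^sub>1 + \<gamma>\<^sub>1 / 2" by linarith
  then have "(j' < i \<longrightarrow> i \<le> N \<longrightarrow> \<beta> * inner_d d (vec V i) x - offs i \<le> ?F')
      \<and> (j < N \<longrightarrow> - (real P + 1) * \<gamma>\<^sub>1 \<le> ?F')" for i
  proof cases
    case high
    have "\<beta> * inner_d d (vec V i) x - offs i \<le> ?F" if i: "j < i" "i \<le> N"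
    proof -
      have q: "\<beta> * inner_d d (vec V i) x \<le> \<beta> * (s * enorm d x)"
        using query[OF i] \<beta> by (intro mult_left_mono) auto
      show ?thesis
      \<comment> \<open>Up to radius 2 the new vector contributes at most 2 \<beta> s, which is at
        most half of \<open>\<gamma>\<^sub>1\<close>, the margin of the threshold. Beyond it the
        norm piece |x| - 1 exceeds |x| / 2.\<close>
      proof (cases "enorm d x \<le> 2")
        case True
        then have "\<beta> * (s * enorm d x) \<le> \<beta> * (s * 2)"
          using \<beta> s by (intro mult_left_mono) auto
        moreover have "p \<le> (i - 1) div k" unfolding p_def using i by (intro div_le_mono) simp
        then have "(real p + 1) * \<gamma>\<^sub>1 \<le> (real ((i - 1) div k) + 1) * \<gamma>\<^sub>1"
          using \<gamma>_nonneg by (intro mult_right_mono) auto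
        ultimately show ?thesis
          using q high offs_bounds(1)[of i] i \<gamma>\<^sub>1 by (simp add: algebra_simps)
      next
        case False
        have "\<beta> * (s * enorm d x) \<le> 1 / 2 * (1 * enorm d x)"
          using \<beta> s by (intro mult_mono) auto
        then show ?thesis
          using q False norm_piece_le_F[of "{..<n}" x A V j, OF finite_lessThan] offs_nonneg[of i]
          by linarith
      qed
    qed
    moreover have "- (real P + 1) * \<gamma>\<^sub>1 \<le> ?F" if "j < N"
    proof -
      have "(real p + 1) * \<gamma>\<^sub>1 \<le> (real P + 1) * \<gamma>\<^sub>1"
        using pP[OF that] \<gamma>_nonneg by (intro mult_right_mono) auto
      then show ?thesis using high \<gamma>_nonneg by linarith
    qed
    ultimately show ?thesis using FF' jj' by fastforce
  next
    case full
    then show ?thesis using jj' by auto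
  next
    case low
    have "0 \<le> real p * \<gamma>\<^sub>1" using \<gamma>_nonneg by simp
    moreover have "- (real p + 1) * \<gamma>\<^sub>1 = - (real p * \<gamma>\<^sub>1) - \<gamma>\<^sub>1"
      by (simp add: algebra_simps)
    ultimately have thr: "- (real p + 1) * \<gamma>\<^sub>1 + \<gamma>\<^sub>1 / 2 < 0"
      using \<gamma>_nonneg by linarith
    then have x1: "enorm d x \<le> 1"
      using low(2) norm_piece_le_F[of "{..<n}" x A V j] by simp
    let ?us = "gram_schmidt d (cur E)"
    have cur: "cur E = drop (k * p) E" by (simp add: cur_def p_def j_def)
    have lus: "length ?us \<le> k" using length_cur[of E] by simp
    have us_w: "\<bar>inner_d d (vec V i) u\<bar> \<le> w"
      if "0 < i" "j \<le> i" "i \<le> N" "(i - 1) div k = p" "u \<in> set ?us" for i u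
    proof (rule valid_orthogonal[of A V i t])
      show "u \<in> set (gram_schmidt d (drop (k * ((i - 1) div k)) (expl A V t)))"
        using that(5) unfolding that(4) cur unfolding E_def .
    qed (use that V(1) Vi t in \<open>auto simp: E_def j_def\<close>)
    have inner_resid: "\<bar>inner_d d (vec V i) (resid d ?us x)\<bar> \<le> enorm d (resid d ?us x)" for i
      using mult_right_mono[OF enorm_vec_le[OF V(1), of i] enorm_nonneg[of d "resid d ?us x"]]
        inner_d_le_enorm[of d "vec V i" "resid d ?us x"] by simp
    \<comment> \<open>\<open>i\<^sub>0\<close> has to be present in the answer already: it is the
      vector just released if the query is explored, and the last one released before
      otherwise.\<close>
    have "\<exists>i\<^sub>0. 0 < i\<^sub>0 \<and> i\<^sub>0 \<le> j' \<and> i\<^sub>0 \<le> N \<and> (i\<^sub>0 - 1) div k = p \<and>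
        (\<forall>i. i\<^sub>0 \<le> i \<longrightarrow> i \<le> N \<longrightarrow> (i - 1) div k = p \<longrightarrow> \<bar>inner_d d (vec V i) x\<bar> \<le> err)"
    proof (cases "\<rho> \<le> enorm d (resid d ?us x)")
      case True
      then have "explores A V {..<n} E x"
        using low by (simp add: explores_def j_def p_def)
      then have Ex: "expl A V (Suc t) = E @ [x]" using E' by (simp add: extend_def)
      have "\<bar>inner_d d (vec V i) x\<bar> \<le> err" if i: "j + 1 \<le> i" "i \<le> N" "(i - 1) div k = p" for i
      proof -
        let ?r = "resid d ?us x"
        have dr: "drop (k * p) (E @ [x]) = cur E @ [x]"
          using low(1) by (simp add: cur p_def j_def)
        have "normalized d ?r \<in> set (gram_schmidt d (drop (k * ((i - 1) div k)) (expl A V (Suc t))))"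
          unfolding Ex i(3) dr gram_schmidt_snoc by simp
        then have "\<bar>inner_d d (vec V i) (normalized d ?r)\<bar> \<le> w"
          by (rule valid_orthogonal[of A V i "Suc t", rotated -1])
            (use i V(1) Vi t in \<open>auto simp: Ex j_def\<close>)
        moreover have "?r = (\<lambda>i. enorm d ?r * normalized d ?r i)"
          using True \<rho> by (auto simp: normalized_def)
        then have "inner_d d (vec V i) ?r = enorm d ?r * inner_d d (vec V i) (normalized d ?r)"
          by (metis inner_d_scale_right)
        moreover have "enorm d ?r \<le> 1"
        proof -
          have "orthonormal d ?us"
            using robust_blocks_expl[of A V t] \<rho> unfolding cur_eq_take E_def robust_blocks_def
            by (intro robust_orthonormal) auto
          then show ?thesis using enorm_resid_le[of d ?us x] x1 by linarith
        qed
        ultimately have "\<bar>inner_d d (vec V i) ?r\<bar> \<le> 1 * w"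
          by (simp add: abs_mult) (meson abs_ge_zero enorm_nonneg mult_left_le_one_le order_trans)
        moreover have "\<bar>inner_d d (vec V i) x\<bar> \<le> real k * w + \<bar>inner_d d (vec V i) ?r\<bar>"
          using i us_w[of i] x1 lus by (intro nearly_orthogonal_bound) (auto intro: enorm_gram_schmidt)
        ultimately show ?thesis using \<rho> by (simp add: err_def distrib_right)
      qed
      then show ?thesis
        using low(1) Ex by (intro exI[of _ "j + 1"]) (auto simp: j'_def j_def p_def)
    next
      case False
      \<comment> \<open>At the start of a period nothing of it has been explored, so a short
        residual means a short query. There vector \<open>j\<close>, still on the level of the
        previous period, lies above the threshold.\<close>
      have "j mod k \<noteq> 0"
      proof
        assume "j mod k = 0"
        then have "k * p = j" unfolding p_def by (metis add.right_neutral mult_div_mod_eq)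
        then have "?us = []" by (simp add: cur j_def)
        then have "enorm d x < \<rho>" using False by (simp add: resid_def proj_def)
        have "\<bar>inner_d d (vec V j) x\<bar> \<le> 1 * enorm d x"
          by (rule order_trans[OF inner_d_le_enorm]) (intro mult_right_mono enorm_vec_le[OF V(1)], simp)
        then have "- inner_d d (vec V j) x \<le> \<rho>" using \<open>enorm d x < \<rho>\<close> by linarith
        then have "\<beta> * - inner_d d (vec V j) x \<le> \<beta> * \<rho>" using \<beta> by (intro mult_left_mono) auto
        moreover have "offs j \<le> real p * \<gamma>\<^sub>1 + real N * \<gamma>\<^sub>2"
        proof -
          have "(if j = 0 then 0 else real ((j - 1) div k) + 1) = real p"
          proof (cases "j = 0")
            case False
            then obtain q where q: "p = Suc q" using \<open>k * p = j\<close> by (cases p) auto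
            have "(j - 1) div k = q"
              using k \<open>k * p = j\<close> q
              by (intro div_nat_eqI) (auto simp: algebra_simps)
            then show ?thesis using False q by simp
          qed (use \<open>k * p = j\<close> k in auto)
          moreover have "real j * \<gamma>\<^sub>2 \<le> real N * \<gamma>\<^sub>2"
            using low(1) \<gamma>_nonneg by (intro mult_right_mono of_nat_mono) auto
          ultimately show ?thesis unfolding offs_def by simp
        qed
        ultimately have "- (real p * \<gamma>\<^sub>1 + real N * \<gamma>\<^sub>2) - \<beta> * \<rho> \<le> ?F"
          using vec_piece_le_F[of "{..<n}" j j V x A] by simp
        then show False using low(2) \<gamma>\<^sub>1\<^sub>2 \<gamma>_nonneg by (simp add: algebra_simps)
      qed
      have "j > 0" using \<open>j mod k \<noteq> 0\<close> by (cases j) auto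
      have "(j - 1) div k = p"
      proof -
        have "j = k * p + j mod k" by (simp add: p_def)
        with \<open>j mod k \<noteq> 0\<close> show ?thesis
          using k mod_less_divisor[OF k, of j] by (intro div_nat_eqI) (auto simp: algebra_simps)
      qed
      moreover have "\<bar>inner_d d (vec V i) x\<bar> \<le> err" if i: "j \<le> i" "i \<le> N" "(i - 1) div k = p" for i
      proof -
        have "\<bar>inner_d d (vec V i) x\<bar> \<le> real k * w + \<bar>inner_d d (vec V i) (resid d ?us x)\<bar>"
          using i us_w[of i] x1 lus \<open>j > 0\<close> by (intro nearly_orthogonal_bound) (auto intro: enorm_gram_schmidt)
        then show ?thesis using False inner_resid[of i] w by (simp add: err_def distrib_right)
      qed
      ultimately show ?thesis
        using \<open>j > 0\<close> jj' low(1) by (intro exI[of _ j]) auto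
    qed
    then obtain i\<^sub>0 where i0: "0 < i\<^sub>0" "i\<^sub>0 \<le> j'" "i\<^sub>0 \<le> N" "(i\<^sub>0 - 1) div k = p"
      and near: "\<And>i. i\<^sub>0 \<le> i \<Longrightarrow> i \<le> N \<Longrightarrow> (i - 1) div k = p \<Longrightarrow> \<bar>inner_d d (vec V i) x\<bar> \<le> err"
      by blast
    have "- inner_d d (vec V i\<^sub>0) x \<le> err" using near[of i\<^sub>0] i0 by linarith
    then have "\<beta> * - inner_d d (vec V i\<^sub>0) x \<le> \<beta> * err" using \<beta> by (intro mult_left_mono) auto
    then have lower: "- \<beta> * err - offs i\<^sub>0 \<le> ?F'"
      using vec_piece_le_F[of "{..<n}" i\<^sub>0 j' V x A] i0 by simp
    have be: "2 * \<beta> * err \<le> \<gamma>\<^sub>2" "0 < \<beta> * err" using \<gamma>\<^sub>2 \<beta> err by (auto simp: err_def)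
    have "\<gamma>\<^sub>2 \<le> (real N + 1) * \<gamma>\<^sub>2" using \<gamma>_nonneg by (simp add: distrib_right)
    moreover have "0 < \<beta> * \<rho>" using \<beta> \<rho> by simp
    ultimately have small: "\<gamma>\<^sub>2 \<le> \<gamma>\<^sub>1 / 4" using \<gamma>\<^sub>1\<^sub>2 by linarith
    have "\<beta> * inner_d d (vec V i) x - offs i \<le> ?F'" if i: "j' < i" "i \<le> N"
    \<comment> \<open>In the same period one drop \<open>\<gamma>\<^sub>2\<close> outweighs two
      errors \<beta> err; in a later period a whole drop \<open>\<gamma>\<^sub>1\<close> outweighs
      \<beta> s and all smaller terms.\<close>
    proof (cases "(i - 1) div k = p")
      case True
      have "\<beta> * inner_d d (vec V i) x \<le> \<beta> * err"
        using near[OF _ i(2) True] i i0 \<beta> by (intro mult_left_mono) auto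
      then show ?thesis using lower offs_mono[of i\<^sub>0 i] i i0 be by simp
    next
      case False
      have "p \<le> (i - 1) div k" unfolding p_def using i jj' by (intro div_le_mono) simp
      then have "p + 1 \<le> (i - 1) div k" using False by simp
      then have "(real p + 1 + 1) * \<gamma>\<^sub>1 \<le> (real ((i - 1) div k) + 1) * \<gamma>\<^sub>1"
        using \<gamma>_nonneg by (intro mult_right_mono) auto
      moreover have "\<beta> * inner_d d (vec V i) x \<le> \<beta> * (s * 1)"
        using query[of i] i jj' mult_left_mono[OF x1 s(1)] \<beta> by (intro mult_left_mono) auto
      ultimately show ?thesis
        using lower offs_bounds(1)[of i] offs_bounds(2)[of i\<^sub>0] i i0 \<gamma>\<^sub>1 be small \<gamma>_nonneg
        by (simp add: algebra_simps)
    qed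
    moreover have "- (real P + 1) * \<gamma>\<^sub>1 \<le> ?F'"
    proof -
      have "(real p + 1) * \<gamma>\<^sub>1 \<le> real P * \<gamma>\<^sub>1"
        using pP[OF low(1)] \<gamma>_nonneg by (intro mult_right_mono) auto
      then show ?thesis
        using lower offs_bounds(2)[of i\<^sub>0] i0 be small \<gamma>_nonneg by (simp add: algebra_simps)
    qed
    ultimately show ?thesis by blast
  qed
  then show "j' < i \<Longrightarrow> i \<le> N \<Longrightarrow> \<beta> * inner_d d (vec V i) x - offs i \<le> ?F'"
    and "length (expl A V t) < N \<Longrightarrow> - (real P + 1) * \<gamma>\<^sub>1 \<le> ?F'"
    unfolding j_def E_def by blast+
qed

section \<open>The final function and its honest oracle\<close>

lemma vec_in_vecs: "vec V i \<in> vecs d"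
  by (auto simp: vec_def vecs_def half_diff_def)

lemma row_in_vecs: "row A i \<in> vecs d"
  by (simp add: row_def vecs_def)

lemma enorm_row_le:
  assumes "A \<in> mats" "i < n"
  shows "enorm d (row A i) \<le> 1"
proof -
  have "(row A i j)\<^sup>2 \<le> 1 / real d" if "j < d" for j
  proof -
    have "A i \<in> PiE {..<d} (\<lambda>_. {..<L})" using assms by (auto simp: mats_def)
    then have "A i j < L" using that by (auto dest: PiE_mem)
    then have "real (A i j) / real L \<le> 1" by simp
    then have "(real (A i j) / real L)\<^sup>2 \<le> 1" by (simp add: power_le_one)
    then have "(real (A i j) / real L)\<^sup>2 / real d \<le> 1 / real d"
      by (rule divide_right_mono) simp
    then show ?thesis using that by (simp add: row_def power_divide power_mult_distrib)
  qed
  then have "(\<Sum>j<d. (row A i j)\<^sup>2) \<le> (\<Sum>j<d. 1 / real d)" by (intro sum_mono) auto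
  then show ?thesis using d by (simp add: enorm_def)
qed

text \<open>Where a norm or a row product vanishes, x / 0 = 0 and sgn 0 = 0 give the zero vector,
  which is a subgradient there.\<close>

lemma piece_subgrad:
  assumes A: "A \<in> mats" and V: "valid A V" and x: "x \<in> vecs d"
  shows "is_subgrad d (val A V i) x (grad A V i x)" and "enorm d (grad A V i x) \<le> 1"
proof -
  consider "i = 0" | "0 < i" "i \<le> n" | "n < i" by linarith
  then have "is_subgrad d (val A V i) x (grad A V i x) \<and> enorm d (grad A V i x) \<le> 1"
  proof cases
    case 1
    have "enorm d x + inner_d d (normalized d x) (\<lambda>i. y i - x i) \<le> enorm d y" for y
    proof (cases "enorm d x = 0")
      case True
      then show ?thesis by (simp add: normalized_def)
    next
      case False
      have "inner_d d (normalized d x) y \<le> 1 * enorm d y"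
        using order_trans[OF inner_d_le_enorm mult_right_mono[OF enorm_normalized_le enorm_nonneg], of d x y]
        by linarith
      moreover have "inner_d d (normalized d x) x = enorm d x"
        using False by (simp add: normalized_def inner_d_linear flip: enorm_mult_self)
      ultimately show ?thesis by (simp add: inner_d_linear)
    qed
    moreover have "normalized d x \<in> vecs d" using x by (simp add: normalized_def vecs_def)
    ultimately show ?thesis
      using 1 by (auto simp: is_subgrad_def val_def grad_def enorm_normalized_le)
  next
    case 2
    let ?a = "row A (i - 1)" and ?s = "sgn (inner_d d (row A (i - 1)) x)"
    have "\<bar>inner_d d ?a x\<bar> + inner_d d (\<lambda>j. ?s * ?a j) (\<lambda>i. y i - x i) \<le> \<bar>inner_d d ?a y\<bar>" for y
    proof -
      have "?s * inner_d d ?a y \<le> \<bar>inner_d d ?a y\<bar>" "?s * inner_d d ?a x = \<bar>inner_d d ?a x\<bar>"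
        by (auto simp: sgn_if)
      then show ?thesis by (simp add: inner_d_linear right_diff_distrib)
    qed
    moreover have "(\<lambda>j. ?s * ?a j) \<in> vecs d" using row_in_vecs[of A "i - 1"] by (simp add: vecs_def)
    moreover have "enorm d (\<lambda>j. ?s * ?a j) \<le> 1"
      using enorm_row_le[OF A, of "i - 1"] 2 by (auto simp: enorm_scale sgn_if)
    ultimately show ?thesis using 2 by (auto simp: is_subgrad_def val_def grad_def)
  next
    case 3
    let ?v = "vec V (i - n - 1)"
    have "(\<lambda>j. \<beta> * ?v j) \<in> vecs d" using vec_in_vecs[of V "i - n - 1"] by (simp add: vecs_def)
    moreover have "enorm d (\<lambda>j. \<beta> * ?v j) \<le> 1"
      using \<beta> mult_mono[of \<beta> 1 "enorm d ?v" 1] enorm_vec_le[OF V] by (simp add: enorm_scale)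
    ultimately show ?thesis
      using 3 by (auto simp: is_subgrad_def val_def grad_def inner_d_linear right_diff_distrib)
  qed
  then show "is_subgrad d (val A V i) x (grad A V i x)" "enorm d (grad A V i x) \<le> 1" by auto
qed

lemma hard_function:
  assumes A: "A \<in> mats" and V: "valid A V" and J: "finite J" "J \<noteq> {}"
  shows "convex_d d (F A V J)" "lipschitz1_d d (F A V J)" "first_order_oracle d (F A V J) (resp A V J)"
proof -
  have sg: "is_subgrad d (F A V J) x (snd (resp A V J x))" if x: "x \<in> vecs d" for x
    unfolding is_subgrad_def
  proof (intro conjI ballI)
    let ?i = "sel A V J x"
    have *: "is_subgrad d (val A V ?i) x (grad A V ?i x)" by (rule piece_subgrad(1)[OF A V x])
    then show "snd (resp A V J x) \<in> vecs d" by (simp add: resp_def is_subgrad_def)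
    fix y assume "y \<in> vecs d"
    with * have "val A V ?i x + inner_d d (grad A V ?i x) (\<lambda>i. y i - x i) \<le> val A V ?i y"
      by (simp add: is_subgrad_def)
    also have "\<dots> \<le> F A V J y" using sel_in(1)[OF J] by (intro val_le_F J(1))
    finally show "F A V J x + inner_d d (snd (resp A V J x)) (\<lambda>i. y i - x i) \<le> F A V J y"
      using sel_in(2)[OF J] by (simp add: resp_def)
  qed
  then show "convex_d d (F A V J)" by (rule subgrads_imp_convex)
  show "lipschitz1_d d (F A V J)"
    by (rule subgrads_imp_lipschitz[OF sg]) (auto simp: resp_def intro: piece_subgrad(2)[OF A V])
  show "first_order_oracle d (F A V J) (resp A V J)"
    using sg by (simp add: first_order_oracle_def resp_def)
qed

text \<open>This turns the adaptive run into a run against one fixed function: within the horizon,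
  each answer is already that of the function with all vectors present.\<close>

lemma resp_final:
  assumes V: "valid A V" "length V = N + 1" and t: "t < T"
  shows "resp A V (pieces {..<n} (length (expl A V (Suc t)))) (qu A V t) = resp A V (pieces {..<n} N) (qu A V t)"
proof (rule resp_extend)
  let ?j = "length (expl A V (Suc t))"
  have jN: "?j \<le> N" by (rule length_expl_le)
  show "pieces {..<n} ?j \<subseteq> pieces {..<n} N" using jN by (auto simp: pieces_def)
  fix i assume i: "i \<in> pieces {..<n} N - pieces {..<n} ?j"
  then have "n + 1 \<le> i" "i \<le> n + 1 + N" "\<not> i \<le> n + 1 + ?j" by (auto simp: pieces_def)
  then obtain i' where i': "i = n + 1 + i'" "?j < i'" "i' \<le> N"
    by (metis add_le_cancel_left le_iff_add not_le)
  show "val A V i (qu A V t) \<le> F A V (pieces {..<n} ?j) (qu A V t)"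
    unfolding i'(1) vec_piece using later_pieces_inactive(1)[OF V t i'(2,3)] .
  fix m assume "m \<in> pieces {..<n} ?j"
  then show "m < i" using i' by (auto simp: pieces_def)
qed (auto simp: finite_pieces pieces_nonempty)

lemma memseq_eq_state:
  assumes V: "valid A V" "length V = N + 1"
  shows "t \<le> T \<Longrightarrow> memseq alg M (resp A V (pieces {..<n} N)) t = fst (state A V t)"
proof (induction t)
  case 0
  then show ?case by (simp add: state_def)
next
  case (Suc t)
  then have "memseq alg M (resp A V (pieces {..<n} N)) (Suc t) =
      update alg (fst (state A V t)) (qu A V t) (resp A V (pieces {..<n} N) (qu A V t))"
    by (simp add: Let_def qu_def)
  also have "\<dots> = fst (state A V (Suc t))"
    using resp_final[OF V, of t] Suc.prems
    by (simp add: state_Suc step_def Let_def qu_def expl_Suc expl_def)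
  finally show ?case .
qed

section \<open>The kernel of the rows and the potential\<close>

lemma basis:
  shows "orthonormal d (basis A)" "length (basis A) \<le> n" "i < n \<Longrightarrow> j < d \<Longrightarrow> resid d (basis A) (row A i) j = 0"
  using someI_ex[OF orthonormal_basis_exists[of d n "row A"]] by (auto simp: basis_def)

lemma inner_ker_proj: "inner_d d (ker_proj A x) y = inner_d d x (ker_proj A y)"
  unfolding ker_proj_def using inner_d_resid_resid[OF basis(1)] by metis

lemma inner_total: "inner_d d y (total V) = (\<Sum>m<length V. inner_d d y (vec V m))"
proof (induction V rule: rev_induct)
  case Nil
  then show ?case by (simp add: total_def)
next
  case (snoc p V)
  have "total (V @ [p]) = (\<lambda>i. total V i + half_diff d p i)" by (simp add: total_def)
  moreover have "(\<Sum>m<length V. inner_d d y (vec (V @ [p]) m)) = (\<Sum>m<length V. inner_d d y (vec V m))"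
    by (intro sum.cong) (auto simp: vec_def nth_append)
  ultimately show ?case using snoc by (simp add: inner_d_linear vec_def)
qed

text \<open>Unrolls a' \<le> C a + 1; as C \<ge> 1, the summand 1 is absorbed by the next power of
  C.\<close>

lemma pot_le:
  assumes "valid A V"
  shows "pot A V \<le> real (length V) * exp (\<Lambda>\<^sup>2 * s\<^sup>2 / 2) ^ length V"
  using assms
proof (induction V rule: rev_induct)
  case Nil
  then show ?case by (simp add: pot_def)
next
  case (snoc p V)
  let ?C = "exp (\<Lambda>\<^sup>2 * s\<^sup>2 / 2)"
  have C: "1 \<le> ?C" by simp
  have "pot A (V @ [p]) \<le> ?C * pot A V + 1" using snoc.prems by (simp add: valid_snoc good_def)
  also have "\<dots> \<le> ?C * (real (length V) * ?C ^ length V) + ?C ^ Suc (length V)"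
    using snoc C by (intro add_mono mult_left_mono one_le_power) (auto simp: valid_snoc)
  finally show ?case by (simp add: algebra_simps)
qed

end

text \<open>Of the squared norm 1/4 of a vector, the rows take at most 1/8 by \<open>ns\<close>.
  Later and earlier vectors spoil at most 1/32 each, by \<open>\<Lambda>N\<close> and
  \<open>sN\<close>, so 1/16 remains. The inequalities \<open>gap\<close> say that the resulting
  point is lower than twice the total drop on each of the three kinds of pieces.\<close>

locale adversary_opt = adversary +
  assumes ns: "real n * s\<^sup>2 \<le> 1 / 8" and \<Lambda>: "0 < \<Lambda>"
    and \<Lambda>N: "ln (real N + 1) + (real N + 1) * (\<Lambda>\<^sup>2 * s\<^sup>2 / 2) \<le> \<Lambda> / 32"
    and sN: "s * (3 * sqrt (real N + 1)) \<le> 1 / 32"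
    and gap: "2 * (real P + 1) * \<gamma>\<^sub>1 \<le> \<beta> / (96 * sqrt (real N + 1))"
      "2 * (real P + 1) * \<gamma>\<^sub>1 \<le> 1 / 2" "2 * (real P + 1) * \<gamma>\<^sub>1 \<le> \<eta>"
begin

section \<open>A low point, and why all vectors must be released\<close>

lemma sqrt_nine_mult: "sqrt (9 * x) = 3 * sqrt x"
  by (simp add: real_sqrt_mult)

text \<open>One term of the potential is at most the whole sum; compare exponents and divide by
  \<open>\<Lambda>\<close>.\<close>

lemma corr_ge:
  assumes "valid A V" "length V = N + 1" "i < length V"
  shows "- 1 / 32 \<le> corr A V i"
proof -
  have "exp (- \<Lambda> * corr A V i) \<le> pot A V"
    unfolding pot_def using assms(3) by (intro member_le_sum) auto
  also have "\<dots> \<le> real (length V) * exp (\<Lambda>\<^sup>2 * s\<^sup>2 / 2) ^ length V"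
    by (rule pot_le[OF assms(1)])
  also have "\<dots> = exp (ln (real N + 1) + (real N + 1) * (\<Lambda>\<^sup>2 * s\<^sup>2 / 2))"
  proof -
    have "exp (\<Lambda>\<^sup>2 * s\<^sup>2 / 2) ^ length V = exp ((real N + 1) * (\<Lambda>\<^sup>2 * s\<^sup>2 / 2))"
      using exp_of_nat_mult[of "N + 1" "\<Lambda>\<^sup>2 * s\<^sup>2 / 2"]
      by (simp only: assms(2) of_nat_add of_nat_1)
    moreover have "real (length V) = exp (ln (real N + 1))"
      by (simp add: assms(2) del: of_nat_mult)
    ultimately show ?thesis by (simp only: exp_add)
  qed
  finally have "- \<Lambda> * corr A V i \<le> \<Lambda> / 32" using \<Lambda>N by (simp only: exp_le_cancel_iff)
  then have "\<Lambda> * (- corr A V i) \<le> \<Lambda> * (1 / 32)" by simp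
  then show ?thesis using \<Lambda> by (simp only: mult_le_cancel_left_pos)
qed

lemma ker_proj_total_add:
  "ker_proj A (total (V @ [p])) = (\<lambda>i. ker_proj A (total V) i + ker_proj A (half_diff d p) i)"
  unfolding ker_proj_def resid_def proj_def total_def
  by (simp add: inner_d_linear distrib_right sum_list_addf algebra_simps)

text \<open>A new vector adds at most 1 plus twice a cross term, and the cross term was tested
  against the projected sum so far.\<close>

lemma enorm_ker_proj_total:
  assumes "valid A V" "length V \<le> N + 1"
  shows "inner_d d (ker_proj A (total V)) (ker_proj A (total V)) \<le> 2 * real (length V)"
  using assms
proof (induction V rule: rev_induct)
  case Nil
  then show ?case by (simp add: total_def ker_proj_def resid_def proj_def sum_list_eq_0)
next
  case (snoc p V)
  let ?S = "ker_proj A (total V)" and ?v = "half_diff d p"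
  have IH: "inner_d d ?S ?S \<le> 2 * real (length V)" using snoc by (simp add: valid_snoc)
  have ps: "passes A V p" using snoc.prems by (simp add: valid_snoc good_def)
  have "enorm d ?S \<le> sqrt (2 * real (length V))"
    using IH by (intro real_le_rsqrt) (simp add: enorm_power2)
  also have "\<dots> \<le> sqrt (9 * (real N + 1))" using snoc.prems(2) by (simp del: of_nat_mult)
  also have "\<dots> = 3 * sqrt (real N + 1)" by (rule sqrt_nine_mult)
  finally have "s * enorm d ?S \<le> s * (3 * sqrt (real N + 1))" using s(1) by (rule mult_left_mono)
  moreover have "\<bar>inner_d d ?v ?S\<bar> \<le> s * enorm d ?S" using ps by (simp add: passes_def tests_def)
  ultimately have cross: "\<bar>inner_d d ?v ?S\<bar> \<le> 1 / 32" using sN by linarith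
  have "inner_d d (ker_proj A ?v) (ker_proj A ?v) \<le> 1"
  proof -
    have "enorm d (ker_proj A ?v) \<le> 1"
      unfolding ker_proj_def using enorm_resid_le[OF basis(1), of A ?v] enorm_half_diff_le[of p d] ps
      by (auto simp: passes_def)
    then show ?thesis by (simp add: power_le_one flip: enorm_power2)
  qed
  moreover have "inner_d d ?S (ker_proj A ?v) = inner_d d ?v ?S"
  proof -
    have "inner_d d ?S (ker_proj A ?v) = inner_d d (total V) (ker_proj A ?v)"
      unfolding ker_proj_def by (rule inner_d_resid_resid(1)[OF basis(1)])
    also have "\<dots> = inner_d d ?S ?v" by (simp add: inner_ker_proj)
    finally show ?thesis by (simp add: inner_d_commute[of d ?S])
  qed
  ultimately show ?case
    using IH cross unfolding ker_proj_total_add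
    by (simp add: inner_d_linear inner_d_commute[of d "ker_proj A ?v" ?S])
qed

text \<open>Split the total at \<open>i\<close>: the earlier vectors were tested all at once as a
  projected sum, the diagonal term is at least 1/8, and the later vectors make up
  \<open>corr\<close>.\<close>

lemma inner_vec_ker_proj_total:
  assumes V: "valid A V" "length V = N + 1" and i: "i \<le> N"
  shows "1 / 16 \<le> inner_d d (vec V i) (ker_proj A (total V))"
proof -
  let ?v = "vec V i" and ?W = "take i V"
  have iV: "i < length V" using V(2) i by simp
  note ps = valid_passes[OF V(1) iV]
  have WV: "valid A ?W" using V(1) iV by (auto simp: valid_def min_def)
  have "inner_d d ?v (ker_proj A (total V)) = inner_d d (ker_proj A ?v) (total V)"
    by (simp add: inner_ker_proj)
  also have "\<dots> = (\<Sum>m<N + 1. inner_d d (ker_proj A ?v) (vec V m))"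
    by (simp add: inner_total V(2))
  also have "{..<N + 1} = {..<i} \<union> {i} \<union> {i<..<N + 1}" using i by auto
  also have "(\<Sum>m\<in>\<dots>. inner_d d (ker_proj A ?v) (vec V m)) =
      (\<Sum>m<i. inner_d d (ker_proj A ?v) (vec V m)) + inner_d d (ker_proj A ?v) ?v + corr A V i"
    by (subst sum.union_disjoint; (subst sum.union_disjoint)?) (auto simp: corr_def V(2))
  also have "(\<Sum>m<i. inner_d d (ker_proj A ?v) (vec V m)) = inner_d d (ker_proj A ?v) (total ?W)"
    using iV by (simp add: inner_total vec_take)
  also have "\<dots> = inner_d d ?v (ker_proj A (total ?W))" by (simp add: inner_ker_proj)
  finally have split: "inner_d d ?v (ker_proj A (total V)) =
      inner_d d ?v (ker_proj A (total ?W)) + inner_d d (ker_proj A ?v) ?v + corr A V i" .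
  have "\<bar>inner_d d ?v (ker_proj A (total ?W))\<bar> \<le> s * enorm d (ker_proj A (total ?W))"
    using ps by (simp add: passes_def tests_def)
  also have "\<dots> \<le> s * (3 * sqrt (real N + 1))"
  proof (rule mult_left_mono[OF _ s(1)])
    have "enorm d (ker_proj A (total ?W)) \<le> sqrt (2 * real (length ?W))"
      using enorm_ker_proj_total[OF WV] iV V(2)
      by (intro real_le_rsqrt) (simp add: enorm_power2)
    also have "\<dots> \<le> sqrt (9 * (real N + 1))" using iV V(2) by (simp del: of_nat_mult)
    finally show "enorm d (ker_proj A (total ?W)) \<le> 3 * sqrt (real N + 1)"
      by (simp only: sqrt_nine_mult)
  qed
  finally have a: "- 1 / 32 \<le> inner_d d ?v (ker_proj A (total ?W))" using sN by linarith
  have "1 / 8 \<le> inner_d d (ker_proj A ?v) ?v"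
  proof -
    have "(inner_d d ?v q)\<^sup>2 \<le> s\<^sup>2" if "q \<in> set (basis A)" for q
    proof -
      have "\<bar>inner_d d ?v q\<bar> \<le> s * enorm d q" using ps that by (simp add: passes_def tests_def)
      then have "\<bar>inner_d d ?v q\<bar> \<le> s" using orthonormal_enorm[OF basis(1) that] by simp
      then show ?thesis using power_mono[of "\<bar>inner_d d ?v q\<bar>" s 2] by simp
    qed
    then have "(\<Sum>q\<leftarrow>basis A. (inner_d d ?v q)\<^sup>2) \<le> (\<Sum>q\<leftarrow>basis A. s\<^sup>2)" by (rule sum_list_mono)
    also have "\<dots> = real (length (basis A)) * s\<^sup>2" by (simp add: sum_list_triv)
    also have "\<dots> \<le> real n * s\<^sup>2" using basis(2) by (intro mult_right_mono) auto
    finally have "(\<Sum>q\<leftarrow>basis A. (inner_d d ?v q)\<^sup>2) \<le> 1 / 8" using ns by linarith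
    moreover have "1/4 \<le> inner_d d ?v ?v" using ps by (simp add: passes_def)
    moreover have "inner_d d (ker_proj A ?v) ?v = inner_d d (ker_proj A ?v) (ker_proj A ?v)"
      unfolding ker_proj_def by (rule inner_d_resid_resid(2)[OF basis(1), symmetric])
    ultimately show ?thesis
      using inner_d_resid_self[OF basis(1), of A ?v] by (simp add: ker_proj_def)
  qed
  then show ?thesis using split a corr_ge[OF V iV] by linarith
qed

lemma near_optimum:
  assumes V: "valid A V" "length V = N + 1"
  shows "\<exists>z\<in>unit_ball d. F A V (pieces {..<n} N) z \<le> - 2 * (real P + 1) * \<gamma>\<^sub>1"
proof -
  \<comment> \<open>With |S| at most 3 sqrt (N + 1) this scale gives norm at most 1/2, hence value
    at most -1/2 on the norm piece. Products of at least 1/16 put the vector pieces at most at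
    -\<beta> / (96 sqrt (N + 1)), as 96 = 6 * 16.\<close>
  define c where "c = 1 / (6 * sqrt (real N + 1))"
  have sq: "0 < sqrt (real N + 1)" by (simp del: of_nat_mult)
  have c: "0 < c" using sq by (simp add: c_def)
  define S where "S = ker_proj A (total V)"
  define z where "z = (\<lambda>i. if i < d then - c * S i else 0)"
  have inz: "inner_d d y z = - c * inner_d d y S" for y
  proof -
    have "inner_d d y z = inner_d d y (\<lambda>i. - c * S i)" by (simp add: z_def inner_d_def)
    then show ?thesis by (simp only: inner_d_scale_right)
  qed
  have "enorm d z = enorm d (\<lambda>i. - c * S i)" by (simp add: z_def enorm_def)
  then have "enorm d z = c * enorm d S" using c enorm_scale[of d "- c" S] by simp
  also have "\<dots> \<le> c * (3 * sqrt (real N + 1))"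
  proof (rule mult_left_mono)
    have "enorm d S \<le> sqrt (2 * real (length V))"
      using enorm_ker_proj_total[OF V(1)] V(2)
      by (intro real_le_rsqrt) (simp add: enorm_power2 S_def)
    also have "\<dots> \<le> sqrt (9 * (real N + 1))" using V(2) by (simp del: of_nat_mult)
    finally show "enorm d S \<le> 3 * sqrt (real N + 1)" by (simp only: sqrt_nine_mult)
  qed (use c in simp)
  also have "\<dots> = 1 / 2" using sq by (simp add: c_def)
  finally have z: "enorm d z \<le> 1 / 2" .
  have "val A V i z \<le> - 2 * (real P + 1) * \<gamma>\<^sub>1" if "i \<in> pieces {..<n} N" for i
  proof -
    from that consider "i = 0" | r where "r < n" "i = Suc r" | i' where "i' \<le> N" "i = n + 1 + i'"
      by (auto simp: pieces_def) (metis add_Suc add_le_cancel_left le_Suc_ex)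
    then show ?thesis
    proof cases
      case 1
      then have "val A V i z = enorm d z - 1" by (simp add: val_def)
      then show ?thesis using z gap(2) by linarith
    next
      case 2
      have "inner_d d (row A r) S = inner_d d (ker_proj A (row A r)) (total V)"
        by (simp add: S_def inner_ker_proj)
      also have "\<dots> = 0" using basis(3)[OF 2(1)] by (simp add: inner_d_def ker_proj_def)
      finally have "inner_d d (row A r) z = 0" by (simp add: inz)
      then have "val A V i z = - \<eta>" using 2 by (simp add: val_def)
      then show ?thesis using gap(3) by linarith
    next
      case 3
      have "c * (1 / 16) \<le> c * inner_d d (vec V i') S"
        using inner_vec_ker_proj_total[OF V 3(1)] c by (intro mult_left_mono) (auto simp: S_def)
      then have "inner_d d (vec V i') z \<le> - 1 / (96 * sqrt (real N + 1))"
        by (simp add: inz c_def)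
      then have "\<beta> * inner_d d (vec V i') z \<le> \<beta> * (- 1 / (96 * sqrt (real N + 1)))"
        using \<beta> by (intro mult_left_mono) auto
      also have "\<dots> = - (\<beta> / (96 * sqrt (real N + 1)))" by simp
      also have "\<dots> \<le> - 2 * (real P + 1) * \<gamma>\<^sub>1" using gap(1) by linarith
      finally show ?thesis using offs_nonneg[of i'] unfolding 3(2) vec_piece by linarith
    qed
  qed
  then have "F A V (pieces {..<n} N) z \<le> - 2 * (real P + 1) * \<gamma>\<^sub>1"
    unfolding F_def by (subst Max_le_iff) (auto simp: finite_pieces pieces_nonempty)
  moreover have "z \<in> unit_ball d" using z by (simp add: unit_ball_def z_def vecs_def)
  ultimately show ?thesis by blast
qed

text \<open>An output that competes with the low point has value below - (P + 1)
  \<open>\<gamma>\<^sub>1\<close>, while every query made before exploration is complete gets an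
  answer at least that high.\<close>

lemma all_explored:
  assumes A: "A \<in> mats" and V: "valid A V" "length V = N + 1"
    and mini: "minimizes d M alg \<epsilon>" and \<epsilon>: "\<epsilon> < (real P + 1) * \<gamma>\<^sub>1"
    and T: "num_queries alg M (resp A V (pieces {..<n} N)) \<le> T"
  shows "length (expl A V (num_queries alg M (resp A V (pieces {..<n} N)))) = N"
proof -
  define orc where "orc = resp A V (pieces {..<n} N)"
  define \<tau> where "\<tau> = (LEAST t. stops_at alg M orc t)"
  have \<tau>: "num_queries alg M orc = Suc \<tau>" by (simp add: num_queries_def \<tau>_def)
  have \<tau>T: "\<tau> < T" using T \<tau> by (simp add: orc_def)
  let ?x = "qu A V \<tau>" and ?F = "F A V (pieces {..<n} N)"
  have "alg_output alg M orc = query alg (memseq alg M orc \<tau>)"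
    by (simp add: alg_output_def \<tau>_def)
  then have "alg_output alg M orc = ?x"
    using memseq_eq_state[OF V, of \<tau>] \<tau>T by (simp add: orc_def qu_def)
  moreover have "first_order_oracle d ?F orc" "convex_d d ?F" "lipschitz1_d d ?F"
    unfolding orc_def by (intro hard_function[OF A V(1)] finite_pieces pieces_nonempty; simp)+
  ultimately have best: "?F ?x \<le> ?F y + \<epsilon>" if "y \<in> unit_ball d" for y
    using mini that unfolding minimizes_def by metis
  obtain z where "z \<in> unit_ball d" "?F z \<le> - 2 * (real P + 1) * \<gamma>\<^sub>1"
    using near_optimum[OF V] by blast
  with best[of z] \<epsilon> have "?F ?x < - (real P + 1) * \<gamma>\<^sub>1" by (simp add: algebra_simps)
  moreover have "F A V (pieces {..<n} (length (expl A V (Suc \<tau>)))) ?x = ?F ?x"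
    using resp_final[OF V \<tau>T] by (simp add: resp_def)
  ultimately have "\<not> length (expl A V \<tau>) < N"
    using later_pieces_inactive(2)[OF V \<tau>T] by linarith
  then have "N \<le> length (expl A V (Suc \<tau>))"
    using length_expl_mono[of \<tau> "Suc \<tau>" A V] by simp
  then show ?thesis
    using length_expl_le[of A V "Suc \<tau>"] \<tau> by (simp add: orc_def)
qed

end

section \<open>Counting\<close>

text \<open>\<open>tests\<close>, \<open>cells\<close> and \<open>far\<close> feed the count of sign
  pairs. \<open>H\<close> and \<open>LH\<close> feed the volume bound: the grid is so fine that
  enlarging its side by \<open>2 * H\<close> multiplies the volume by at most e. By
  \<open>m\<close>, a period of \<open>m\<close> queries cannot reveal more than all
  \<open>n\<close> rows even at two per query.\<close>

locale adversary_count = adversary_opt +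
  fixes c m H :: nat
  assumes tests: "real (T + n + N + 2) * (4 * exp (- (real d * s\<^sup>2) / 2)) \<le> 1"
    and cells: "2 / w + 1 \<le> real c"
    and far: "8 * real c ^ (2 * k) * exp (- real d / 8) \<le> 1"
    and T_eq: "T = P * m"
    and P: "0 < P"
    and m: "2 * m \<le> n"
    and H: "((2 * (\<eta> * real L * sqrt d) + sqrt d + 1) / \<rho>) * real k + 1 \<le> real H"
    and LH: "real d * (2 * real H) \<le> real L"
    and \<eta>: "0 \<le> \<eta>"
begin

section \<open>Counting admissible vector sequences\<close>

lemma pot_snoc:
  "pot A (V @ [p]) = (\<Sum>j<length V. exp (- \<Lambda> * (corr A V j + inner_d d (ker_proj A (vec V j)) (half_diff d p)))) + 1"
proof -
  have "corr A (V @ [p]) j = corr A V j + inner_d d (ker_proj A (vec V j)) (half_diff d p)"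
    if j: "j < length V" for j
  proof -
    have "{j<..<length (V @ [p])} = insert (length V) {j<..<length V}" using j by auto
    moreover have "vec (V @ [p]) m = vec V m" if "m < length V" for m
      using that by (simp add: vec_def nth_append)
    ultimately show ?thesis
      using j unfolding corr_def by (simp add: vec_def nth_append)
  qed
  moreover have "corr A (V @ [p]) (length V) = 0"
    unfolding corr_def by (rule sum.neutral) auto
  ultimately show ?thesis by (simp add: pot_def)
qed

text \<open>Swapping the pair negates the new vector, so in the sum of both potentials every old
  term is multiplied by twice a cosh.\<close>

lemma pot_swap:
  assumes "\<And>j. j < length V \<Longrightarrow> \<bar>inner_d d (ker_proj A (vec V j)) (half_diff d p)\<bar> \<le> s"
  shows "pot A (V @ [p]) + pot A (V @ [prod.swap p]) \<le> 2 * (exp (\<Lambda>\<^sup>2 * s\<^sup>2 / 2) * pot A V + 1)"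
proof -
  let ?y = "\<lambda>j. inner_d d (ker_proj A (vec V j)) (half_diff d p)"
  have sw: "inner_d d z (half_diff d (prod.swap p)) = - inner_d d z (half_diff d p)" for z
    unfolding half_diff_swap using inner_d_scale_right[of d z "- 1" "half_diff d p"] by simp
  have "exp (- \<Lambda> * (corr A V j + ?y j)) + exp (- \<Lambda> * (corr A V j - ?y j)) \<le>
      2 * exp (\<Lambda>\<^sup>2 * s\<^sup>2 / 2) * exp (- \<Lambda> * corr A V j)" if "j < length V" for j
  proof -
    have "(\<Lambda> * ?y j)\<^sup>2 \<le> \<Lambda>\<^sup>2 * s\<^sup>2"
      using power_mono[OF assms[OF that], of 2] by (simp add: power_mult_distrib mult_left_mono)
    then have "exp (\<Lambda> * ?y j) + exp (- (\<Lambda> * ?y j)) \<le> 2 * exp (\<Lambda>\<^sup>2 * s\<^sup>2 / 2)"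
      using exp_plus_exp_minus_le[of "\<Lambda> * ?y j"] by (smt (verit) divide_right_mono exp_le_cancel_iff)
    then have "exp (- \<Lambda> * corr A V j) * (exp (\<Lambda> * ?y j) + exp (- (\<Lambda> * ?y j))) \<le>
        exp (- \<Lambda> * corr A V j) * (2 * exp (\<Lambda>\<^sup>2 * s\<^sup>2 / 2))"
      by (rule mult_left_mono) simp
    moreover have "exp (- \<Lambda> * (corr A V j + ?y j)) = exp (- \<Lambda> * corr A V j) * exp (- (\<Lambda> * ?y j))"
      "exp (- \<Lambda> * (corr A V j - ?y j)) = exp (- \<Lambda> * corr A V j) * exp (\<Lambda> * ?y j)"
      unfolding exp_add[symmetric] by (simp_all add: algebra_simps)
    ultimately show ?thesis by (simp add: algebra_simps)
  qed
  then have "(\<Sum>j<length V. exp (- \<Lambda> * (corr A V j + ?y j)) + exp (- \<Lambda> * (corr A V j - ?y j))) \<le>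
      (\<Sum>j<length V. 2 * exp (\<Lambda>\<^sup>2 * s\<^sup>2 / 2) * exp (- \<Lambda> * corr A V j))"
    by (intro sum_mono) simp
  also have "\<dots> = 2 * (exp (\<Lambda>\<^sup>2 * s\<^sup>2 / 2) * pot A V)"
    by (simp add: pot_def sum_distrib_left mult.assoc)
  finally have *: "(\<Sum>j<length V. exp (- \<Lambda> * (corr A V j + ?y j))) +
      (\<Sum>j<length V. exp (- \<Lambda> * (corr A V j + - ?y j))) \<le> 2 * (exp (\<Lambda>\<^sup>2 * s\<^sup>2 / 2) * pot A V)"
    by (simp only: sum.distrib diff_conv_add_uminus)
  have "a + b \<le> 2 * z \<Longrightarrow> (a + 1) + (b + 1) \<le> 2 * (z + 1)" for a b z :: real by simp
  from this[OF *] show ?thesis unfolding pot_snoc sw .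
qed

lemma finite_pairs: "finite (signs d \<times> signs d)" by simp

text \<open>All tests are invariant under swapping a pair, and in at least one of the two orders the
  potential is at most the average. So at least half of the passing pairs are good, which turns 8
  into 16.\<close>

lemma card_good:
  assumes "length V \<le> N" "valid A V"
  shows "4 ^ d \<le> 16 * real c ^ (2 * k) * real (card {p. good A V p})"
proof -
  let ?R = "{p. passes A V p}" and ?G = "{p. good A V p}"
  let ?us = "gram_schmidt d (blk (length V) (expl A V T))"
  have fin: "finite ?R" "finite ?G"
    by (rule finite_subset[OF _ finite_pairs], force simp: passes_def good_def)+
  have Y: "finite (tests A V)" by (simp add: tests_def)
  have "card (tests A V) \<le> card (qu A V ` {..<T}) + card (set (basis A)) +
      card ((\<lambda>p. ker_proj A (half_diff d p)) ` set V) + card {ker_proj A (total V)}"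
    unfolding tests_def by (intro order_trans[OF card_Un_le] add_mono) auto
  also have "\<dots> \<le> T + n + N + 1"
  proof (intro add_mono)
    show "card (qu A V ` {..<T}) \<le> T" using card_image_le[of "{..<T}" "qu A V"] by simp
    show "card (set (basis A)) \<le> n" using card_length[of "basis A"] basis(2)[of A] by linarith
    show "card ((\<lambda>p. ker_proj A (half_diff d p)) ` set V) \<le> N"
      using card_image_le[of "set V" "\<lambda>p. ker_proj A (half_diff d p)"] card_length[of V] assms(1) by simp
  qed simp
  finally have "real (card (tests A V)) * (4 * exp (- (real d * s\<^sup>2) / 2)) \<le>
      real (T + n + N + 2) * (4 * exp (- (real d * s\<^sup>2) / 2))"
    by (intro mult_right_mono of_nat_mono) auto
  then have Y': "real (card (tests A V)) * (4 * exp (- (real d * s\<^sup>2) / 2)) \<le> 1"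
    using tests by linarith
  have lus: "length ?us \<le> k"
  proof -
    have "length ?us \<le> length V - k * ((length V - 1) div k)" by (simp add: blk_def)
    also have "\<dots> \<le> Suc ((length V - 1) - k * ((length V - 1) div k))" by simp
    also have "(length V - 1) - k * ((length V - 1) div k) = (length V - 1) mod k"
      by (simp add: minus_mult_div_eq_mod)
    also have "Suc \<dots> \<le> k" using k by (simp add: Suc_le_eq)
    finally show ?thesis .
  qed
  have "4 ^ d \<le> 8 * real c ^ (2 * k) * real (card ?R)"
    using card_good_pairs[OF d Y Y' s(1) enorm_gram_schmidt lus w cells far]
    by (simp add: passes_def)
  moreover have "?R \<subseteq> ?G \<union> prod.swap ` ?G"
  proof
    fix p assume "p \<in> ?R"
    then have ps: "passes A V p" by simp
    have neg: "inner_d d (half_diff d (prod.swap p)) z = - inner_d d (half_diff d p) z" for z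
      unfolding half_diff_swap using inner_d_scale_left[of d "- 1" "half_diff d p" z] by simp
    have negr: "inner_d d z (half_diff d (prod.swap p)) = - inner_d d z (half_diff d p)" for z
      unfolding half_diff_swap using inner_d_scale_right[of d z "- 1" "half_diff d p"] by simp
    have ps': "passes A V (prod.swap p)"
      using ps unfolding passes_def neg negr by (auto simp: prod.swap_def)
    have "\<bar>inner_d d (ker_proj A (vec V j)) (half_diff d p)\<bar> \<le> s" if "j < length V" for j
    proof -
      have "half_diff d (V ! j) = vec V j" "V ! j \<in> set V" using that by (auto simp: vec_def)
      then have "\<bar>inner_d d (half_diff d p) (ker_proj A (vec V j))\<bar> \<le> s * enorm d (ker_proj A (vec V j))"
        using ps by (auto simp: passes_def tests_def simp flip: \<open>half_diff d (V ! j) = vec V j\<close>)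
      also have "\<dots> \<le> s * 1"
        using enorm_resid_le[OF basis(1), of A "vec V j"] enorm_vec_le[OF assms(2), of j] s
        by (intro mult_left_mono) (auto simp: ker_proj_def)
      finally show ?thesis by (simp add: inner_d_commute)
    qed
    then have "pot A (V @ [p]) + pot A (V @ [prod.swap p]) \<le> 2 * (exp (\<Lambda>\<^sup>2 * s\<^sup>2 / 2) * pot A V + 1)"
      by (rule pot_swap)
    moreover have "a + b \<le> 2 * z \<Longrightarrow> a \<le> z \<or> b \<le> z" for a b z :: real by linarith
    ultimately have "good A V p \<or> good A V (prod.swap p)"
      using ps ps' unfolding good_def by blast
    then show "p \<in> ?G \<union> prod.swap ` ?G"
      by (metis UnI1 UnI2 image_eqI mem_Collect_eq swap_swap)
  qed
  then have "card ?R \<le> card ?G + card (prod.swap ` ?G)"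
    using fin by (intro order_trans[OF card_mono card_Un_le]) auto
  then have "card ?R \<le> 2 * card ?G" using card_image_le[OF fin(2), of prod.swap] by linarith
  then have "8 * real c ^ (2 * k) * real (card ?R) \<le> 8 * real c ^ (2 * k) * (2 * real (card ?G))"
    by (intro mult_left_mono) auto
  ultimately show ?thesis by simp
qed


definition pairs :: "nat \<Rightarrow> ((nat \<Rightarrow> real) \<times> (nat \<Rightarrow> real)) list set" where
  "pairs r = {V. set V \<subseteq> signs d \<times> signs d \<and> length V = r}"

lemma finite_pairs_list: "finite (pairs r)" and card_pairs: "card (pairs r) = (4 ^ d) ^ r"
proof -
  show "finite (pairs r)" unfolding pairs_def by (rule finite_lists_length_eq) simp
  have "card (signs d \<times> signs d) = 4 ^ d"
    by (simp add: card_cartesian_product card_signs flip: power_mult_distrib)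
  then show "card (pairs r) = (4 ^ d) ^ r"
    unfolding pairs_def by (subst card_lists_length_eq) auto
qed

lemma card_valid:
  "r \<le> N + 1 \<Longrightarrow>
    (4 ^ d) ^ r \<le> (16 * real c ^ (2 * k)) ^ r * real (card {V \<in> pairs r. valid A V})"
proof (induction r)
  case 0
  have "{V \<in> pairs 0. valid A V} = {[]}" by (auto simp: pairs_def)
  then show ?case by simp
next
  case (Suc r)
  let ?S = "{V \<in> pairs r. valid A V}" and ?Q = "16 * real c ^ (2 * k)"
  have fin: "finite ?S" using finite_pairs_list by simp
  have finG: "finite {p. good A V p}" for V
    by (rule finite_subset[OF _ finite_pairs]) (force simp: passes_def good_def)
  have "(\<lambda>(V, p). V @ [p]) ` (SIGMA V:?S. {p. good A V p}) \<subseteq> {V \<in> pairs (Suc r). valid A V}"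
    by (auto simp: valid_snoc pairs_def good_def passes_def)
  moreover have "inj_on (\<lambda>(V, p). V @ [p]) (SIGMA V:?S. {p. good A V p})"
    by (auto simp: inj_on_def)
  ultimately have "card (SIGMA V:?S. {p. good A V p}) \<le> card {V \<in> pairs (Suc r). valid A V}"
    using finite_pairs_list by (intro card_inj_on_le[of "\<lambda>(V, p). V @ [p]"]) auto
  then have le: "(\<Sum>V\<in>?S. card {p. good A V p}) \<le> card {V \<in> pairs (Suc r). valid A V}"
    using fin finG by (simp add: card_SigmaI)
  have "(4 ^ d) ^ Suc r \<le> 4 ^ d * (?Q ^ r * real (card ?S))"
    using Suc by (simp add: mult_left_mono)
  also have "\<dots> = ?Q ^ r * (\<Sum>V\<in>?S. 4 ^ d)" by simp
  also have "\<dots> \<le> ?Q ^ r * (\<Sum>V\<in>?S. ?Q * real (card {p. good A V p}))"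
    using Suc.prems by (intro mult_left_mono sum_mono card_good) (auto simp: pairs_def)
  also have "\<dots> = ?Q ^ Suc r * real (\<Sum>V\<in>?S. card {p. good A V p})"
    by (simp add: sum_distrib_left mult.assoc mult.left_commute)
  also have "\<dots> \<le> ?Q ^ Suc r * real (card {V \<in> pairs (Suc r). valid A V})"
    using le by (intro mult_left_mono of_nat_mono) auto
  finally show ?case .
qed

section \<open>Counting row matrices by recomputing a fast period\<close>

definition near_orth :: "(nat \<Rightarrow> real) list \<Rightarrow> (nat \<Rightarrow> nat) set" where
  "near_orth R = (if robust d \<rho> R \<and> length R = k
     then {a \<in> PiE {..<d} (\<lambda>_. {..<L}). \<forall>x\<in>set R. \<bar>inner_d d (\<lambda>j. real (a j)) x\<bar> \<le> \<eta> * real L * sqrt d}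
     else {})"

lemma finite_near_orth: "finite (near_orth R)"
  by (auto simp: near_orth_def intro!: finite_PiE)

text \<open>The bound has to cover whatever list an arbitrary code produces; lists that are not
  robust blocks of full length get the empty set by definition. For the others it is the volume
  bound with (1 + 2 H / L)^d \<le> e \<le> 3.\<close>

lemma card_near_orth: "real (card (near_orth R)) \<le> 3 * real L ^ d / 2 ^ k"
proof (cases "robust d \<rho> R \<and> length R = k")
  case True
  \<comment> \<open>The summand 1 makes the inequality required of the translation length
    strict.\<close>
  define s' where "s' = (2 * (\<eta> * real L * sqrt d) + sqrt d + 1) / \<rho>"
  have s': "0 \<le> s'" using \<eta> \<rho> by (simp add: s'_def)
  have sr: "2 * (\<eta> * real L * sqrt d) + sqrt d < s' * \<rho>" using \<rho> by (simp add: s'_def)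
  have "card (near_orth R) * 2 ^ k \<le> (L + 2 * H) ^ d"
    using card_nearly_orthogonal[OF \<rho> conjunct1[OF True] s' sr, of H L] H True
    by (simp add: near_orth_def s'_def)
  then have "real (card (near_orth R)) * 2 ^ k \<le> (real L + 2 * real H) ^ d"
    by (metis (mono_tags) of_nat_add of_nat_le_iff of_nat_mult of_nat_numeral of_nat_power)
  also have "\<dots> = real L ^ d * (1 + 2 * real H / real L) ^ d"
    using L by (simp add: field_simps flip: power_mult_distrib)
  also have "\<dots> \<le> real L ^ d * 3"
  proof (rule mult_left_mono)
    have "(1 + 2 * real H / real L) ^ d \<le> exp (2 * real H / real L) ^ d"
      by (intro power_mono) (auto intro: exp_ge_add_one_self)
    also have "\<dots> = exp (real d * (2 * real H / real L))" by (rule exp_of_nat_mult[symmetric])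
    also have "\<dots> \<le> exp 1" using LH L by (simp add: field_simps)
    also have "\<dots> \<le> 3" by (rule exp_le)
    finally show "(1 + 2 * real H / real L) ^ d \<le> 3" .
  qed simp
  finally show ?thesis by (simp add: field_simps)
next
  case False
  then show ?thesis unfolding near_orth_def by auto
qed

text \<open>A period that uses few queries is determined by its number \<open>p\<close>, the memory content \<open>\<mu>\<close> at its
  start and the set \<open>I\<close> of rows seen during it, together with those rows themselves: no other row
  is needed to recompute the queries explored in it.\<close>

definition simulate where
  "simulate A V p \<mu> I = take k (drop (k * p) (snd ((step A V I ^^ m) (\<mu>, replicate (k * p) (\<lambda>_. 0)))))"

lemma simulate_restrict:
  assumes "I \<subseteq> {..<n}"
  shows "simulate (restrict A I) V p \<mu> I = simulate A V p \<mu> I"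
proof -
  have "F (restrict A I) V (pieces I j) x = F A V (pieces I j) x"
    "resp (restrict A I) V (pieces I j) x = resp A V (pieces I j) x" for j x
    by (rule resp_cong[OF assms]; simp)+
  then have "step (restrict A I) V I = step A V I"
    by (intro ext) (simp add: step_def extend_def explores_def)
  then show ?thesis by (simp add: simulate_def)
qed

definition coded where
  "coded V p \<mu> I = {A \<in> mats. \<forall>i\<in>{..<n} - I. A i \<in> near_orth (simulate A V p \<mu> I)}"

text \<open>The rows in \<open>I\<close> are free and already determine the simulation, hence the
  set to which each of the other rows is confined. Splitting a matrix into these two parts is
  injective.\<close>

lemma card_coded:
  assumes I: "I \<subseteq> {..<n}" "card I \<le> 2 * m"
  shows "real (card (coded V p \<mu> I)) \<le> real L ^ (d * n) * 3 ^ n / 2 ^ (k * (n - 2 * m))"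
proof -
  let ?row = "PiE {..<d} (\<lambda>_. {..<L})"
  let ?X = "SIGMA B:PiE I (\<lambda>_. ?row). PiE ({..<n} - I) (\<lambda>_. near_orth (simulate B V p \<mu> I))"
  have finI: "finite I" using I finite_subset by blast
  have finrow: "finite ?row" "card ?row = L ^ d" by (auto simp: card_PiE intro!: finite_PiE)
  have fX: "finite (PiE I (\<lambda>_. ?row))" using finI finrow by (intro finite_PiE) auto
  have fY: "finite (PiE ({..<n} - I) (\<lambda>_. near_orth R))" for R
    by (intro finite_PiE finite_near_orth) auto
  have "inj_on (\<lambda>A. (restrict A I, restrict A ({..<n} - I))) (coded V p \<mu> I)"
  proof (rule inj_onI)
    fix A B assume AB: "A \<in> coded V p \<mu> I" "B \<in> coded V p \<mu> I"
      and eq: "(restrict A I, restrict A ({..<n} - I)) = (restrict B I, restrict B ({..<n} - I))"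
    have "A i = B i" if "i < n" for i
    proof (cases "i \<in> I")
      case True
      then show ?thesis using eq by (metis prod.inject restrict_apply')
    next
      case False
      have "restrict A ({..<n} - I) i = restrict B ({..<n} - I) i" using eq by simp
      then show ?thesis using False that by simp
    qed
    then show "A = B"
      using AB by (intro PiE_ext[of A "{..<n}" _ B]) (auto simp: coded_def mats_def)
  qed
  moreover have "(\<lambda>A. (restrict A I, restrict A ({..<n} - I))) ` coded V p \<mu> I \<subseteq> ?X"
  proof (rule image_subsetI)
    fix A assume A: "A \<in> coded V p \<mu> I"
    then have "A i \<in> ?row" if "i < n" for i
      using that by (auto simp: coded_def mats_def dest: PiE_mem)
    then have "restrict A I \<in> PiE I (\<lambda>_. ?row)" using I(1) by (simp add: restrict_PiE_iff subset_iff)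
    moreover have "restrict A ({..<n} - I) \<in> PiE ({..<n} - I) (\<lambda>_. near_orth (simulate (restrict A I) V p \<mu> I))"
      using A by (simp add: restrict_PiE_iff simulate_restrict[OF I(1)] coded_def)
    ultimately show "(restrict A I, restrict A ({..<n} - I)) \<in> ?X" by blast
  qed
  ultimately have "card (coded V p \<mu> I) \<le> card ?X"
    using fX fY by (intro card_inj_on_le[of "\<lambda>A. (restrict A I, restrict A ({..<n} - I))"] finite_SigmaI) auto
  also have "card ?X = (\<Sum>B\<in>PiE I (\<lambda>_. ?row). card (near_orth (simulate B V p \<mu> I)) ^ (n - card I))"
    using fX fY I(1) by (simp add: card_SigmaI card_PiE card_Diff_subset finI)
  finally have "real (card (coded V p \<mu> I)) \<le>
      (\<Sum>B\<in>PiE I (\<lambda>_. ?row). real (card (near_orth (simulate B V p \<mu> I))) ^ (n - card I))"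
    unfolding of_nat_power[symmetric] of_nat_sum[symmetric] by (rule of_nat_mono)
  also have "\<dots> \<le> (\<Sum>B\<in>PiE I (\<lambda>_. ?row). (3 * real L ^ d / 2 ^ k) ^ (n - card I))"
    by (intro sum_mono power_mono card_near_orth) auto
  also have "\<dots> = (real L ^ d) ^ card I * (3 * real L ^ d / 2 ^ k) ^ (n - card I)"
    using finI by (simp add: card_PiE)
  also have "\<dots> = (real L ^ d) ^ (card I + (n - card I)) * 3 ^ (n - card I) / 2 ^ (k * (n - card I))"
    by (simp add: power_add power_divide power_mult_distrib power_mult)
  also have "card I + (n - card I) = n" using I(2) m by simp
  also have "(real L ^ d) ^ n * 3 ^ (n - card I) / 2 ^ (k * (n - card I)) \<le>
      (real L ^ d) ^ n * 3 ^ n / 2 ^ (k * (n - 2 * m))"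
    using I(2) by (intro frac_le mult_left_mono power_increasing mult_nonneg_nonneg) auto
  finally show ?thesis by (simp add: power_mult)
qed

lemma inner_row_expl_le:
  "x \<in> set (expl A V t) \<Longrightarrow> i < n \<Longrightarrow> \<bar>inner_d d (row A i) x\<bar> \<le> \<eta>"
proof (induction t)
  case (Suc t)
  then show ?case
    using explores_imp(2)[of A V "{..<n}" "expl A V t" "qu A V t" i]
    by (auto simp: expl_Suc extend_def split: if_splits)
qed simp

lemma sel_in_pieces:
  assumes "\<And>i. sel A V (pieces {..<n} j) x = Suc i \<Longrightarrow> i < n \<Longrightarrow> i \<in> I" "I \<subseteq> {..<n}"
  shows "resp A V (pieces I j) x = resp A V (pieces {..<n} j) x"
proof (rule resp_restrict)
  show "finite (pieces {..<n} j)" by (simp add: finite_pieces)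
  show "pieces I j \<subseteq> pieces {..<n} j" using assms(2) by (auto simp: pieces_def)
  have "sel A V (pieces {..<n} j) x \<in> pieces {..<n} j"
    by (intro sel_in(1) finite_pieces pieces_nonempty) simp
  with assms(1) show "sel A V (pieces {..<n} j) x \<in> pieces I j"
    by (auto simp: pieces_def)
qed

text \<open>A step consults two maxima, one to decide on exploration and one to answer. If
  \<open>I\<close> contains the active rows of both, leaving out the other rows changes
  neither.\<close>

lemma simulate_period:
  assumes t: "length (expl A V t\<^sub>0) = k * p" "length (expl A V (t\<^sub>0 + r)) = k * Suc p"
    and len: "\<And>q. q < r \<Longrightarrow> length (expl A V (t\<^sub>0 + q)) < k * Suc p" and r: "r \<le> m"
    and I: "I \<subseteq> {..<n}"
    and seen: "\<And>q i. q < r \<Longrightarrow> i < n \<Longrightarrow>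
        sel A V (pieces {..<n} (length (expl A V (t\<^sub>0 + q)))) (qu A V (t\<^sub>0 + q)) = Suc i \<Longrightarrow> i \<in> I"
      "\<And>q i. q < r \<Longrightarrow> i < n \<Longrightarrow>
        sel A V (pieces {..<n} (length (expl A V (Suc (t\<^sub>0 + q))))) (qu A V (t\<^sub>0 + q)) = Suc i \<Longrightarrow> i \<in> I"
  shows "simulate A V p (fst (state A V t\<^sub>0)) I = drop (k * p) (expl A V (t\<^sub>0 + r))"
proof -
  \<comment> \<open>Earlier periods enter a step only through the number of queries explored in
    them, so zero vectors can stand in for those queries.\<close>
  define Z :: "(nat \<Rightarrow> real) list" where "Z = replicate (k * p) (\<lambda>_. 0)"
  have lZ: "length Z = k * p" by (simp add: Z_def)
  let ?st = "(fst (state A V t\<^sub>0), Z)"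
  have sim: "q \<le> r \<Longrightarrow> (step A V I ^^ q) ?st =
      (fst (state A V (t\<^sub>0 + q)), Z @ drop (k * p) (expl A V (t\<^sub>0 + q)))" for q
  proof (induction q)
    case 0
    then show ?case using t(1) by simp
  next
    case (Suc q)
    then have q: "q < r" by simp
    let ?E = "expl A V (t\<^sub>0 + q)" and ?x = "qu A V (t\<^sub>0 + q)"
    let ?E\<^sub>2 = "Z @ drop (k * p) ?E"
    have ge: "k * p \<le> length ?E" using length_expl_mono[of t\<^sub>0 "t\<^sub>0 + q" A V] t(1) by simp
    have dv: "length ?E div k = p"
      using ge len[OF q] by (intro div_nat_eqI) (auto simp: algebra_simps)
    have l2: "length ?E\<^sub>2 = length ?E" using ge lZ by simp
    have cur2: "cur ?E\<^sub>2 = cur ?E" unfolding cur_def l2 dv using lZ by simp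
    have r1: "resp A V (pieces I (length ?E)) ?x = resp A V (pieces {..<n} (length ?E)) ?x"
      using seen(1)[OF q] I by (intro sel_in_pieces) auto
    then have F1: "F A V (pieces I (length ?E)) ?x = F A V (pieces {..<n} (length ?E)) ?x"
      by (simp add: resp_def)
    have ex: "explores A V I ?E\<^sub>2 ?x \<longleftrightarrow> explores A V {..<n} ?E ?x"
      unfolding explores_def l2 cur2 F1 ..
    have E': "extend A V I ?E\<^sub>2 ?x = Z @ drop (k * p) (expl A V (Suc (t\<^sub>0 + q)))"
      using ge unfolding expl_Suc extend_def ex by simp
    have "k * p \<le> length (expl A V (Suc (t\<^sub>0 + q)))"
      using ge length_expl_mono[of "t\<^sub>0 + q" "Suc (t\<^sub>0 + q)" A V] by simp
    then have l2': "length (extend A V I ?E\<^sub>2 ?x) = length (expl A V (Suc (t\<^sub>0 + q)))"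
      unfolding E' using lZ by simp
    have r2: "resp A V (pieces I (length (expl A V (Suc (t\<^sub>0 + q))))) ?x =
        resp A V (pieces {..<n} (length (expl A V (Suc (t\<^sub>0 + q))))) ?x"
      using seen(2)[OF q] I by (intro sel_in_pieces) auto
    have "(step A V I ^^ Suc q) ?st = step A V I (fst (state A V (t\<^sub>0 + q)), ?E\<^sub>2)"
      using Suc by simp
    also have "\<dots> = (update alg (fst (state A V (t\<^sub>0 + q))) ?x
        (resp A V (pieces I (length (extend A V I ?E\<^sub>2 ?x))) ?x), extend A V I ?E\<^sub>2 ?x)"
      by (simp add: step_def Let_def qu_def)
    also have "\<dots> = (update alg (fst (state A V (t\<^sub>0 + q))) ?x
        (resp A V (pieces {..<n} (length (expl A V (Suc (t\<^sub>0 + q))))) ?x),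
        Z @ drop (k * p) (expl A V (Suc (t\<^sub>0 + q))))"
      unfolding l2' r2 unfolding E' ..
    also have "update alg (fst (state A V (t\<^sub>0 + q))) ?x
        (resp A V (pieces {..<n} (length (expl A V (Suc (t\<^sub>0 + q))))) ?x) = fst (state A V (Suc (t\<^sub>0 + q)))"
      by (simp add: state_Suc step_def Let_def qu_def expl_Suc expl_def)
    finally show ?case by simp
  qed
  \<comment> \<open>The simulation always runs \<open>m\<close> steps; those after the end of the
    period can only append, and \<open>take k\<close> cuts off what they add.\<close>
  have "(step A V I ^^ m) ?st = (step A V I ^^ (m - r)) ((step A V I ^^ r) ?st)"
    using r by (simp flip: funpow_add comp_apply[of "_ ^^ _" "_ ^^ _"])
  then obtain R where "snd ((step A V I ^^ m) ?st) = snd ((step A V I ^^ r) ?st) @ R"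
    using iterate_prefix[of "m - r" A V I "(step A V I ^^ r) ?st"] by auto
  then show ?thesis
    unfolding simulate_def Z_def[symmetric] using sim[of r] lZ t(2) by simp
qed

lemma exists_code:
  assumes A: "A \<in> mats" and t: "t \<le> P * m" "length (expl A V t) = N"
  shows "\<exists>p<P. \<exists>\<mu> I. length \<mu> = M \<and> I \<subseteq> {..<n} \<and> card I \<le> 2 * m \<and> A \<in> coded V p \<mu> I"
proof -
  define len where "len t = length (expl A V t)" for t
  have len_Suc: "len (Suc t) \<le> Suc (len t)" for t
    unfolding len_def expl_Suc extend_def by simp
  have len_mono: "len t \<le> len t'" if "t \<le> t'" for t t'
    unfolding len_def using that by (rule length_expl_mono)
  define tm where "tm p = (LEAST t. k * p \<le> len t)" for p
  have ex: "k * p \<le> len t" if "p \<le> P" for p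
    using t(2) that by (simp add: len_def mult.commute)
  have tm_ge: "k * p \<le> len (tm p)" if "p \<le> P" for p
    unfolding tm_def by (rule LeastI[of "\<lambda>t. k * p \<le> len t", OF ex[OF that]])
  have tm_less: "len t' < k * p" if "t' < tm p" for t' p
    using not_less_Least[OF that[unfolded tm_def]] by simp
  \<comment> \<open>The number of explored queries grows by at most one per step, so no multiple of
    \<open>k\<close> is jumped over.\<close>
  have tm_len: "len (tm p) = k * p" if "p \<le> P" for p
  proof (cases "tm p")
    case 0
    then show ?thesis using tm_ge[OF that] by (simp add: len_def)
  next
    case (Suc t')
    then show ?thesis using tm_ge[OF that] tm_less[of t' p] len_Suc[of t'] by simp
  qed
  \<comment> \<open>Otherwise every period would take at least \<open>m + 1\<close> queries, more
    than \<open>P * m\<close> in total.\<close>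
  have "\<exists>p<P. tm (Suc p) \<le> tm p + m"
  proof (rule ccontr)
    assume "\<not> ?thesis"
    then have long: "tm p + m < tm (Suc p)" if "p < P" for p using that by auto
    have "p \<le> P \<Longrightarrow> p * Suc m \<le> tm p" for p
    proof (induction p)
      case (Suc p)
      then show ?case using long[of p] by simp
    qed simp
    then have "P * Suc m \<le> tm P" by simp
    moreover have "tm P \<le> t" unfolding tm_def by (rule Least_le) (rule ex, simp)
    ultimately show False using t(1) P by simp
  qed
  then obtain p where p: "p < P" "tm (Suc p) \<le> tm p + m" by blast
  define t\<^sub>0 where "t\<^sub>0 = tm p"
  have "tm p \<le> tm (Suc p)"
  proof (rule ccontr)
    assume "\<not> ?thesis"
    then have "len (tm (Suc p)) < k * p" by (intro tm_less) simp
    then show False using tm_len[of "Suc p"] p by simp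
  qed
  then obtain r where r: "tm (Suc p) = t\<^sub>0 + r" by (metis le_Suc_ex t\<^sub>0_def)
  have rm: "r \<le> m" using p(2) r by (simp add: t\<^sub>0_def)
  let ?s1 = "\<lambda>q. sel A V (pieces {..<n} (length (expl A V (t\<^sub>0 + q)))) (qu A V (t\<^sub>0 + q))"
  let ?s2 = "\<lambda>q. sel A V (pieces {..<n} (length (expl A V (Suc (t\<^sub>0 + q))))) (qu A V (t\<^sub>0 + q))"
  define I where "I = {i. i < n \<and> (\<exists>q<r. ?s1 q = Suc i \<or> ?s2 q = Suc i)}"
  have I: "I \<subseteq> {..<n}" by (auto simp: I_def)
  have "I \<subseteq> (\<lambda>q. ?s1 q - 1) ` {..<r} \<union> (\<lambda>q. ?s2 q - 1) ` {..<r}"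
    unfolding I_def by force
  then have "card I \<le> card ((\<lambda>q. ?s1 q - 1) ` {..<r}) + card ((\<lambda>q. ?s2 q - 1) ` {..<r})"
    by (intro order_trans[OF card_mono card_Un_le]) auto
  also have "\<dots> \<le> r + r"
    using card_image_le[of "{..<r}" "\<lambda>q. ?s1 q - 1"] card_image_le[of "{..<r}" "\<lambda>q. ?s2 q - 1"]
    by (intro add_mono) simp_all
  finally have cI: "card I \<le> 2 * m" using rm by simp
  let ?R = "drop (k * p) (expl A V (t\<^sub>0 + r))"
  have lr: "length (expl A V (t\<^sub>0 + r)) = k * Suc p"
    using tm_len[of "Suc p"] p r by (simp add: len_def)
  have sim: "simulate A V p (fst (state A V t\<^sub>0)) I = ?R"
  proof (rule simulate_period)
    show "length (expl A V t\<^sub>0) = k * p" using tm_len[of p] p by (simp add: len_def t\<^sub>0_def)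
    show "length (expl A V (t\<^sub>0 + q)) < k * Suc p" if "q < r" for q
      using tm_less[of "t\<^sub>0 + q" "Suc p"] that r by (simp add: len_def)
  qed (use lr rm I in \<open>auto simp: I_def\<close>)
  have "?R = take k ?R" using lr by simp
  then have rob: "robust d \<rho> ?R"
    using robust_blocks_expl[of A V "t\<^sub>0 + r"] unfolding robust_blocks_def by metis
  have "A i \<in> near_orth ?R" if i: "i < n" for i
  proof -
    have Ai: "A i \<in> PiE {..<d} (\<lambda>_. {..<L})" using A i by (auto simp: mats_def dest: PiE_mem)
    have "\<bar>inner_d d (\<lambda>j. real (A i j)) x\<bar> \<le> \<eta> * real L * sqrt d" if "x \<in> set ?R" for x
    proof -
      have pos: "0 < real L * sqrt d" using L d by simp
      have "inner_d d (row A i) x = inner_d d (\<lambda>j. real (A i j) / (real L * sqrt d)) x"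
        by (simp add: row_def inner_d_def)
      then have "inner_d d (row A i) x = inner_d d (\<lambda>j. real (A i j)) x / (real L * sqrt d)"
        by (simp only: inner_d_divide_left)
      moreover have "\<bar>inner_d d (row A i) x\<bar> \<le> \<eta>"
        using that i by (intro inner_row_expl_le) (auto dest: in_set_dropD)
      ultimately have "\<bar>inner_d d (\<lambda>j. real (A i j)) x\<bar> / (real L * sqrt d) \<le> \<eta>"
        using pos by (simp add: abs_divide)
      then show ?thesis using pos by (simp add: pos_divide_le_eq mult.assoc)
    qed
    then show ?thesis using Ai rob lr by (simp add: near_orth_def)
  qed
  then have "A \<in> coded V p (fst (state A V t\<^sub>0)) I"
    using A by (simp add: coded_def sim)
  then show ?thesis using p(1) length_fst_state I cI by blast
qed

lemma card_mats: "card mats = L ^ (d * n)" and finite_mats: "finite mats"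
  unfolding mats_def by (auto simp: card_PiE power_mult intro!: finite_PiE)

text \<open>Count the valid pairs (A, V) twice: from below for each matrix, from above by the codes
  for each sequence. The sizes of both full spaces cancel; 6^n collects the 2^n sets
  \<open>I\<close> and the factor 3 per row.\<close>

lemma counting_bound:
  assumes "\<And>A V. A \<in> mats \<Longrightarrow> valid A V \<Longrightarrow> length V = N + 1 \<Longrightarrow> \<exists>t\<le>P * m. length (expl A V t) = N"
  shows "2 ^ (k * (n - 2 * m)) \<le> (16 * real c ^ (2 * k)) ^ (N + 1) * (real P * 2 ^ M * 6 ^ n)"
proof -
  let ?Q = "16 * real c ^ (2 * k)" and ?W = "pairs (N + 1)"
  let ?codes = "{..<P} \<times> {\<mu>. set \<mu> \<subseteq> (UNIV :: bool set) \<and> length \<mu> = M} \<times> {I. I \<subseteq> {..<n} \<and> card I \<le> 2 * m}"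
  let ?b = "real L ^ (d * n) * 3 ^ n / 2 ^ (k * (n - 2 * m))"
  have fin: "finite ?codes"
    by (intro finite_cartesian_product finite_lists_length_eq) auto
  have "card ?codes = P * (2 ^ M * card {I. I \<subseteq> {..<n} \<and> card I \<le> 2 * m})"
    by (subst card_cartesian_product, subst card_cartesian_product, subst card_lists_length_eq) auto
  also have "\<dots> \<le> P * (2 ^ M * 2 ^ n)"
    using card_mono[of "Pow {..<n}" "{I. I \<subseteq> {..<n} \<and> card I \<le> 2 * m}"]
    by (intro mult_le_mono) (auto simp: card_Pow)
  finally have "real (card ?codes) \<le> real (P * (2 ^ M * 2 ^ n))" by (rule of_nat_mono)
  then have ccodes: "real (card ?codes) \<le> real P * (2 ^ M * 2 ^ n)" by simp
  have upper: "real (card {A \<in> mats. valid A V}) \<le> real P * (2 ^ M * 2 ^ n) * ?b" if V: "V \<in> ?W" for V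
  proof -
    have "{A \<in> mats. valid A V} \<subseteq> (\<Union>(p, \<mu>, I)\<in>?codes. coded V p \<mu> I)"
    proof
      fix A assume A: "A \<in> {A \<in> mats. valid A V}"
      then obtain t where "t \<le> P * m" "length (expl A V t) = N"
        using assms[of A V] V by (auto simp: pairs_def)
      from exists_code[OF _ this] A obtain p \<mu> I where
        "p < P" "length \<mu> = M" "I \<subseteq> {..<n}" "card I \<le> 2 * m" "A \<in> coded V p \<mu> I" by blast
      then show "A \<in> (\<Union>(p, \<mu>, I)\<in>?codes. coded V p \<mu> I)"
        by (intro UN_I[of "(p, \<mu>, I)"]) simp_all
    qed
    moreover have "finite (\<Union>(p, \<mu>, I)\<in>?codes. coded V p \<mu> I)"
      using fin finite_mats by (auto simp: coded_def split: prod.splits intro!: finite_UN_I)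
    ultimately have "card {A \<in> mats. valid A V} \<le> card (\<Union>(p, \<mu>, I)\<in>?codes. coded V p \<mu> I)"
      by (intro card_mono)
    also have "\<dots> \<le> (\<Sum>x\<in>?codes. card (case x of (p, \<mu>, I) \<Rightarrow> coded V p \<mu> I))"
      by (rule card_UN_le[OF fin])
    finally have "real (card {A \<in> mats. valid A V}) \<le>
        (\<Sum>x\<in>?codes. real (card (case x of (p, \<mu>, I) \<Rightarrow> coded V p \<mu> I)))"
      unfolding of_nat_sum[symmetric] by (rule of_nat_mono)
    also have "\<dots> \<le> (\<Sum>x\<in>?codes. ?b)"
      by (rule sum_mono) (auto split: prod.splits intro: card_coded)
    also have "\<dots> = real (card ?codes) * ?b" by simp
    also have "\<dots> \<le> real P * (2 ^ M * 2 ^ n) * ?b"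
      by (intro mult_right_mono ccodes) simp
    finally show ?thesis .
  qed
  have "real L ^ (d * n) * (4 ^ d) ^ (N + 1) = (\<Sum>A\<in>mats. (4 ^ d) ^ (N + 1))"
    by (simp add: card_mats)
  also have "\<dots> \<le> (\<Sum>A\<in>mats. ?Q ^ (N + 1) * real (card {V \<in> ?W. valid A V}))"
    by (intro sum_mono card_valid) simp
  also have "\<dots> = ?Q ^ (N + 1) * real (\<Sum>A\<in>mats. card {V \<in> ?W. valid A V})"
    by (simp add: sum_distrib_left)
  also have "(\<Sum>A\<in>mats. card {V \<in> ?W. valid A V}) = (\<Sum>V\<in>?W. card {A \<in> mats. valid A V})"
    by (rule sum_multicount_gen) (auto simp: finite_mats finite_pairs_list)
  also have "?Q ^ (N + 1) * real (\<Sum>V\<in>?W. card {A \<in> mats. valid A V}) \<le>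
      ?Q ^ (N + 1) * (\<Sum>V\<in>?W. real P * (2 ^ M * 2 ^ n) * ?b)"
    unfolding of_nat_sum by (intro mult_left_mono sum_mono upper) auto
  also have "\<dots> = (real L ^ (d * n) * (4 ^ d) ^ (N + 1)) *
      (?Q ^ (N + 1) * (real P * 2 ^ M * (2 ^ n * 3 ^ n)) / 2 ^ (k * (n - 2 * m)))"
    by (simp add: card_pairs)
  finally have "(real L ^ (d * n) * (4 ^ d) ^ (N + 1)) * 1 \<le> (real L ^ (d * n) * (4 ^ d) ^ (N + 1)) *
      (?Q ^ (N + 1) * (real P * 2 ^ M * (2 ^ n * 3 ^ n)) / 2 ^ (k * (n - 2 * m)))" by simp
  moreover have "0 < real L ^ (d * n) * (4 ^ d) ^ (N + 1)" using L by simp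
  ultimately have "1 \<le> ?Q ^ (N + 1) * (real P * 2 ^ M * (2 ^ n * 3 ^ n)) / 2 ^ (k * (n - 2 * m))"
    by (simp only: mult_le_cancel_left_pos)
  then have "2 ^ (k * (n - 2 * m)) \<le> ?Q ^ (N + 1) * (real P * 2 ^ M * (2 ^ n * 3 ^ n))"
    by (simp add: pos_le_divide_eq)
  moreover have "(2::real) ^ n * 3 ^ n = 6 ^ n" by (simp flip: power_mult_distrib)
  ultimately show ?thesis by simp
qed

lemma exists_valid:
  assumes "0 < c"
  shows "\<exists>A V. A \<in> mats \<and> valid A V \<and> length V = N + 1"
proof -
  have "mats \<noteq> {}" using L by (auto simp: mats_def PiE_eq_empty_iff)
  then obtain A where A: "A \<in> mats" by blast
  have "0 < ((4::real) ^ d) ^ (N + 1)" by simp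
  also have "\<dots> \<le> (16 * real c ^ (2 * k)) ^ (N + 1) * real (card {V \<in> pairs (N + 1). valid A V})"
    by (rule card_valid) simp
  finally have "card {V \<in> pairs (N + 1). valid A V} \<noteq> 0" by (metis mult_zero_right of_nat_0 less_irrefl)
  then have "{V \<in> pairs (N + 1). valid A V} \<noteq> {}" by (metis card.empty)
  then show ?thesis using A by (auto simp: pairs_def)
qed

end

section \<open>Parameters\<close>

text \<open>Origins: \<open>s\<close> makes exp (-d s^2 / 2) equal to d^(-5), against at most d^3
  tests. Once (k + 1) w \<le> \<rho>, the choice of \<open>\<rho>\<close> keeps the drops per vector
  below a quarter of a drop per period. \<open>\<beta>\<close> makes (P + 1)
  \<open>\<gamma>\<^sub>1\<close> equal to 2 / d^4, twice the accuracy, and the slack of the rows is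
  twice that. \<open>\<Lambda>\<close> = 64 ln d grants ln d to each summand of the potential bound.
  2 d^3 + 1 is 2 / w + 1, and the grid size d^6 suffices because 2 H is at most d^5. In
  \<open>n\<close>, 80 = 8 * 10; in \<open>PN\<close>, 5898240 = 10 * 768^2 with 768 = 8 * 96 from
  the gap.\<close>

lemma adversary_count_parameters:
  fixes d k P n m M :: nat and alg :: alg
  defines "\<l> \<equiv> ln (real d)"
  defines "s \<equiv> sqrt (10 * \<l> / real d)"
  defines "\<rho> \<equiv> s / (8 * (real (P * k) + 2))"
  defines "w \<equiv> 1 / real d ^ 3"
  defines "\<beta> \<equiv> 1 / (2 * real d ^ 4 * (real P + 1) * s)"
  defines "H \<equiv> nat \<lceil>((2 * (4 / real d ^ 4 * real (d ^ 6) * sqrt d) + sqrt d + 1) / \<rho>) * real k + 1\<rceil>"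
  assumes \<l>: "1 \<le> \<l>" and d\<l>: "1000 * \<l> \<le> real d"
    and k: "0 < k" and P: "0 < P"
    and n: "80 * \<l> * real n \<le> real d"
    and N: "100000 * \<l>\<^sup>2 * (real (P * k) + 2) \<le> real d"
    and PN: "5898240 * \<l> * (real P + 1)\<^sup>2 * (real (P * k) + 1) \<le> real d"
    and m: "2 * m \<le> n" and T: "P * m + n + P * k + 2 \<le> d ^ 3"
    and alg: "valid_alg d M alg"
  shows "adversary_count d k P n (d ^ 6) (P * m) M alg s \<rho> w \<beta> (4 * \<beta> * s)
    (2 * \<beta> * (\<rho> + (real k + 1) * w)) (4 / real d ^ 4) (64 * \<l>) (2 * d ^ 3 + 1) m H"
    and "(real P + 1) * (4 * \<beta> * s) = 2 / real d ^ 4"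
proof -
  let ?d = "real d"
  define K where "K = real (P * k)"
  note N = N[folded K_def] and PN = PN[folded K_def]
  have \<rho>_eq: "\<rho> = s / (8 * (K + 2))" by (simp add: \<rho>_def K_def)
  have d: "1000 \<le> ?d" using \<l> d\<l> by linarith
  then have d0: "0 < ?d" by linarith
  have \<l>2: "\<l> \<le> \<l>\<^sup>2" "1 \<le> \<l>\<^sup>2" 
    using \<l> power_increasing[of 1 2 \<l>] one_le_power[of \<l> 2] by simp_all
  have s2: "s\<^sup>2 = 10 * \<l> / ?d" using \<l> d0 by (simp add: s_def)
  have s0: "0 < s" using \<l> d0 by (simp add: s_def)
  have s1: "s \<le> 1" using d\<l> \<l> d0 by (simp add: s_def divide_le_eq)
  have ds: "1 \<le> ?d * s"
  proof -
    have "1 \<le> ?d * s\<^sup>2" using s2 d0 \<l> by simp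
    also have "\<dots> \<le> ?d * s" using s0 s1 d0 by (intro mult_left_mono) (auto simp: power2_eq_square mult_left_le)
    finally show ?thesis .
  qed
  have sqs: "1 \<le> sqrt ?d * s" using \<l> d0 by (simp add: s_def flip: real_sqrt_mult)
  have N0: "0 \<le> K" by (simp add: K_def)
  have Nd: "100000 * (K + 2) \<le> ?d"
  proof -
    have "1 * (100000 * (K + 2)) \<le> \<l>\<^sup>2 * (100000 * (K + 2))" using \<l>2 N0 by (intro mult_right_mono) auto
    then show ?thesis using N by (simp add: algebra_simps)
  qed
  have Nl: "100000 * \<l> * (K + 2) \<le> ?d"
  proof -
    have "\<l> * (100000 * (K + 2)) \<le> \<l>\<^sup>2 * (100000 * (K + 2))" using \<l>2 N0 by (intro mult_right_mono) auto
    then show ?thesis using N by (simp add: algebra_simps)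
  qed
  have kN: "real k \<le> K" unfolding K_def using P k by (intro of_nat_mono) simp
  have \<rho>0: "0 < \<rho>" using s0 N0 unfolding \<rho>_eq by (intro divide_pos_pos) auto
  have w0: "0 < w" using d0 by (simp add: w_def)
  have \<beta>0: "0 < \<beta>" using d0 s0 by (simp add: \<beta>_def)
  have \<beta>1: "\<beta> \<le> 1 / 2"
  proof -
    have "1 * 1 * 1 \<le> ?d ^ 3 * (real P + 1) * (?d * s)"
      using d ds by (intro mult_mono one_le_power) auto
    then have "1 \<le> ?d ^ 4 * (real P + 1) * s" by (simp add: power4_eq_xxxx power3_eq_cube algebra_simps)
    then show ?thesis by (simp add: \<beta>_def divide_le_eq mult.assoc)
  qed
  have \<gamma>: "(real P + 1) * (4 * \<beta> * s) = 2 / ?d ^ 4"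
  proof -
    have "real P + 1 \<noteq> 0" "s \<noteq> 0" "?d ^ 4 \<noteq> 0" using s0 d0 by auto
    then show ?thesis unfolding \<beta>_def by (simp add: divide_simps)
  qed
  then show "(real P + 1) * (4 * \<beta> * s) = 2 / ?d ^ 4" .
  have kw: "(real k + 1) * w \<le> \<rho>"
  proof -
    have "(real k + 1) * (8 * (K + 2)) \<le> (K + 2) * (8 * (K + 2))"
      using kN by (intro mult_right_mono) auto
    also have "\<dots> \<le> ?d * ?d" using Nd N0 by (intro mult_mono) auto
    also have "\<dots> \<le> ?d * ?d * (?d * s)" using ds d0 by (simp add: mult_left_le)
    finally have "(real k + 1) * (8 * (K + 2)) \<le> ?d ^ 3 * s" by (simp add: power3_eq_cube algebra_simps)
    moreover have "0 < 8 * (K + 2)" using N0 by simp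
    ultimately show ?thesis
      unfolding \<rho>_eq w_def using d0 by (simp add: pos_le_divide_eq divide_le_eq mult.commute)
  qed
  have g12: "(K + 1) * (2 * \<beta> * (\<rho> + (real k + 1) * w)) + \<beta> * \<rho> \<le> (4 * \<beta> * s) / 4"
  proof -
    have "(K + 1) * (2 * \<beta> * (\<rho> + (real k + 1) * w)) \<le> (K + 1) * (2 * \<beta> * (\<rho> + \<rho>))"
      using kw \<beta>0 N0 by (intro mult_left_mono add_left_mono) auto
    moreover have "\<beta> * ((8 * (K + 2)) * \<rho>) = \<beta> * s"
    proof -
      have "8 * (K + 2) \<noteq> 0" using N0 by simp
      then show ?thesis by (simp add: \<rho>_eq)
    qed
    moreover have "0 \<le> \<beta> * \<rho> * (4 * K + 11)" using \<beta>0 \<rho>0 N0 by simp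
    ultimately show ?thesis by (simp add: algebra_simps)
  qed
  have lnN: "ln (K + 1) \<le> \<l>"
    unfolding \<l>_def using Nd N0 by (intro ln_mono) auto
  have LN: "ln (K + 1) + (K + 1) * ((64 * \<l>)\<^sup>2 * s\<^sup>2 / 2) \<le> 64 * \<l> / 32"
  proof -
    have "20480 * \<l>\<^sup>2 * (K + 1) \<le> 100000 * \<l>\<^sup>2 * (K + 2)"
      using N0 by (intro mult_mono) auto
    then have "20480 * \<l>\<^sup>2 * (K + 1) \<le> ?d" using N by (rule order_trans)
    then have "20480 * \<l>\<^sup>2 * (K + 1) * \<l> \<le> ?d * \<l>" using \<l> by (intro mult_right_mono) auto
    then have "(K + 1) * ((64 * \<l>)\<^sup>2 * s\<^sup>2 / 2) \<le> \<l>"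
      unfolding s2 using d0 by (simp add: divide_le_eq power_mult_distrib power2_eq_square algebra_simps)
    then show ?thesis using lnN by linarith
  qed
  have sq1: "s * (3 * sqrt (K + 1)) \<le> 1 / 32"
  proof (rule power2_le_imp_le)
    have "92160 * \<l> * (K + 1) \<le> 100000 * \<l> * (K + 2)" using \<l> N0 by (intro mult_mono) auto
    then have "92160 * \<l> * (K + 1) \<le> ?d" using Nl by (rule order_trans)
    then have "90 * \<l> * (K + 1) / ?d \<le> (1 / 32)\<^sup>2"
      using d0 by (simp add: power2_eq_square divide_le_eq)
    moreover have "(s * (3 * sqrt (K + 1)))\<^sup>2 = 90 * \<l> * (K + 1) / ?d"
      using N0 by (simp add: power_mult_distrib s2)
    ultimately show "(s * (3 * sqrt (K + 1)))\<^sup>2 \<le> (1 / 32)\<^sup>2" by (simp only:)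
  qed simp
  have gap1: "2 * (real P + 1) * (4 * \<beta> * s) \<le> \<beta> / (96 * sqrt (K + 1))"
  proof -
    have "768 * (real P + 1) * s * sqrt (K + 1) \<le> 1"
    proof (rule power2_le_imp_le)
      have "(768 * (real P + 1) * s * sqrt (K + 1))\<^sup>2 = 5898240 * \<l> * (real P + 1)\<^sup>2 * (K + 1) / ?d"
        using N0 by (simp add: power_mult_distrib s2 del: distrib_left_numeral)
      then show "(768 * (real P + 1) * s * sqrt (K + 1))\<^sup>2 \<le> 1\<^sup>2"
        using PN d0 by (simp add: divide_le_eq)
    qed simp
    then have "\<beta> * (768 * (real P + 1) * s * sqrt (K + 1)) \<le> \<beta> * 1" using \<beta>0 by (intro mult_left_mono) auto
    moreover have "0 < 96 * sqrt (K + 1)" using N0 by (simp add: add_nonneg_pos)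
    ultimately show ?thesis by (simp add: pos_le_divide_eq algebra_simps)
  qed
  have d4: "8 \<le> ?d ^ 4"
  proof -
    have "1000 ^ 4 \<le> ?d ^ 4" using d by (intro power_mono) auto
    then show ?thesis by simp
  qed
  have gap2: "2 * (real P + 1) * (4 * \<beta> * s) \<le> 1 / 2" "2 * (real P + 1) * (4 * \<beta> * s) \<le> 4 / ?d ^ 4"
  proof -
    have e: "2 * (real P + 1) * (4 * \<beta> * s) = 4 / ?d ^ 4"
      using arg_cong[OF \<gamma>, of "\<lambda>x. 2 * x"] by (simp only: mult.assoc)
    show "2 * (real P + 1) * (4 * \<beta> * s) \<le> 1 / 2" unfolding e using d4 by (simp add: divide_le_eq)
    show "2 * (real P + 1) * (4 * \<beta> * s) \<le> 4 / ?d ^ 4" by (simp only: e)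
  qed
  have ns: "real n * s\<^sup>2 \<le> 1 / 8" using n d0 unfolding s2 by (simp add: field_simps)
  have exp5: "exp (- (?d * s\<^sup>2) / 2) = 1 / ?d ^ 5"
  proof -
    have "- (?d * s\<^sup>2) / 2 = - (5 * ln ?d)" using d0 by (simp add: s2 \<l>_def)
    then show ?thesis using d0 exp_of_nat_mult[of 5 "ln ?d"] by (simp add: exp_minus inverse_eq_divide)
  qed
  have tests: "real (P * m + n + P * k + 2) * (4 * exp (- (?d * s\<^sup>2) / 2)) \<le> 1"
  proof -
    have "real (P * m + n + P * k + 2) \<le> real (d ^ 3)" using T by (rule of_nat_mono)
    also have "\<dots> = ?d ^ 3" by simp
    finally have "real (P * m + n + P * k + 2) \<le> ?d ^ 3" .
    then have "real (P * m + n + P * k + 2) * 4 \<le> ?d ^ 3 * (?d * ?d)"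
      using d mult_mono[of 2 ?d 2 ?d] by (intro mult_mono) auto
    then show ?thesis unfolding exp5 using d0 by (simp add: divide_le_eq power3_eq_cube numeral_eq_Suc algebra_simps)
  qed
  have far: "8 * real (2 * d ^ 3 + 1) ^ (2 * k) * exp (- ?d / 8) \<le> 1"
  proof -
    have "real (2 * d ^ 3 + 1) \<le> 3 * ?d ^ 3" using d one_le_power[of ?d 3] by simp
    also have "\<dots> \<le> ?d * ?d ^ 3" using d by (intro mult_right_mono) auto
    finally have "real (2 * d ^ 3 + 1) \<le> ?d ^ 4" by (simp add: numeral_eq_Suc)
    also have "?d ^ 4 = exp (4 * \<l>)" using exp_of_nat_mult[of 4 "ln ?d"] d0 by (simp add: \<l>_def)
    finally have "real (2 * d ^ 3 + 1) ^ (2 * k) \<le> exp (4 * \<l>) ^ (2 * k)" by (intro power_mono) auto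
    also have "\<dots> = exp (real (2 * k) * (4 * \<l>))" by (rule exp_of_nat_mult[symmetric])
    finally have a: "real (2 * d ^ 3 + 1) ^ (2 * k) \<le> exp (8 * real k * \<l>)" by (simp add: mult.assoc)
    have "(2::real) \<le> exp 1" using exp_ge_add_one_self[of 1] by simp
    then have "2 ^ 3 \<le> exp (1::real) ^ 3" by (intro power_mono) auto
    then have b: "8 \<le> exp (3::real)" using exp_of_nat_mult[of 3 "1::real"] by simp
    have "8 * real (2 * d ^ 3 + 1) ^ (2 * k) * exp (- ?d / 8) \<le> exp 3 * exp (8 * real k * \<l>) * exp (- ?d / 8)"
      by (intro mult_right_mono mult_mono a b) auto
    also have "\<dots> = exp (3 + 8 * real k * \<l> + - ?d / 8)" by (simp only: exp_add)
    also have "\<dots> \<le> 1"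
    proof -
      have "8 * real k * \<l> \<le> 100 * (\<l> * (K + 2))"
        using kN \<l> mult_mono[of "8::real" 100 "real k * \<l>" "\<l> * (K + 2)"] mult_left_mono[of "real k" "K + 2" \<l>]
        by (simp add: mult.commute mult.left_commute)
      moreover have "1000 * (100 * (\<l> * (K + 2))) \<le> ?d" using Nl by (simp add: mult.assoc)
      ultimately have "8 * real k * \<l> \<le> ?d / 1000" by linarith
      then show ?thesis using d by simp
    qed
    finally show ?thesis .
  qed
  have eL: "4 / ?d ^ 4 * real (d ^ 6) = 4 * ?d\<^sup>2"
    using d0 by (simp add: divide_simps flip: power_add)
  define X where "X = ((2 * (4 / ?d ^ 4 * real (d ^ 6) * sqrt d) + sqrt d + 1) / \<rho>) * real k + 1"
  have XH: "X \<le> real H" "real H \<le> X + 1"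
  proof -
    have "0 \<le> X" unfolding X_def using \<rho>0 by simp
    then show "X \<le> real H" "real H \<le> X + 1" unfolding H_def X_def[symmetric] by linarith+
  qed
  have LH: "?d * (2 * real H) \<le> real (d ^ 6)"
  proof -
    have "1 * 1 \<le> ?d\<^sup>2 * sqrt ?d" using d by (intro mult_mono one_le_power) auto
    moreover have "1 * sqrt ?d \<le> ?d\<^sup>2 * sqrt ?d" using d by (intro mult_right_mono one_le_power) auto
    ultimately have "2 * (4 * ?d\<^sup>2 * sqrt d) + sqrt d + 1 \<le> 10 * ?d\<^sup>2 * sqrt ?d" by linarith
    then have "(2 * (4 * ?d\<^sup>2 * sqrt d) + sqrt d + 1) / \<rho> * real k \<le> (10 * ?d\<^sup>2 * sqrt ?d) / \<rho> * real k"
      using \<rho>0 by (intro mult_right_mono divide_right_mono) auto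
    then have "X - 1 \<le> (10 * ?d\<^sup>2 * sqrt ?d) / \<rho> * real k"
      unfolding X_def eL by linarith
    also have "\<dots> = 80 * ?d\<^sup>2 * (K + 2) * real k * (sqrt ?d / s)"
      using s0 by (simp add: \<rho>_eq divide_simps)
    also have "\<dots> \<le> 80 * ?d\<^sup>2 * (K + 2) * (K + 2) * ?d"
    proof (intro mult_mono mult_left_mono)
      have "sqrt ?d * 1 \<le> sqrt ?d * (sqrt ?d * s)" using sqs by (intro mult_left_mono) auto
      then show "sqrt ?d / s \<le> ?d" using s0 by (simp add: divide_le_eq mult.assoc[symmetric])
    qed (use kN s0 in auto)
    also have "\<dots> \<le> 80 * ?d\<^sup>2 * (?d / 100000) * (?d / 100000) * ?d"
      using Nd N0 by (intro mult_mono) auto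
    also have "\<dots> \<le> ?d ^ 5 / 4" using d0 by (simp add: numeral_eq_Suc)
    finally have "X \<le> ?d ^ 5 / 4 + 1" by simp
    moreover have "8 \<le> ?d ^ 5"
    proof -
      have "1000 ^ 5 \<le> ?d ^ 5" using d by (intro power_mono) auto
      then show ?thesis by simp
    qed
    ultimately have "2 * real H \<le> ?d ^ 5" using XH by linarith
    then have "?d * (2 * real H) \<le> ?d * ?d ^ 5" using d0 by (intro mult_left_mono) auto
    then show ?thesis by (simp add: numeral_eq_Suc)
  qed
  show "adversary_count d k P n (d ^ 6) (P * m) M alg s \<rho> w \<beta> (4 * \<beta> * s)
    (2 * \<beta> * (\<rho> + (real k + 1) * w)) (4 / ?d ^ 4) (64 * \<l>) (2 * d ^ 3 + 1) m H"
  proof unfold_locales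
    show "2 / w + 1 \<le> real (2 * d ^ 3 + 1)" by (simp add: w_def)
    show "(2 * (4 / ?d ^ 4 * real (d ^ 6) * sqrt ?d) + sqrt ?d + 1) / \<rho> * real k + 1 \<le> real H"
      using XH(1) by (simp only: X_def)
    show "0 < 64 * \<l>" using \<l> by simp
  qed (use d0 k P s0 s1 \<rho>0 w0 \<beta>0 \<beta>1 g12 alg ns LN sq1 gap1 gap2 tests far LH m in \<open>simp_all add: K_def\<close>)
qed

lemma (in adversary) length_expl_le_time: "length (expl A V t) \<le> t"
  by (induction t) (auto simp: expl_Suc extend_def)

text \<open>Exponents in multiples of k n: on the right, the vectors cost 1/16, the memory 1/16, and
  P with 6^n together 4 n, again at most 1/16 because k \<ge> 64. On the left, n - 2 m \<ge> n / 2
  and 2 \<ge> exp (1/2) give 1/4.\<close>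

lemma counting_contradiction:
  fixes d k P n m M :: nat
  defines "\<l> \<equiv> ln (real d)"
  assumes \<l>: "1 \<le> \<l>" and d: "3 \<le> d" and k: "64 \<le> k" and n: "0 < n" and m: "4 * m \<le> n"
    and N: "144 * \<l> * (real (P * k) + 1) \<le> real n" and M: "16 * real M \<le> real k * real n"
  shows "\<not> 2 ^ (k * (n - 2 * m)) \<le>
    (16 * real (2 * d ^ 3 + 1) ^ (2 * k)) ^ (P * k + 1) * (real P * 2 ^ M * 6 ^ n)"
proof -
  have e2: "(2::real) \<le> exp 1" using exp_ge_add_one_self[of 1] by simp
  have "(2::real) ^ 4 \<le> exp 1 ^ 4" "(2::real) ^ 3 \<le> exp 1 ^ 3" using e2 by (intro power_mono; simp)+
  then have e16: "16 \<le> exp (4::real)" and e6: "6 \<le> exp (3::real)"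
    using exp_of_nat_mult[of 4 "1::real"] exp_of_nat_mult[of 3 "1::real"] by simp_all
  have d0: "0 < real d" using d by simp
  have "real (2 * d ^ 3 + 1) \<le> 3 * real d ^ 3" using d one_le_power[of "real d" 3] by simp
  also have "\<dots> \<le> real d * real d ^ 3" using d by (intro mult_right_mono) auto
  finally have "real (2 * d ^ 3 + 1) \<le> real d ^ 4" by (simp add: numeral_eq_Suc)
  also have "real d ^ 4 = exp (4 * \<l>)" using exp_of_nat_mult[of 4 "ln (real d)"] d0 by (simp add: \<l>_def)
  finally have "real (2 * d ^ 3 + 1) ^ (2 * k) \<le> exp (4 * \<l>) ^ (2 * k)" by (intro power_mono) auto
  also have "\<dots> = exp (real (2 * k) * (4 * \<l>))" by (rule exp_of_nat_mult[symmetric])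
  finally have "16 * real (2 * d ^ 3 + 1) ^ (2 * k) \<le> exp 4 * exp (real (2 * k) * (4 * \<l>))"
    by (intro mult_mono e16) auto
  also have "\<dots> = exp (4 + 8 * (real k * \<l>))" by (simp add: exp_add)
  also have "\<dots> \<le> exp (9 * (real k * \<l>))"
  proof -
    have "64 * 1 \<le> real k * \<l>" using k \<l> by (intro mult_mono) auto
    then show ?thesis by (simp add: mult.commute)
  qed
  finally have "(16 * real (2 * d ^ 3 + 1) ^ (2 * k)) ^ (P * k + 1) \<le> exp (9 * (real k * \<l>)) ^ (P * k + 1)"
    by (intro power_mono) auto
  also have "\<dots> = exp (real (P * k + 1) * (9 * (real k * \<l>)))" by (rule exp_of_nat_mult[symmetric])
  also have "\<dots> \<le> exp (real k * real n / 16)"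
  proof -
    have "real k * (144 * \<l> * (real (P * k) + 1)) \<le> real k * real n" using N by (intro mult_left_mono) auto
    then show ?thesis by (simp add: algebra_simps)
  qed
  finally have a: "(16 * real (2 * d ^ 3 + 1) ^ (2 * k)) ^ (P * k + 1) \<le> exp (real k * real n / 16)" .
  have b: "real P \<le> exp (real n)"
  proof -
    have "1 * (real (P * k) + 1) \<le> 144 * \<l> * (real (P * k) + 1)" using \<l> by (intro mult_right_mono) auto
    from order_trans[OF this N] have "real (P * k + 1) \<le> real n" by (simp only: mult_1 of_nat_add of_nat_1)
    then have "P * k + 1 \<le> n" by (simp only: of_nat_le_iff)
    moreover have "P \<le> P * k" using k by simp
    ultimately have "P \<le> n" by linarith
    then have "real P \<le> real n" by simp
    also have "\<dots> \<le> exp (real n)" using exp_ge_add_one_self[of "real n"] by linarith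
    finally show ?thesis .
  qed
  have c: "(2::real) ^ M \<le> exp (real M)"
    using power_mono[OF e2, of M] exp_of_nat_mult[of M "1::real"] by simp
  have e: "(6::real) ^ n \<le> exp (3 * real n)"
    using power_mono[OF e6, of n] exp_of_nat_mult[of n "3::real"] by (simp add: mult.commute)
  have "(16 * real (2 * d ^ 3 + 1) ^ (2 * k)) ^ (P * k + 1) * (real P * 2 ^ M * 6 ^ n) \<le>
      exp (real k * real n / 16) * (exp (real n) * exp (real M) * exp (3 * real n))"
    by (intro mult_mono a b c e) auto
  also have "\<dots> = exp (real k * real n / 16 + (real n + real M + 3 * real n))" by (simp only: exp_add)
  also have "\<dots> < exp (real k * real n / 4)"
  proof -
    have "64 * real n \<le> real k * real n" using k by (intro mult_right_mono) auto
    moreover have "0 < real n" using n by simp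
    ultimately have "real k * real n / 16 + (real n + real M + 3 * real n) < real k * real n / 4"
      using M by linarith
    then show ?thesis by simp
  qed
  also have "\<dots> \<le> exp (real (k * (n - 2 * m)) * (1 / 2))"
  proof -
    have "real n / 2 \<le> real (n - 2 * m)" using m by (simp add: of_nat_diff)
    then have "real k * (real n / 2) \<le> real k * real (n - 2 * m)" by (intro mult_left_mono) auto
    then show ?thesis by simp
  qed
  also have "\<dots> = exp (1 / 2) ^ (k * (n - 2 * m))" by (rule exp_of_nat_mult)
  also have "\<dots> \<le> 2 ^ (k * (n - 2 * m))"
  proof (rule power_mono)
    have "(exp (1 / 2 :: real))\<^sup>2 \<le> 2\<^sup>2"
      using exp_le exp_of_nat_mult[of 2 "1 / 2 :: real"] by simp
    then show "exp (1 / 2 :: real) \<le> 2" by (rule power2_le_imp_le) simp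
  qed simp
  finally show ?thesis by simp
qed

text \<open>The first bound ignores the memory: a query explores at most one vector, and all P k
  must be explored unless the horizon P m is exceeded. The second one is the counting argument, run
  under the assumption that every hard function is solved within the horizon.\<close>

lemma query_lower_bound:
  fixes d k P n m M :: nat and A :: alg
  defines "\<l> \<equiv> ln (real d)"
  assumes \<l>: "1 \<le> \<l>" and d\<l>: "1000 * \<l> \<le> real d"
    and k: "0 < k" and P: "0 < P"
    and n: "80 * \<l> * real n \<le> real d"
    and N: "100000 * \<l>\<^sup>2 * (real (P * k) + 2) \<le> real d"
    and PN: "5898240 * \<l> * (real P + 1)\<^sup>2 * (real (P * k) + 1) \<le> real d"
    and m4: "4 * m \<le> n" and T: "P * m + n + P * k + 2 \<le> d ^ 3"
    and A: "valid_alg d M A" and mini: "minimizes d M A (1 / real d ^ 4)"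
  shows "\<exists>f orc. convex_d d f \<and> lipschitz1_d d f \<and> first_order_oracle d f orc \<and>
      min (P * k) (P * m) \<le> num_queries A M orc"
    and "64 \<le> k \<Longrightarrow> 0 < n \<Longrightarrow> 144 * \<l> * (real (P * k) + 1) \<le> real n \<Longrightarrow> 16 * real M \<le> real k * real n \<Longrightarrow>
      \<exists>f orc. convex_d d f \<and> lipschitz1_d d f \<and> first_order_oracle d f orc \<and>
      P * m < num_queries A M orc"
proof -
  have m2: "2 * m \<le> n" using m4 by simp
  note par = adversary_count_parameters[OF \<l>[unfolded \<l>_def] d\<l>[unfolded \<l>_def] k P n[unfolded \<l>_def]
      N[unfolded \<l>_def] PN[unfolded \<l>_def] m2 T A]
  define s where "s = sqrt (10 * ln (real d) / real d)"
  define \<rho> where "\<rho> = s / (8 * (real (P * k) + 2))"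
  define \<beta> where "\<beta> = 1 / (2 * real d ^ 4 * (real P + 1) * s)"
  define H where "H = nat \<lceil>((2 * (4 / real d ^ 4 * real (d ^ 6) * sqrt d) + sqrt d + 1) / \<rho>) * real k + 1\<rceil>"
  interpret adversary_count d k P n "d ^ 6" "P * m" M A s \<rho> "1 / real d ^ 3" \<beta> "4 * \<beta> * s"
    "2 * \<beta> * (\<rho> + (real k + 1) * (1 / real d ^ 3))" "4 / real d ^ 4" "64 * ln (real d)" "2 * d ^ 3 + 1" m H
    unfolding H_def \<beta>_def \<rho>_def s_def by (rule par(1))
  have "(real P + 1) * (4 * \<beta> * s) = 2 / real d ^ 4"
    unfolding \<beta>_def s_def by (rule par(2))
  moreover have "0 < real d" using d by simp
  ultimately have eps: "1 / real d ^ 4 < (real P + 1) * (4 * \<beta> * s)"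
    by (simp add: divide_strict_right_mono)
  let ?f = "\<lambda>B V. F B V (pieces {..<n} (P * k))" and ?orc = "\<lambda>B V. resp B V (pieces {..<n} (P * k))"
  have hard: "convex_d d (?f B V) \<and> lipschitz1_d d (?f B V) \<and> first_order_oracle d (?f B V) (?orc B V)"
    if "B \<in> mats" "valid B V" for B V
    using hard_function[OF that finite_pieces pieces_nonempty] by blast
  show "\<exists>f orc. convex_d d f \<and> lipschitz1_d d f \<and> first_order_oracle d f orc \<and>
      min (P * k) (P * m) \<le> num_queries A M orc"
  proof -
    obtain B V where BV: "B \<in> mats" "valid B V" "length V = P * k + 1" using exists_valid by auto
    have "min (P * k) (P * m) \<le> num_queries A M (?orc B V)"
    proof (cases "num_queries A M (?orc B V) \<le> P * m")
      case True
      then have "P * k \<le> num_queries A M (?orc B V)"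
        using all_explored[OF BV mini eps True] length_expl_le_time by metis
      then show ?thesis by simp
    qed simp
    then show ?thesis using hard[OF BV(1,2)] by blast
  qed
  assume large: "64 \<le> k" "0 < n" "144 * \<l> * (real (P * k) + 1) \<le> real n" "16 * real M \<le> real k * real n"
  show "\<exists>f orc. convex_d d f \<and> lipschitz1_d d f \<and> first_order_oracle d f orc \<and>
      P * m < num_queries A M orc"
  proof (rule ccontr)
    assume none: "\<not> ?thesis"
    have "\<exists>t\<le>P * m. length (expl B V t) = P * k"
      if BV: "B \<in> mats" "valid B V" "length V = P * k + 1" for B V
    proof -
      have le: "num_queries A M (?orc B V) \<le> P * m"
        using none hard[OF BV(1,2)] by (meson not_le)
      then show ?thesis using all_explored[OF BV mini eps le] by blast
    qed
    then have "2 ^ (k * (n - 2 * m)) \<le>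
      (16 * real (2 * d ^ 3 + 1) ^ (2 * k)) ^ (P * k + 1) * (real P * 2 ^ M * 6 ^ n)"
      by (rule counting_bound)
    moreover have "3 \<le> d" using \<l> d\<l> by linarith
    ultimately show False
      using counting_contradiction[of d k n m P M] \<l> large m4 unfolding \<l>_def by blast
  qed
qed

theorem theorem1:
  shows "\<exists>c>0. \<exists>k::nat. \<exists>d0::nat. \<forall>d\<ge>d0. \<forall>\<delta>::real. 0 \<le> \<delta> \<and> \<delta> \<le> 1 \<longrightarrow>
    (\<forall>M A. valid_alg d M A \<and> minimizes d M A (1 / real d ^ 4) \<longrightarrow>
       real M \<ge> real d powr (2 - \<delta>) \<or>
       (\<exists>f orc. convex_d d f \<and> lipschitz1_d d f \<and> first_order_oracle d f orc \<and>
          real (num_queries A M orc) \<ge> c * real d powr (1 + \<delta> / 3) / (ln (real d)) ^ k))"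
proof -
  have "eventually (\<lambda>d::nat. 1000 \<le> ln (real d)) at_top"
    by real_asymp
  moreover have "eventually (\<lambda>d::nat. ln (real d) ^ 5 \<le> real d) at_top"
    by real_asymp
  ultimately obtain d0 :: nat where d0: "\<And>d. d0 \<le> d \<Longrightarrow> 1000 \<le> ln (real d) \<and> ln (real d) ^ 5 \<le> real d"
    unfolding eventually_sequentially by (metis le_trans nat_le_linear)
  show ?thesis
  \<comment> \<open>2560 = 2 * 1280: m is at least d / (1280 ln d), and rounding P down costs at
    most a factor 2. The power 6 comes from the range of small \<delta>: 4 for k and 2 for the bound
    on u.\<close>
  proof (rule exI[of _ "1 / 2560"], rule conjI, simp, rule exI[of _ 6], rule exI[of _ d0], intro allI impI)
    fix d :: nat and \<delta> :: real and M :: nat and A :: alg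
    assume "d0 \<le> d" and \<delta>: "0 \<le> \<delta> \<and> \<delta> \<le> 1"
      and alg: "valid_alg d M A \<and> minimizes d M A (1 / real d ^ 4)"
    define l where "l = ln (real d)"
    define x where "x = real d"
    have l: "1000 \<le> l" and l5: "l ^ 5 \<le> x" using d0[OF \<open>d0 \<le> d\<close>] by (auto simp: l_def x_def)
    have lpow: "1000 ^ i \<le> l ^ i" for i using l by (intro power_mono) auto
    have l2': "1000000 \<le> l\<^sup>2" and l3': "1000000000 \<le> l ^ 3" using lpow[of 2] lpow[of 3] by simp_all
    have l0: "0 < l" using l by linarith
    have x1: "1000 * l ^ 4 \<le> x"
    proof -
      have "1000 * l ^ 4 \<le> l * l ^ 4" using l by (intro mult_right_mono) auto
      then show ?thesis using l5 by (simp add: numeral_eq_Suc)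
    qed
    have l14: "l \<le> l ^ 4" using power_increasing[of 1 4 l] l by simp
    have xl: "1000 * l \<le> x" using x1 l14 by linarith
    have x0: "0 < x" "1 \<le> x" using xl l by linarith+
    define u where "u = x powr (\<delta> / 3)"
    have u1: "1 \<le> u" unfolding u_def using x0 \<delta> by (simp add: ge_one_powr_ge_zero)
    have u3: "u ^ 3 = x powr \<delta>" unfolding u_def using x0 by (simp add: powr_realpow[symmetric] powr_powr)
    have u3x: "u ^ 3 \<le> x" unfolding u3 using \<delta> x0 powr_mono[of \<delta> 1 x] by simp
    have ux: "u \<le> x" using u3x power_increasing[of 1 3 u] u1 by simp
    have goal_powr: "x powr (1 + \<delta> / 3) = x * u" unfolding u_def using x0 by (simp add: powr_add)
    have mem_powr: "x powr (2 - \<delta>) = x\<^sup>2 / u ^ 3"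
      unfolding u3 using x0 by (simp add: powr_diff powr_numeral)
    define n where "n = nat \<lfloor>x / (80 * l)\<rfloor>"
    define m where "m = n div 4"
    have q8: "8 \<le> x / (80 * l)"
    proof -
      have "640 * l \<le> x" using xl l by linarith
      then show ?thesis using l0 by (simp add: pos_le_divide_eq)
    qed
    have n_up: "real n \<le> x / (80 * l)" and n_lo: "x / (80 * l) \<le> 2 * real n" and n8: "7 < real n"
      unfolding n_def using q8 by linarith+
    have n80: "80 * l * real n \<le> x" using n_up l0 by (simp add: pos_le_divide_eq mult.commute)
    have n160: "x \<le> 160 * l * real n" using n_lo l0 by (simp add: pos_divide_le_eq algebra_simps)
    have nx: "real n \<le> x"
    proof -
      have "1 * real n \<le> 80 * l * real n" using l by (intro mult_right_mono) auto
      then show ?thesis using n80 by linarith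
    qed
    have m4: "4 * m \<le> n" by (simp add: m_def)
    have m_lo: "real n \<le> 8 * real m" using n8 unfolding m_def by linarith
    have mx: "x \<le> 1280 * l * real m"
    proof -
      have "160 * l * real n \<le> 160 * l * (8 * real m)" using m_lo l0 by (intro mult_left_mono) auto
      then show ?thesis using n160 by simp
    qed
    have m_n: "real m \<le> real n" using m4 by simp
    have x3: "x * x + x + x \<le> x ^ 3"
    proof -
      have "3 \<le> x" using xl l by linarith
      then have "3 * (x * x) \<le> x * (x * x)" "1 * x \<le> x * x" using x0 by (intro mult_right_mono; simp)+
      then show ?thesis by (simp add: power3_eq_cube)
    qed
    show "real d powr (2 - \<delta>) \<le> real M \<or>
       (\<exists>f orc. convex_d d f \<and> lipschitz1_d d f \<and> first_order_oracle d f orc \<and>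
          1 / 2560 * real d powr (1 + \<delta> / 3) / ln (real d) ^ 6 \<le> real (num_queries A M orc))"
    \<comment> \<open>Here d^(\<delta>/3) is only logarithmic and u / l^2 would round down to no
      period at all. A single period with \<open>k\<close> as large as d up to logarithms is enough,
      whatever the memory.\<close>
    proof (cases "u < l\<^sup>2")
      case True
      define k where "k = nat \<lfloor>x / l ^ 4\<rfloor>"
      have q: "1000 \<le> x / l ^ 4" using x1 l0 by (simp add: pos_le_divide_eq)
      have k_up: "real k \<le> x / l ^ 4" and k_lo: "x / l ^ 4 \<le> 2 * real k" and k3: "2 < real k"
        unfolding k_def using q by linarith+
      have kl: "l ^ 4 * real k \<le> x" using k_up l0 by (simp add: pos_le_divide_eq mult.commute)
      have kx: "real k + 2 \<le> x"
      proof -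
        have "1000 * real k \<le> l ^ 4 * real k" using l14 l by (intro mult_right_mono) auto
        then show ?thesis using kl k3 by linarith
      qed
      have N: "100000 * l\<^sup>2 * (real (1 * k) + 2) \<le> x"
      proof -
        have "100000 * l\<^sup>2 * (real k + 2) \<le> l\<^sup>2 * l\<^sup>2 * real k"
        proof -
          have "100000 * (real k + 2) \<le> l\<^sup>2 * real k"
            using mult_right_mono[OF l2' of_nat_0_le_iff[of k]] k3 unfolding distrib_left by linarith
          then have "l\<^sup>2 * (100000 * (real k + 2)) \<le> l\<^sup>2 * (l\<^sup>2 * real k)" by (intro mult_left_mono) auto
          then show ?thesis by (simp add: algebra_simps)
        qed
        then show ?thesis using kl by (simp add: power4_eq_xxxx power2_eq_square mult.assoc)
      qed
      have PN: "5898240 * l * (real (1::nat) + 1)\<^sup>2 * (real (1 * k) + 1) \<le> x"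
      proof -
        have "23592960 * (real k + 1) \<le> l ^ 3 * real k"
          using mult_right_mono[OF l3' of_nat_0_le_iff[of k]] k3 unfolding distrib_left by linarith
        then have "l * (23592960 * (real k + 1)) \<le> l * (l ^ 3 * real k)" using l0 by (intro mult_left_mono) auto
        then show ?thesis using kl by (simp add: power4_eq_xxxx power3_eq_cube algebra_simps)
      qed
      have T: "1 * m + n + 1 * k + 2 \<le> d ^ 3"
      proof -
        have "x \<le> x * x" using x0 by simp
        then have "real m + real n + real k + 2 \<le> x ^ 3" using m_n nx kx x3 by linarith
        then have "real (1 * m + n + 1 * k + 2) \<le> x ^ 3" by simp
        then show ?thesis unfolding x_def by (metis of_nat_le_iff of_nat_power)
      qed
      have "0 < k" using k3 by (cases k) auto
      then obtain f orc where fo: "convex_d d f" "lipschitz1_d d f" "first_order_oracle d f orc"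
        and q: "min (1 * k) (1 * m) \<le> num_queries A M orc"
        using query_lower_bound(1)[of d k 1 n m M A] l xl n80 N PN m4 T alg
        unfolding l_def x_def by force
      have "1 / 2560 * (x * u) / l ^ 6 \<le> real (num_queries A M orc)"
      proof -
        have "x * u \<le> x * l\<^sup>2" using True x0 by (intro mult_left_mono) auto
        then have "1 / 2560 * (x * u) / l ^ 6 \<le> 1 / 2560 * (x * l\<^sup>2) / l ^ 6"
          using l0 by (intro divide_right_mono) auto
        also have "\<dots> = x / l ^ 4 / 2560" using l0 by (simp add: divide_simps numeral_eq_Suc)
        also have "\<dots> \<le> real (min k m)"
        proof -
          have "x / l ^ 4 / 2560 \<le> real k" using k_lo by simp
          moreover have "x / l ^ 4 / 2560 \<le> real m"
          proof -
            have "x \<le> 1280 * l * real m" by (rule mx)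
            also have "\<dots> \<le> 2560 * l ^ 4 * real m" using l14 l0 by (intro mult_right_mono) auto
            finally show ?thesis using l0 by (simp add: divide_le_eq algebra_simps)
          qed
          ultimately show ?thesis by (simp add: min_def)
        qed
        also have "\<dots> \<le> real (num_queries A M orc)" using q by simp
        finally show ?thesis .
      qed
      then have "1 / 2560 * x powr (1 + \<delta> / 3) / l ^ 6 \<le> real (num_queries A M orc)"
        by (simp only: goal_powr)
      then show ?thesis using fo unfolding x_def l_def by blast
    next
      case False
      then have ul: "l\<^sup>2 \<le> u" by simp
      show ?thesis
      proof (cases "real d powr (2 - \<delta>) \<le> real M")
        case mem: False
        then have M: "real M < x\<^sup>2 / u ^ 3" using mem_powr by (simp add: x_def)
        \<comment> \<open>The gap requires P^3 k to be at most d up to logarithms, and k is of order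
          l x / u^3, which leaves u for P. Dividing by l^2 gains a factor l^5 in that product,
          enough to absorb the remaining logarithms and constants.\<close>
        define P where "P = nat \<lfloor>u / l\<^sup>2\<rfloor>"
        \<comment> \<open>The block length at which k n reaches 16 M for every M below d^(2 -
          \<delta>); the 64 added to it is what the final comparison of exponents demands of
          \<open>k\<close>.\<close>
        define y where "y = 16 * (x\<^sup>2 / u ^ 3) / real n"
        define k where "k = nat \<lceil>y\<rceil> + 64"
        have l2: "0 < l\<^sup>2" using l0 by simp
        have q: "1 \<le> u / l\<^sup>2" using ul l2 by (simp add: pos_le_divide_eq)
        have P_up: "real P \<le> u / l\<^sup>2" and P_lo: "u / l\<^sup>2 \<le> 2 * real P" and P1: "1 \<le> real P"
        proof -
          have "1 \<le> \<lfloor>u / l\<^sup>2\<rfloor>" using q by simp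
          then show "real P \<le> u / l\<^sup>2" "u / l\<^sup>2 \<le> 2 * real P" "1 \<le> real P"
            unfolding P_def by linarith+
        qed
        have u0: "0 < u ^ 3" using u1 by simp
        have n0: "0 < real n" using n8 by linarith
        have y0: "0 \<le> y" unfolding y_def using u0 n0 by simp
        have k_lo: "y \<le> real k" and k_up: "real k \<le> y + 65" and k64: "64 \<le> real k"
          unfolding k_def using y0 by linarith+
        have xu: "1 \<le> x / u ^ 3" using u3x u0 by (simp add: pos_le_divide_eq)
        have kub: "real k \<le> 2625 * l * (x / u ^ 3)"
        proof -
          have "y \<le> 2560 * l * (x / u ^ 3)"
          proof -
            define z where "z = x / u ^ 3"
            have "x * (16 * z) \<le> 160 * l * real n * (16 * z)"
              using n160 xu by (intro mult_right_mono) (auto simp: z_def)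
            also have "\<dots> = 2560 * l * z * real n" by simp
            finally have "x * (16 * z) / real n \<le> 2560 * l * z" using n0 by (simp only: pos_divide_le_eq)
            then show ?thesis by (simp add: y_def z_def power2_eq_square mult.left_commute[of x 16])
          qed
          moreover have "1 * 1 \<le> l * (x / u ^ 3)" using xu l by (intro mult_mono) auto
          ultimately show ?thesis using k_up by simp
        qed
        define K where "K = real (P * k)"
        have K: "K = real P * real k" by (simp add: K_def)
        have K64: "64 \<le> K" unfolding K using mult_mono[OF P1 k64] by simp
        have K0: "0 \<le> K" using K64 by simp
        have PPk: "real P ^ 3 * real k * l ^ 5 \<le> 2625 * x"
        proof -
          have "real P ^ 3 * real k \<le> (u / l\<^sup>2) ^ 3 * (2625 * l * (x / u ^ 3))"
            using P_up kub xu l0 u1 by (intro mult_mono power_mono) auto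
          also have "\<dots> = 2625 * x / l ^ 5"
            using l0 u1 by (simp add: power_divide divide_simps power_mult[symmetric]) (simp add: numeral_eq_Suc)
          finally show ?thesis using l0 by (simp add: pos_le_divide_eq)
        qed
        have Kl: "K * l ^ 5 \<le> 2625 * x"
        proof -
          have "real P ^ 1 \<le> real P ^ 3" using P1 by (intro power_increasing) auto
          then have "real P * (real k * l ^ 5) \<le> real P ^ 3 * (real k * l ^ 5)"
            using l0 by (intro mult_right_mono) auto
          then show ?thesis using PPk unfolding K by (simp add: mult.assoc)
        qed
        have N: "100000 * l\<^sup>2 * (K + 2) \<le> x"
        proof -
          have "262500000 * (K + 2) \<le> l ^ 3 * K"
            using mult_right_mono[OF l3' K0] K64 unfolding distrib_left by linarith
          then have "l\<^sup>2 * (262500000 * (K + 2)) \<le> l\<^sup>2 * (l ^ 3 * K)" by (intro mult_left_mono) auto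
          also have "\<dots> = K * l ^ 5" by (simp add: numeral_eq_Suc)
          finally show ?thesis using Kl by (simp add: algebra_simps)
        qed
        have PN: "5898240 * l * (real P + 1)\<^sup>2 * (K + 1) \<le> x"
        proof -
          have "(real P + 1)\<^sup>2 \<le> (2 * real P)\<^sup>2" using P1 by (intro power_mono) auto
          moreover have "K + 1 \<le> 2 * K" using K64 by simp
          ultimately have "(real P + 1)\<^sup>2 * (K + 1) \<le> (2 * real P)\<^sup>2 * (2 * K)"
            using K64 by (intro mult_mono) auto
          also have "\<dots> = 8 * (real P ^ 3 * real k)"
            by (simp add: K power2_eq_square power3_eq_cube)
          finally have "2625 * 5898240 * l * ((real P + 1)\<^sup>2 * (K + 1)) \<le>
              2625 * 5898240 * l * (8 * (real P ^ 3 * real k))"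
            using l0 by (intro mult_left_mono) auto
          also have "\<dots> = (2625 * 5898240 * 8) * (l * (real P ^ 3 * real k))" by simp
          also have "\<dots> \<le> l ^ 4 * (l * (real P ^ 3 * real k))"
            using lpow[of 4] l0 by (intro mult_right_mono) auto
          also have "\<dots> = real P ^ 3 * real k * l ^ 5" by (simp add: numeral_eq_Suc)
          finally have "2625 * (5898240 * l * (real P + 1)\<^sup>2 * (K + 1)) \<le> 2625 * x"
            using PPk by (simp add: mult.assoc mult.commute[of "K + 1" "(real P + 1)\<^sup>2"])
          then show ?thesis by (rule mult_left_le_imp_le) simp
        qed
        have Kn: "144 * l * (K + 1) \<le> real n"
        proof -
          have "2625 * 144 * 160 * (K + 1) \<le> l ^ 3 * K"
            using mult_right_mono[OF l3' K0] K64 unfolding distrib_left by linarith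
          then have "l\<^sup>2 * (2625 * 144 * 160 * (K + 1)) \<le> l\<^sup>2 * (l ^ 3 * K)" by (intro mult_left_mono) auto
          also have "\<dots> = K * l ^ 5" by (simp add: numeral_eq_Suc)
          also have "\<dots> \<le> 2625 * (160 * l * real n)" using Kl n160 by linarith
          finally have "(160 * 2625 * l) * (144 * l * (K + 1)) \<le> (160 * 2625 * l) * real n"
            by (simp add: power2_eq_square algebra_simps)
          moreover have "0 < 160 * 2625 * l" using l0 by simp
          ultimately show ?thesis by (simp only: mult_le_cancel_left_pos)
        qed
        have Mk: "16 * real M \<le> real k * real n"
        proof -
          have "16 * real M \<le> y * real n" using M n0 by (simp add: y_def)
          also have "\<dots> \<le> real k * real n" using k_lo by (intro mult_right_mono) auto
          finally show ?thesis .
        qed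
        have Px: "real P \<le> x"
        proof -
          have "u / l\<^sup>2 \<le> u" using lpow[of 2] u1 by (simp add: divide_le_eq mult_left_le)
          then show ?thesis using P_up ux by linarith
        qed
        have Kx: "K + 2 \<le> x"
        proof -
          have "1 * (K + 2) \<le> 100000 * l\<^sup>2 * (K + 2)" using lpow[of 2] K64 by (intro mult_right_mono) auto
          from order_trans[OF this N] show ?thesis by simp
        qed
        have T: "P * m + n + P * k + 2 \<le> d ^ 3"
        proof -
          have "real P * real m \<le> x * x" using Px m_n nx x0 by (intro mult_mono) auto
          then have "real (P * m + n + P * k + 2) \<le> x ^ 3" using nx Kx x3 K by simp
          then show ?thesis unfolding x_def by (metis of_nat_le_iff of_nat_power)
        qed
        have "0 < k" "64 \<le> k" "0 < P" "0 < n" using k64 P1 n0 by (simp_all add: k_def)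
        then obtain f orc where fo: "convex_d d f" "lipschitz1_d d f" "first_order_oracle d f orc"
          and q: "P * m < num_queries A M orc"
          using query_lower_bound(2)[of d k P n m M A] l xl n80 N PN m4 T alg Kn Mk
          unfolding l_def x_def K_def by force
        have "1 / 2560 * (x * u) / l ^ 6 \<le> real (num_queries A M orc)"
        proof -
          have "u \<le> 2 * real P * l\<^sup>2" using P_lo l2 by (simp add: pos_divide_le_eq)
          then have "x * u \<le> (1280 * l * real m) * (2 * real P * l\<^sup>2)"
            using mx u1 x0 by (intro mult_mono) auto
          also have "\<dots> = 2560 * l ^ 3 * (real P * real m)" by (simp add: power2_eq_square power3_eq_cube)
          also have "\<dots> \<le> 2560 * l ^ 6 * (real P * real m)"
            using power_increasing[of 3 6 l] l by (intro mult_right_mono) auto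
          finally have "1 / 2560 * (x * u) / l ^ 6 \<le> real P * real m"
            using l0 by (simp add: divide_le_eq algebra_simps)
          also have "\<dots> = real (P * m)" by simp
          also have "\<dots> \<le> real (num_queries A M orc)" using q by (intro of_nat_mono) simp
          finally show ?thesis .
        qed
        then have "1 / 2560 * x powr (1 + \<delta> / 3) / l ^ 6 \<le> real (num_queries A M orc)"
          by (simp only: goal_powr)
        then show ?thesis using fo unfolding x_def l_def by blast
      qed simp
    qed
  qed
qed

end
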